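(* Let $B\in\mathbb{C}$ with $|1-B|>1$. If $W_1$ intersects the critical value parabola $C$, then $H_1(W_1)$ is infinitely generated.
   Context: Homology is singular homology with $\mathbb{Z}$ coefficients; $\mathbb{P}^1=\mathbb{C}\cup\{\infty\}$. $N$ is the Newton map for the common zeros of $x(1-x)$ and $y^2+Bxy-y$: $$N(x,y)=\left(\frac{x^2}{2x-1},\ \frac{y(Bx^2+2xy-Bx-y)}{(2x-1)(Bx+2y-1)}\right),$$ a rational self-map of $\mathbb{P}^1\times\mathbb{P}^1$, which restricts to a holomorphic self-map of $X_r=\{(x,y):\mathrm{Re}(x)>1/2,\ x\neq\infty\}$ ($y\in\mathbb{P}^1$). The critical value parabola is $C=\{y^2+Bxy+\frac{B^2}{4}x^2-\frac{B^2}{4}x-y=0\}$. $S_1$ is the set of points of the line $x=1$ equidistant from $(1,0)$ and $(1,1-B)$ together with $(1,\infty)$, and $W_1\subset X_r$ is the set of points whose $N$-orbit converges to $S_1$. *)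

theory Defs
  imports "HOL-Analysis.Analysis" "HOL-Homology.Homology" "HOL-Algebra.Generated_Groups"
begin

text \<open>The Riemann sphere is the one-point compactification of the complex plane:
  \<^term>\<open>Some z\<close> is the finite point \<^term>\<open>z\<close> and \<^term>\<open>None\<close> is the point at infinity.\<close>

definition P1 :: "complex option topology" where
  "P1 = Alexandroff_compactification euclidean"

definition P1xP1 :: "(complex option \<times> complex option) topology" where
  "P1xP1 = prod_topology P1 P1"

text \<open>The quotient as a point of the sphere; meaningful unless both arguments vanish.\<close>

definition ratio :: "complex \<Rightarrow> complex \<Rightarrow> complex option" where
  "ratio a b = (if b = 0 then None else Some (a / b))"

text \<open>The Newton map. The last two equations are the continuous extension of the affine formula
  to the lines at infinity (for \<^prop>\<open>B \<noteq> 0\<close>): as \<^term>\<open>y\<close> tends to infinity the second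
  component is asymptotic to \<^term>\<open>y / 2\<close>, and so it is as \<^term>\<open>x\<close> tends to infinity. The values
  at the points of indeterminacy of the rational map are arbitrary; for \<^prop>\<open>cmod (1 - B) > 1\<close>
  none of these points lies in the region \<open>X_r\<close> below, see \<open>newton_no_indeterminacy\<close>.\<close>

fun newton :: "complex \<Rightarrow> complex option \<times> complex option \<Rightarrow> complex option \<times> complex option" where
  "newton B (Some x, Some y) =
     (ratio (x\<^sup>2) (2 * x - 1),
      ratio (y * (B * x\<^sup>2 + 2 * x * y - B * x - y)) ((2 * x - 1) * (B * x + 2 * y - 1)))"
| "newton B (Some x, None) = (ratio (x\<^sup>2) (2 * x - 1), None)"
| "newton B (None, y) = (None, map_option (\<lambda>z. z / 2) y)"

definition X_r :: "(complex option \<times> complex option) set" where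
  "X_r = {(Some x, y) |x y. Re x > 1 / 2}"

text \<open>The parabola is given by its affine points. Its closure in the product of spheres adds no
  point of \<^const>\<open>X_r\<close>, since its equation is monic in \<^term>\<open>y\<close>.\<close>

definition critical_value_parabola :: "complex \<Rightarrow> (complex option \<times> complex option) set" where
  "critical_value_parabola B =
     {(Some x, Some y) |x y. y\<^sup>2 + B * x * y + B\<^sup>2 / 4 * x\<^sup>2 - B\<^sup>2 / 4 * x - y = 0}"

definition S_1 :: "complex \<Rightarrow> (complex option \<times> complex option) set" where
  "S_1 B = insert (Some 1, None) {(Some 1, Some y) |y. dist y 0 = dist y (1 - B)}"

text \<open>Convergence of a sequence to a set (not to one of its points): every neighbourhood of the
  set contains all but finitely many terms. As \<^const>\<open>S_1\<close> is compact, this says for it that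
  the distance to the set tends to zero, in any compatible metric.\<close>

definition converges_to_set :: "'a topology \<Rightarrow> (nat \<Rightarrow> 'a) \<Rightarrow> 'a set \<Rightarrow> bool" where
  "converges_to_set T s S \<longleftrightarrow> (\<forall>U. openin T U \<and> S \<subseteq> U \<longrightarrow> (\<forall>\<^sub>F n in sequentially. s n \<in> U))"

definition W_1 :: "complex \<Rightarrow> (complex option \<times> complex option) set" where
  "W_1 B = {p \<in> X_r. converges_to_set P1xP1 (\<lambda>n. (newton B ^^ n) p) (S_1 B)}"

definition finitely_generated_group :: "('a, 'b) monoid_scheme \<Rightarrow> bool" where
  "finitely_generated_group G \<longleftrightarrow> (\<exists>A. finite A \<and> A \<subseteq> carrier G \<and> generate G A = carrier G)"

lemma Re_newton:
  assumes "Re x > 1 / 2"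
  shows "Re (x\<^sup>2 / (2 * x - 1)) > 1 / 2"
proof -
  define a where "a = 2 * x - 1"
  have a: "Re a > 0" using assms by (simp add: a_def)
  then have a0: "a \<noteq> 0" by auto
  have x: "x = (a + 1) / 2" by (simp add: a_def)
  have "x\<^sup>2 / a = 1 / 2 + (a + 1 / a) / 4"
    using a0 unfolding x by (simp add: field_simps power2_eq_square)
  moreover have "Re (1 / a) > 0" using a by (simp add: Re_divide sum_power2_gt_zero_iff)
  ultimately show ?thesis using a by (simp add: a_def)
qed

lemma newton_X_r: "p \<in> X_r \<Longrightarrow> newton B p \<in> X_r"
proof -
  assume "p \<in> X_r"
  then obtain x y where p: "p = (Some x, y)" and x: "Re x > 1 / 2" by (auto simp: X_r_def)
  have "2 * x - 1 \<noteq> 0" using x by (auto simp: complex_eq_iff)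
  then show ?thesis using Re_newton[OF x] p by (cases y) (auto simp: X_r_def ratio_def)
qed

lemma half_plane_inverse:
  fixes c :: complex
  assumes "cmod (1 - c) > 1" "c * x = 1"
  shows "Re x < 1 / 2"
proof -
  have "c \<noteq> 0" using assms by auto
  then have x: "x = 1 / c" using assms by (simp add: field_simps)
  have "(Re c)\<^sup>2 + (Im c)\<^sup>2 > 2 * Re c"
  proof -
    have "(cmod (1 - c))\<^sup>2 > 1" using assms(1) by (simp add: power2_eq_square less_1_mult)
    then show ?thesis unfolding cmod_power2 by (simp add: power2_eq_square algebra_simps)
  qed
  moreover have "(Re c)\<^sup>2 + (Im c)\<^sup>2 > 0"
    using \<open>c \<noteq> 0\<close> by (simp add: complex_eq_iff sum_power2_gt_zero_iff)
  ultimately show ?thesis unfolding x by (simp add: Re_divide field_simps)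
qed

lemma newton_no_indeterminacy:
  fixes B x y :: complex
  assumes B: "cmod (1 - B) > 1" and x: "Re x > 1 / 2"
    and den: "(2 * x - 1) * (B * x + 2 * y - 1) = 0"
  shows "y * (B * x\<^sup>2 + 2 * x * y - B * x - y) \<noteq> 0"
proof
  assume num: "y * (B * x\<^sup>2 + 2 * x * y - B * x - y) = 0"
  have "2 * x - 1 \<noteq> 0" using x by (auto simp: complex_eq_iff)
  then have "B * x + 2 * y - 1 = 0" using den by simp
  then have y: "y = (1 - B * x) / 2" by (simp add: field_simps) algebra
  consider "B * x = 1" | "B * x\<^sup>2 + 2 * x * y - B * x - y = 0" using num y by auto
  then show False
  proof cases
    case 1
    then show False using half_plane_inverse[OF B] x by force
  next
    case 2
    then have "(2 - B) * x = 1" unfolding y by (simp add: field_simps power2_eq_square)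
    moreover have "cmod (1 - (2 - B)) > 1" using B by (simp add: norm_minus_commute)
    ultimately show False using half_plane_inverse x by force
  qed
qed

end

theory Submission
  imports Defs "HOL-Complex_Analysis.Complex_Analysis"
begin

text \<open>With \<open>w = 1 - 1 / x\<close> the base map becomes \<open>w \<mapsto> w\<^sup>2\<close> on the unit disc. Put \<open>U = 2 y + B x - 1\<close>; the
  critical values in the fibre over \<open>w\<close> are \<open>U = s w\<close> and \<open>U = - s w\<close> for a holomorphic \<open>s\<close> without
  zeros, and in the coordinate \<open>z = (U - s w) / (U + s w)\<close> the map on fibres is a Moebius
  transformation close to the identity near \<open>w = 0\<close>, followed by \<open>z \<mapsto> z\<^sup>2\<close>. Points of \<open>W_1\<close> are
  those whose orbits end up in an annulus around the circle \<open>|z| = 1\<close>, which is \<open>S_1\<close>.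

  For a 1-cycle in \<open>W_1\<close> let \<open>\<theta>_n\<close> be the winding number around 0 of the \<open>z\<close>-coordinate of its \<open>n\<close>-th
  image. It is an integer for large \<open>n\<close>, it then doubles with each step, and it vanishes on
  boundaries, so \<open>\<theta>_n / 2 ^ n\<close> defines a homomorphism from the homology group to the dyadic rationals,
  with value 1 on \<open>S_1\<close>. Paths can be lifted through the map. A loop based at a critical value
  lifts to a loop because the two preimages in the fibre coincide there, and lifting halves the
  invariant. As \<open>W_1\<close> is path connected, the lift can be conjugated back to the critical value and
  the step repeated. The invariant therefore takes all values \<open>1 / 2 ^ k\<close>, which is impossible on a
  finitely generated group.\<close>

section \<open>Winding numbers of singular 1-chains\<close>

text \<open>In terms of \<open>U\<close>, the map from the fibre over w to the fibre over w^2 is U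
  -> (U^2 + s1^2) / (2 U), where s1 is \<open>s\<close> at w^2. This is Newton's iteration for a
  square root of s1^2, and it squares (U - s1) / (U + s1); the Moebius factor only converts the
  normalisation by \<open>s\<close> at w into that by s1. In homogeneous coordinates y = infinity is
  the ordinary point p = q, and lifting a path means taking square roots of two paths that may pass
  through 0. Three obstacles shape the rest. The coordinate of the n-th image is under control only
  where w^(2^n) is small, so statements about winding hold for large n, with a bound depending on
  the simplex; this is where the denominators of the invariant come from. Path connectedness is not
  evident: a point is joined to the circle by a leaf over the segment from w to 0, obtained as the
  fixed point of a contraction. And w -> w^2 is itself branched at 0, so a lifted loop closes only
  if its base coordinate lifts to a loop; the loops are therefore kept over a half plane in
  w.\<close>

definition chain_eval :: "('a \<Rightarrow> complex) \<Rightarrow> ('a \<Rightarrow>\<^sub>0 int) \<Rightarrow> complex" where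
  "chain_eval h c = (\<Sum>x\<in>Poly_Mapping.keys c. of_int (Poly_Mapping.lookup c x) * h x)"

lemma chain_eval_superset:
  assumes "finite A" "Poly_Mapping.keys c \<subseteq> A"
  shows "chain_eval h c = (\<Sum>x\<in>A. of_int (Poly_Mapping.lookup c x) * h x)"
  unfolding chain_eval_def using assms
  by (intro sum.mono_neutral_left) (auto simp: in_keys_iff)

lemma chain_eval_0 [simp]: "chain_eval h 0 = 0"
  by (simp add: chain_eval_def)

lemma chain_eval_frag_of [simp]: "chain_eval h (frag_of x) = h x"
  by (simp add: chain_eval_def)

lemma chain_eval_add: "chain_eval h (c + d) = chain_eval h c + chain_eval h d"
proof -
  let ?A = "Poly_Mapping.keys c \<union> Poly_Mapping.keys d"
  have "chain_eval h (c + d) = (\<Sum>x\<in>?A. of_int (Poly_Mapping.lookup (c + d) x) * h x)"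
    by (rule chain_eval_superset) (auto simp: Poly_Mapping.keys_add)
  moreover have "chain_eval h c = (\<Sum>x\<in>?A. of_int (Poly_Mapping.lookup c x) * h x)"
    "chain_eval h d = (\<Sum>x\<in>?A. of_int (Poly_Mapping.lookup d x) * h x)"
    by (rule chain_eval_superset; simp)+
  ultimately show ?thesis
    by (simp add: lookup_add algebra_simps sum.distrib)
qed

lemma chain_eval_cmul: "chain_eval h (frag_cmul k c) = of_int k * chain_eval h c"
proof -
  have "chain_eval h (frag_cmul k c) =
      (\<Sum>x\<in>Poly_Mapping.keys c. of_int (Poly_Mapping.lookup (frag_cmul k c) x) * h x)"
    by (rule chain_eval_superset) (auto simp: keys_cmul)
  then show ?thesis
    by (simp add: chain_eval_def sum_distrib_left mult.assoc)
qed

lemma chain_eval_diff: "chain_eval h (c - d) = chain_eval h c - chain_eval h d"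
  using chain_eval_add[of h "c - d" d] by (simp add: algebra_simps)

lemma chain_eval_uminus: "chain_eval h (- c) = - chain_eval h c"
  using chain_eval_diff[of h 0 c] by simp

lemma chain_eval_sum: "finite I \<Longrightarrow> chain_eval h (sum f I) = (\<Sum>i\<in>I. chain_eval h (f i))"
  by (induction I rule: finite_induct) (auto simp: chain_eval_add)

lemma chain_eval_frag_extend:
  "chain_eval h (frag_extend f c) = chain_eval (\<lambda>x. chain_eval h (f x)) c"
  by (simp add: frag_extend_def chain_eval_sum chain_eval_cmul) (simp add: chain_eval_def)

lemma chain_eval_cong:
  "(\<And>x. x \<in> Poly_Mapping.keys c \<Longrightarrow> g x = h x) \<Longrightarrow> chain_eval g c = chain_eval h c"
  by (simp add: chain_eval_def)

lemma chain_eval_linear: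
  "chain_eval (\<lambda>x. k * g x + h x) c = k * chain_eval g c + chain_eval h c"
  by (simp add: chain_eval_def algebra_simps sum.distrib sum_distrib_left)

lemma chain_eval_Ints: "(\<And>x. x \<in> Poly_Mapping.keys c \<Longrightarrow> h x \<in> \<int>) \<Longrightarrow> chain_eval h c \<in> \<int>"
  unfolding chain_eval_def by (intro Ints_sum Ints_mult) auto

section \<open>Winding numbers along the edges of singular simplices\<close>

definition edge :: "real \<Rightarrow> nat \<Rightarrow> real" where
  "edge t = (\<lambda>i. if i = 0 then 1 - t else if i = 1 then t else 0)"

lemma edge_in_standard_simplex: "t \<in> {0..1} \<Longrightarrow> edge t \<in> standard_simplex 1"
  by (auto simp: edge_def standard_simplex_def)

lemma continuous_map_edge:
  "continuous_map (top_of_set {0..1}) (subtopology (powertop_real UNIV) (standard_simplex 1)) edge"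
proof -
  have "continuous_map (top_of_set {0..1}) euclideanreal (\<lambda>t. edge t i)" for i
    by (cases "i = 0"; cases "i = 1") (auto simp: edge_def intro!: continuous_intros)
  then show ?thesis
    using edge_in_standard_simplex
    by (auto simp: continuous_map_in_subtopology continuous_map_componentwise_UNIV)
qed

text \<open>Continuity is asked of the composition with the simplex only: \<open>f\<close> will be
  \<open>Z_down n\<close>, which is under control only on a part of \<open>W_1\<close> that grows
  with \<open>n\<close>.\<close>

definition nonvanishing_on_simplex :: "nat \<Rightarrow> ('a \<Rightarrow> complex) \<Rightarrow> ((nat \<Rightarrow> real) \<Rightarrow> 'a) \<Rightarrow> bool" where
  "nonvanishing_on_simplex p f \<sigma> \<longleftrightarrow>
     continuous_map (subtopology (powertop_real UNIV) (standard_simplex p)) euclidean (f \<circ> \<sigma>) \<and>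
     (\<forall>x\<in>standard_simplex p. f (\<sigma> x) \<noteq> 0)"

text \<open>For an edge that is not closed this is the increment of a continuous logarithm divided
  by \<open>2 * pi * \<i>\<close>. It is complex in general; integrality holds on cycles.\<close>

definition edge_winding :: "('a \<Rightarrow> complex) \<Rightarrow> ((nat \<Rightarrow> real) \<Rightarrow> 'a) \<Rightarrow> complex" where
  "edge_winding f \<sigma> = winding_number (\<lambda>t. f (\<sigma> (edge t))) 0"

lemma path_along_edge:
  assumes "nonvanishing_on_simplex 1 f \<sigma>"
  shows "path (\<lambda>t. f (\<sigma> (edge t)))" "0 \<notin> path_image (\<lambda>t. f (\<sigma> (edge t)))"
proof -
  have "continuous_map (top_of_set {0..1}) euclidean ((f \<circ> \<sigma>) \<circ> edge)"
    using assms by (intro continuous_map_compose[OF continuous_map_edge])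
      (simp add: nonvanishing_on_simplex_def)
  then show "path (\<lambda>t. f (\<sigma> (edge t)))"
    by (simp add: path_def o_def)
  show "0 \<notin> path_image (\<lambda>t. f (\<sigma> (edge t)))"
    using assms edge_in_standard_simplex by (force simp: nonvanishing_on_simplex_def path_image_def)
qed

lemma winding_number_exp_path:
  assumes "continuous_on {0..1} q" "\<And>t. t \<in> {0..1} \<Longrightarrow> p t = exp (q t)"
  shows "winding_number p 0 = (q 1 - q 0) / (2 * pi * \<i>)"
proof -
  have "winding_number p 0 = winding_number (exp \<circ> q) 0"
    by (rule winding_number_cong) (use assms in auto)
  also have "\<dots> = (q 1 - q 0) / (2 * pi * \<i>)"
    using winding_number_compose_exp[of q] assms by (simp add: path_def pathfinish_def pathstart_def)
  finally show ?thesis .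
qed

lemma path_has_log:
  assumes "path p" "0 \<notin> path_image p"
  shows "\<exists>q. path q \<and> winding_number p 0 = (q 1 - q 0) / (2 * pi * \<i>) \<and> (\<forall>t\<in>{0..1}. p t = exp (q t))"
proof (rule winding_number_as_continuous_log[OF assms])
  fix q
  assume q: "path q" "pathfinish q - pathstart q = 2 * of_real pi * \<i> * winding_number p 0"
    "\<And>t. t \<in> {0..1} \<Longrightarrow> p t = 0 + exp (q t)"
  have "winding_number p 0 = (q 1 - q 0) / (2 * pi * \<i>)"
    using q(2) by (simp add: pathfinish_def pathstart_def)
  then show ?thesis using q by auto
qed

text \<open>A nonvanishing continuous function on a triangle has a continuous logarithm
  \<open>g\<close>, so each edge contributes a difference of two vertex values of \<open>g\<close>,
  and with the signs of the boundary these differences cancel.\<close>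

lemma edge_winding_boundary_simplex:
  assumes "nonvanishing_on_simplex 2 f \<tau>"
  shows "chain_eval (edge_winding f) (chain_boundary 2 (frag_of \<tau>)) = 0"
proof -
  \<comment> \<open>The logarithm is taken on a plane triangle, since the standard simplex lives in
    a function space; \<open>P\<close> gives barycentric coordinates.\<close>
  define T :: "(real \<times> real) set" where "T = {(a, b). 0 \<le> a \<and> 0 \<le> b \<and> a + b \<le> 1}"
  define P :: "real \<times> real \<Rightarrow> nat \<Rightarrow> real" where
    "P = (\<lambda>(a, b) i. if i = 0 then 1 - a - b else if i = 1 then a else if i = 2 then b else 0)"
  have T: "convex T"
  proof -
    have "T = {x. inner (- 1, 0) x \<le> 0} \<inter> {x. inner (0, - 1) x \<le> 0} \<inter> {x. inner (1, 1) x \<le> 1}"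
      by (auto simp: T_def)
    then show ?thesis by (simp only: convex_Int convex_halfspace_le)
  qed
  have Pin: "P ` T \<subseteq> standard_simplex 2"
    by (auto simp: P_def T_def standard_simplex_def numeral_2_eq_2)
  have "continuous_map (top_of_set T) euclideanreal (\<lambda>x. P x i)" for i
    by (cases "i = 0"; cases "i = 1"; cases "i = 2")
       (auto simp: P_def case_prod_unfold intro!: continuous_intros)
  then have "continuous_map (top_of_set T) (subtopology (powertop_real UNIV) (standard_simplex 2)) P"
    using Pin by (auto simp: continuous_map_in_subtopology continuous_map_componentwise_UNIV)
  then have "continuous_map (top_of_set T) euclidean ((f \<circ> \<tau>) \<circ> P)"
    using assms by (intro continuous_map_compose[OF \<open>continuous_map _ _ P\<close>])
      (simp add: nonvanishing_on_simplex_def)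
  then have "continuous_on T (\<lambda>x. f (\<tau> (P x)))" by (simp add: o_def)
  moreover have "f (\<tau> (P x)) \<noteq> 0" if "x \<in> T" for x
    using assms Pin that by (auto simp: nonvanishing_on_simplex_def)
  ultimately have "\<exists>g. continuous_on T g \<and> (\<forall>x\<in>T. f (\<tau> (P x)) = exp (g x))"
    by (rule continuous_logarithm_on_contractible[OF _ convex_imp_contractible[OF T]]) auto
  then obtain g where g: "continuous_on T g" "\<And>x. x \<in> T \<Longrightarrow> f (\<tau> (P x)) = exp (g x)"
    by blast
  have face: "edge_winding f (singular_face 2 k \<tau>) = (g (e 1) - g (e 0)) / (2 * pi * \<i>)"
    if "\<And>t. t \<in> {0..1} \<Longrightarrow> e t \<in> T" "\<And>t. simplical_face k (edge t) = P (e t)" "continuous_on {0..1} e"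
    for k e
    unfolding edge_winding_def
  proof (rule winding_number_exp_path)
    show "continuous_on {0..1} (\<lambda>t. g (e t))"
      using that g(1) by (intro continuous_on_compose2[OF g(1) that(3)]) auto
    show "f (singular_face 2 k \<tau> (edge t)) = exp (g (e t))" if "t \<in> {0..1}" for t
      using that g(2) \<open>\<And>t. t \<in> {0..1} \<Longrightarrow> e t \<in> T\<close> \<open>\<And>t. simplical_face k (edge t) = P (e t)\<close>
        edge_in_standard_simplex by (simp add: singular_face_def)
  qed
  have 0: "edge_winding f (singular_face 2 0 \<tau>) = (g (0, 1) - g (1, 0)) / (2 * pi * \<i>)"
    by (subst face[where e="\<lambda>t. (1 - t, t)"])
       (auto simp: T_def P_def simplical_face_def edge_def fun_eq_iff intro!: continuous_intros)
  have 1: "edge_winding f (singular_face 2 1 \<tau>) = (g (0, 1) - g (0, 0)) / (2 * pi * \<i>)"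
    by (subst face[where e="\<lambda>t. (0, t)"])
       (auto simp: T_def P_def simplical_face_def edge_def fun_eq_iff intro!: continuous_intros)
  have 2: "edge_winding f (singular_face 2 2 \<tau>) = (g (1, 0) - g (0, 0)) / (2 * pi * \<i>)"
    by (subst face[where e="\<lambda>t. (t, 0)"])
       (auto simp: T_def P_def simplical_face_def edge_def fun_eq_iff intro!: continuous_intros)
  have "chain_boundary 2 (frag_of \<tau>) = frag_of (singular_face 2 0 \<tau>)
      - frag_of (singular_face 2 1 \<tau>) + frag_of (singular_face 2 2 \<tau>)"
    by (simp add: chain_boundary_of numeral_2_eq_2)
  then show ?thesis
    using 0 1 2 by (simp add: chain_eval_add chain_eval_diff diff_divide_distrib)
qed

lemma edge_winding_boundary:
  assumes "\<And>\<tau>. \<tau> \<in> Poly_Mapping.keys d \<Longrightarrow> nonvanishing_on_simplex 2 f \<tau>"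
  shows "chain_eval (edge_winding f) (chain_boundary 2 d) = 0"
proof -
  have "chain_eval (edge_winding f) (chain_boundary 2 d) =
      chain_eval (\<lambda>\<tau>. chain_eval (edge_winding f) (chain_boundary 2 (frag_of \<tau>))) d"
    by (simp add: chain_boundary_def chain_eval_frag_extend)
  also have "\<dots> = chain_eval (\<lambda>_. 0) d"
    by (rule chain_eval_cong) (use assms edge_winding_boundary_simplex in auto)
  finally show ?thesis by (simp add: chain_eval_def)
qed

text \<open>The summand is the coboundary of the vertex function \<open>g\<close>, so the sum over
  \<open>c\<close> is \<open>g\<close> evaluated on the boundary of \<open>c\<close>. Even a
  discontinuous \<open>g\<close>, such as a principal logarithm, is allowed.\<close>

lemma chain_eval_endpoints_cycle:
  assumes "chain_boundary 1 c = 0"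
  shows "chain_eval (\<lambda>\<sigma>. g (\<sigma> (edge 1)) - g (\<sigma> (edge 0))) c = 0"
proof -
  define G where "G = (\<lambda>\<rho>::(nat \<Rightarrow> real) \<Rightarrow> 'a. g (\<rho> (\<lambda>i. if i = 0 then 1 else 0)))"
  have v: "(\<lambda>i. if i = 0 then 1 else 0) \<in> standard_simplex 0" by simp
  have e: "simplical_face 0 (\<lambda>i. if i = 0 then 1 else 0) = edge 1"
    "simplical_face (Suc 0) (\<lambda>i. if i = 0 then 1 else 0) = edge 0"
    by (auto simp: simplical_face_def edge_def fun_eq_iff)
  have "chain_eval G (chain_boundary 1 (frag_of \<sigma>)) = g (\<sigma> (edge 1)) - g (\<sigma> (edge 0))" for \<sigma>
    using v by (simp add: chain_boundary_of chain_eval_add chain_eval_diff G_def singular_face_def e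
        chain_eval_uminus)
  then have "chain_eval (\<lambda>\<sigma>. g (\<sigma> (edge 1)) - g (\<sigma> (edge 0))) c = chain_eval G (chain_boundary 1 c)"
    by (simp add: chain_boundary_def chain_eval_frag_extend)
  then show ?thesis using assms by simp
qed

text \<open>On each edge the increment of a continuous logarithm differs from the increment of the
  principal one, taken at the two ends, by an integer multiple of \<open>2 * pi * \<i>\<close>. The
  principal increments cancel on a cycle.\<close>

lemma edge_winding_cycle_Ints:
  assumes "chain_boundary 1 c = 0"
    and "\<And>\<sigma>. \<sigma> \<in> Poly_Mapping.keys c \<Longrightarrow> nonvanishing_on_simplex 1 f \<sigma>"
  shows "chain_eval (edge_winding f) c \<in> \<int>"
proof -
  define L where "L = (\<lambda>x. Ln (f x) / (2 * pi * \<i>))"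
  define k where "k = (\<lambda>\<sigma>. edge_winding f \<sigma> - (L (\<sigma> (edge 1)) - L (\<sigma> (edge 0))))"
  have "k \<sigma> \<in> \<int>" if \<sigma>: "\<sigma> \<in> Poly_Mapping.keys c" for \<sigma>
  proof -
    note p = path_along_edge[OF assms(2)[OF \<sigma>]]
    obtain q where q: "path q" "edge_winding f \<sigma> = (q 1 - q 0) / (2 * pi * \<i>)"
      "\<And>t. t \<in> {0..1} \<Longrightarrow> f (\<sigma> (edge t)) = exp (q t)"
      using path_has_log[OF p] unfolding edge_winding_def by auto
    have n: "exp (q t) = exp (Ln (f (\<sigma> (edge t))))" if "t \<in> {0..1}" for t
      using q(3)[OF that] by simp
    obtain m1 where m1: "q 1 = Ln (f (\<sigma> (edge 1))) + of_int (2 * m1) * pi * \<i>"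
      using n[of 1] by (auto simp: exp_eq dest: sym)
    obtain m0 where m0: "q 0 = Ln (f (\<sigma> (edge 0))) + of_int (2 * m0) * pi * \<i>"
      using n[of 0] by (auto simp: exp_eq dest: sym)
    have "k \<sigma> = of_int (m1 - m0)"
      unfolding k_def L_def q(2) m1 m0 by (simp add: field_simps)
    then show ?thesis by (metis Ints_of_int)
  qed
  then have "chain_eval k c \<in> \<int>" by (rule chain_eval_Ints)
  moreover have "chain_eval (edge_winding f) c =
      chain_eval (\<lambda>\<sigma>. 1 * k \<sigma> + (L (\<sigma> (edge 1)) - L (\<sigma> (edge 0)))) c"
    by (rule chain_eval_cong) (simp add: k_def)
  then have "chain_eval (edge_winding f) c = chain_eval k c"
    using chain_eval_endpoints_cycle[OF assms(1)] by (simp only: chain_eval_linear) simp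
  ultimately show ?thesis by simp
qed

text \<open>The quotient \<open>g / f\<^sup>2\<close> stays in the right half plane, where
  \<open>Ln\<close> is continuous, so twice a logarithm of \<open>f\<close> plus \<open>Ln\<close>
  of the quotient is a logarithm of \<open>g\<close>. The \<open>Ln\<close> terms depend on end
  points only and cancel on a cycle, which makes the doubling exact.\<close>

lemma edge_winding_cycle_square:
  assumes c: "chain_boundary 1 c = 0"
    and f: "\<And>\<sigma>. \<sigma> \<in> Poly_Mapping.keys c \<Longrightarrow> nonvanishing_on_simplex 1 f \<sigma>"
    and g: "\<And>\<sigma>. \<sigma> \<in> Poly_Mapping.keys c \<Longrightarrow> nonvanishing_on_simplex 1 g \<sigma>"
    and near: "\<And>\<sigma> x. \<sigma> \<in> Poly_Mapping.keys c \<Longrightarrow> x \<in> standard_simplex 1 \<Longrightarrow>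
        Re (g (\<sigma> x) / (f (\<sigma> x))\<^sup>2) > 0"
  shows "chain_eval (edge_winding g) c = 2 * chain_eval (edge_winding f) c"
proof -
  define L where "L = (\<lambda>x. Ln (g x / (f x)\<^sup>2) / (2 * pi * \<i>))"
  have "edge_winding g \<sigma> = 2 * edge_winding f \<sigma> + (L (\<sigma> (edge 1)) - L (\<sigma> (edge 0)))"
    if \<sigma>: "\<sigma> \<in> Poly_Mapping.keys c" for \<sigma>
  proof -
    note p = path_along_edge[OF f[OF \<sigma>]] and pg = path_along_edge[OF g[OF \<sigma>]]
    obtain q where q: "path q" "edge_winding f \<sigma> = (q 1 - q 0) / (2 * pi * \<i>)"
      "\<And>t. t \<in> {0..1} \<Longrightarrow> f (\<sigma> (edge t)) = exp (q t)"
      using path_has_log[OF p] unfolding edge_winding_def by auto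
    let ?l = "\<lambda>t. Ln (g (\<sigma> (edge t)) / (f (\<sigma> (edge t)))\<^sup>2)"
    have re: "Re (g (\<sigma> (edge t)) / (f (\<sigma> (edge t)))\<^sup>2) > 0" if "t \<in> {0..1}" for t
      using near[OF \<sigma> edge_in_standard_simplex[OF that]] .
    have nz: "f (\<sigma> (edge t)) \<noteq> 0" "g (\<sigma> (edge t)) \<noteq> 0" if "t \<in> {0..1}" for t
      using f[OF \<sigma>] g[OF \<sigma>] edge_in_standard_simplex[OF that]
      by (auto simp: nonvanishing_on_simplex_def)
    have "edge_winding g \<sigma> = ((2 * q 1 + ?l 1) - (2 * q 0 + ?l 0)) / (2 * pi * \<i>)"
      unfolding edge_winding_def
    proof (rule winding_number_exp_path)
      show "continuous_on {0..1} (\<lambda>t. 2 * q t + ?l t)"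
        using q(1) p(1) pg(1) nz re unfolding path_def
        by (intro continuous_intros) (force simp: complex_nonpos_Reals_iff)+
      show "g (\<sigma> (edge t)) = exp (2 * q t + ?l t)" if "t \<in> {0..1}" for t
        using q(3)[OF that] nz[OF that] by (simp add: exp_add exp_double)
    qed
    then show ?thesis
      unfolding q(2) by (simp add: L_def diff_divide_distrib add_divide_distrib)
  qed
  then have "chain_eval (edge_winding g) c =
      chain_eval (\<lambda>\<sigma>. 2 * edge_winding f \<sigma> + (L (\<sigma> (edge 1)) - L (\<sigma> (edge 0)))) c"
    by (rule chain_eval_cong)
  then show ?thesis
    using chain_eval_endpoints_cycle[OF c] by (simp only: chain_eval_linear) simp
qed

text \<open>In \<open>mult_relative_homology_group\<close> the product of two classes is the set of
  sums of their elements; this turns it into the class of a sum.\<close>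

lemma homologous_rel_set_add:
  "(\<Union>r\<in>homologous_rel_set p X S c. \<Union>s\<in>homologous_rel_set p X S d. {r + s})
    = homologous_rel_set p X S (c + d)"
proof (intro Set.set_eqI iffI)
  fix t assume "t \<in> homologous_rel_set p X S (c + d)"
  then have "singular_relboundary p X S (d - (t - c))"
    by (simp add: homologous_rel_def algebra_simps)
  then have "homologous_rel p X S d (t - c)" by (simp add: homologous_rel_def)
  then show "t \<in> (\<Union>r\<in>homologous_rel_set p X S c. \<Union>s\<in>homologous_rel_set p X S d. {r + s})"
    by (intro UN_I[of c] UN_I[of "t - c"]) auto
qed (auto simp: homologous_rel_add)

lemma homologous_rel_set_uminus:
  "uminus ` homologous_rel_set p X S c = homologous_rel_set p X S (- c)"
proof (intro Set.set_eqI iffI)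
  fix t assume "t \<in> uminus ` homologous_rel_set p X S c"
  then show "t \<in> homologous_rel_set p X S (- c)"
    using homologous_rel_diff[of p X S 0 0 c] by (auto simp: image_iff)
next
  fix t assume "t \<in> homologous_rel_set p X S (- c)"
  then show "t \<in> uminus ` homologous_rel_set p X S c"
    using homologous_rel_diff[of p X S 0 0 "- c" t] by (auto simp: image_iff intro!: exI[of _ "- t"])
qed

text \<open>The sets \<open>S N\<close> form an increasing chain of subgroups that exhausts the
  group, so a finite generating set lies in a single one, which is then everything. Membership in
  \<open>S N\<close> asks for one representative with the right invariant; \<open>triangles\<close>
  enters at the end, to compare that representative with a given loop.\<close>

lemma not_finitely_generated_homology_1:
  fixes Z :: "nat \<Rightarrow> 'a \<Rightarrow> complex"
  assumes edges: "\<And>\<sigma>. singular_simplex 1 X \<sigma> \<Longrightarrow>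
      \<forall>\<^sub>F n in sequentially. nonvanishing_on_simplex 1 (Z n) \<sigma> \<and>
        (\<forall>x\<in>standard_simplex 1. Re (Z (Suc n) (\<sigma> x) / (Z n (\<sigma> x))\<^sup>2) > 0)"
    and triangles: "\<And>\<tau>. singular_simplex 2 X \<tau> \<Longrightarrow>
      \<forall>\<^sub>F n in sequentially. nonvanishing_on_simplex 2 (Z n) \<tau>"
    and loops: "\<And>k. \<exists>\<sigma>. singular_simplex 1 X \<sigma> \<and> \<sigma> (edge 0) = \<sigma> (edge 1) \<and>
      (\<forall>\<^sub>F n in sequentially. edge_winding (Z n) \<sigma> = 2 ^ n / 2 ^ k)"
  shows "\<not> finitely_generated_group (homology_group 1 X)"
proof
  define \<Phi> where "\<Phi> = (\<lambda>c n. chain_eval (edge_winding (Z n)) c)"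
  define S where "S = (\<lambda>N. {homologous_rel_set 1 X {} c |c. singular_relcycle 1 X {} c \<and>
      (\<exists>m::int. \<forall>\<^sub>F n in sequentially. \<Phi> c n = 2 ^ n * of_int m / 2 ^ N)})"
  let ?H = "relative_homology_group (int 1) X {}"
  have cycle: "\<exists>N. homologous_rel_set 1 X {} c \<in> S N" if c: "singular_relcycle 1 X {} c" for c
  proof -
    have c': "singular_chain 1 X c" "chain_boundary 1 c = 0"
      using c by (auto simp: singular_cycle)
    have "\<forall>\<^sub>F n in sequentially. \<forall>\<sigma>\<in>Poly_Mapping.keys c. nonvanishing_on_simplex 1 (Z n) \<sigma> \<and>
        (\<forall>x\<in>standard_simplex 1. Re (Z (Suc n) (\<sigma> x) / (Z n (\<sigma> x))\<^sup>2) > 0)"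
      by (rule eventually_ball_finite) (use c'(1) edges in \<open>auto simp: singular_chain_def\<close>)
    then obtain N where N: "\<And>n \<sigma>. n \<ge> N \<Longrightarrow> \<sigma> \<in> Poly_Mapping.keys c \<Longrightarrow> nonvanishing_on_simplex 1 (Z n) \<sigma>"
       "\<And>n \<sigma> x. n \<ge> N \<Longrightarrow> \<sigma> \<in> Poly_Mapping.keys c \<Longrightarrow> x \<in> standard_simplex 1
          \<Longrightarrow> Re (Z (Suc n) (\<sigma> x) / (Z n (\<sigma> x))\<^sup>2) > 0"
      unfolding eventually_sequentially by blast
    \<comment> \<open>\<open>N\<close> is a time from which all edges of \<open>c\<close> are tame.
      The value there is an integer \<open>m\<close>, and exact doubling afterwards gives the
      invariant \<open>m / 2 ^ N\<close>.\<close>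
    have "\<Phi> c N \<in> \<int>"
      unfolding \<Phi>_def by (rule edge_winding_cycle_Ints) (use N c' in auto)
    then obtain m where m: "\<Phi> c N = of_int m" by (auto elim: Ints_cases)
    have step: "\<Phi> c (Suc n) = 2 * \<Phi> c n" if "n \<ge> N" for n
      unfolding \<Phi>_def by (rule edge_winding_cycle_square) (use N that c' in auto)
    have "\<Phi> c n = 2 ^ n * of_int m / 2 ^ N" if "n \<ge> N" for n
      using that by (induction n rule: dec_induct) (simp_all add: m step)
    then have "\<forall>\<^sub>F n in sequentially. \<Phi> c n = 2 ^ n * of_int m / 2 ^ N"
      unfolding eventually_sequentially by blast
    then show ?thesis using c unfolding S_def by blast
  qed
  have S_mono: "S M \<subseteq> S N" if "M \<le> N" for M N
  proof
    fix a assume "a \<in> S M"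
    then obtain c m where c: "a = homologous_rel_set 1 X {} c" "singular_relcycle 1 X {} c"
      and m: "\<forall>\<^sub>F n in sequentially. \<Phi> c n = 2 ^ n * of_int m / 2 ^ M"
      unfolding S_def by blast
    have "(2::complex) ^ N = 2 ^ M * 2 ^ (N - M)"
      using that by (simp flip: power_add)
    then have "(of_int m :: complex) / 2 ^ M = of_int (m * 2 ^ (N - M)) / 2 ^ N"
      by simp
    then have "\<forall>\<^sub>F n in sequentially. \<Phi> c n = 2 ^ n * of_int (m * 2 ^ (N - M)) / 2 ^ N"
      using m by (metis (mono_tags, lifting) eventually_mono times_divide_eq_right)
    then show "a \<in> S N" using c unfolding S_def by blast
  qed
  have S_add: "a \<otimes>\<^bsub>?H\<^esub> b \<in> S N" if a: "a \<in> S N" and b: "b \<in> S N" for a b N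
  proof -
    obtain c m where c: "a = homologous_rel_set 1 X {} c" "singular_relcycle 1 X {} c"
      and m: "\<forall>\<^sub>F n in sequentially. \<Phi> c n = 2 ^ n * of_int m / 2 ^ N"
      using a unfolding S_def by blast
    obtain d k where d: "b = homologous_rel_set 1 X {} d" "singular_relcycle 1 X {} d"
      and k: "\<forall>\<^sub>F n in sequentially. \<Phi> d n = 2 ^ n * of_int k / 2 ^ N"
      using b unfolding S_def by blast
    have "\<forall>\<^sub>F n in sequentially. \<Phi> (c + d) n = 2 ^ n * of_int (m + k) / 2 ^ N"
      using m k by eventually_elim (simp add: \<Phi>_def chain_eval_add field_simps)
    moreover have "a \<otimes>\<^bsub>?H\<^esub> b = homologous_rel_set 1 X {} (c + d)"
      unfolding mult_relative_homology_group c d by (rule homologous_rel_set_add)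
    ultimately show ?thesis
      using singular_relcycle_add[OF c(2) d(2)] unfolding S_def by blast
  qed
  have S_inv: "inv\<^bsub>?H\<^esub> a \<in> S N" if a: "a \<in> S N" for a N
  proof -
    obtain c m where c: "a = homologous_rel_set 1 X {} c" "singular_relcycle 1 X {} c"
      and m: "\<forall>\<^sub>F n in sequentially. \<Phi> c n = 2 ^ n * of_int m / 2 ^ N"
      using a unfolding S_def by blast
    have "\<forall>\<^sub>F n in sequentially. \<Phi> (- c) n = 2 ^ n * of_int (- m) / 2 ^ N"
      using m by eventually_elim (simp add: \<Phi>_def chain_eval_uminus)
    moreover have "a \<in> carrier ?H"
      using c unfolding carrier_relative_homology_group by blast
    from inv_relative_homology_group[OF this] have "inv\<^bsub>?H\<^esub> a = homologous_rel_set 1 X {} (- c)"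
      by (simp add: c(1) homologous_rel_set_uminus)
    ultimately show ?thesis
      using singular_relcycle_minus[of 1 X "{}" c] c(2) unfolding S_def by blast
  qed
  have S_one: "\<one>\<^bsub>?H\<^esub> \<in> S N" for N
  proof -
    have "\<one>\<^bsub>?H\<^esub> = homologous_rel_set 1 X {} 0"
      unfolding one_relative_homology_group by (metis homologous_rel_set_eq_relboundary singular_relboundary_0)
    moreover have "\<forall>\<^sub>F n in sequentially. \<Phi> 0 n = 2 ^ n * of_int 0 / 2 ^ N"
      by (simp add: \<Phi>_def)
    ultimately show ?thesis
      unfolding S_def using singular_relcycle_0[of 1 X "{}"] by blast
  qed
  assume "finitely_generated_group (homology_group 1 X)"
  then obtain A where A: "finite A" "A \<subseteq> carrier ?H" "generate ?H A = carrier ?H"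
    unfolding finitely_generated_group_def by auto
  have "\<forall>a\<in>A. \<exists>N. a \<in> S N"
    using A(2) cycle unfolding carrier_relative_homology_group by blast
  then obtain N where N: "\<And>a. a \<in> A \<Longrightarrow> a \<in> S (N a)" by metis
  define M where "M = Max (insert 0 (N ` A))"
  have AM: "a \<in> S M" if "a \<in> A" for a
    using N[OF that] S_mono[of "N a" M] A(1) that by (auto simp: M_def)
  have "a \<in> S M" if "a \<in> generate ?H A" for a
    using that by (induction rule: generate.induct) (blast intro: S_one AM S_inv S_add)+
  then have all: "carrier ?H \<subseteq> S M" using A(3) by blast
  \<comment> \<open>The exponent is one larger than \<open>S M\<close> permits: membership would
    make \<open>1 / 2 ^ Suc M\<close> an integer multiple of \<open>1 / 2 ^ M\<close>, so 1 would be
    even.\<close>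
  obtain \<sigma> where \<sigma>: "singular_simplex 1 X \<sigma>" "\<sigma> (edge 0) = \<sigma> (edge 1)"
    and w: "\<forall>\<^sub>F n in sequentially. edge_winding (Z n) \<sigma> = 2 ^ n / 2 ^ Suc M"
    using loops by blast
  have "singular_relcycle 1 X {} (frag_of \<sigma>)"
  proof -
    have v: "simplical_face 0 x = edge 1" "simplical_face (Suc 0) x = edge 0" if "x \<in> standard_simplex 0" for x
      using that by (auto simp: simplical_face_def edge_def fun_eq_iff standard_simplex_0)
    have "singular_face 1 0 \<sigma> = singular_face 1 1 \<sigma>"
      using \<sigma>(2) v by (auto simp: singular_face_def restrict_def)
    then show ?thesis
      using \<sigma>(1) by (simp add: singular_cycle singular_chain_of chain_boundary_of)
  qed
  then have "homologous_rel_set 1 X {} (frag_of \<sigma>) \<in> S M"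
    using all unfolding carrier_relative_homology_group by blast
  then obtain c m where c: "homologous_rel_set 1 X {} (frag_of \<sigma>) = homologous_rel_set 1 X {} c"
      and m: "\<forall>\<^sub>F n in sequentially. \<Phi> c n = 2 ^ n * of_int m / 2 ^ M"
      unfolding S_def by blast
  have "singular_relboundary 1 X {} (frag_of \<sigma> - c)"
    using c by (metis homologous_rel_def homologous_rel_set_eq)
  then obtain d where d: "singular_chain 2 X d" "chain_boundary 2 d = frag_of \<sigma> - c"
    unfolding singular_boundary numeral_2_eq_2 One_nat_def by blast
  have "\<forall>\<^sub>F n in sequentially. \<forall>\<tau>\<in>Poly_Mapping.keys d. nonvanishing_on_simplex 2 (Z n) \<tau>"
    by (rule eventually_ball_finite) (use d(1) triangles in \<open>auto simp: singular_chain_def\<close>)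
  then have "\<forall>\<^sub>F n in sequentially. \<Phi> (frag_of \<sigma> - c) n = 0"
    by eventually_elim (unfold \<Phi>_def d(2)[symmetric], rule edge_winding_boundary, auto)
  with w m have "\<forall>\<^sub>F n in sequentially. (2::complex) ^ n / 2 ^ Suc M = 2 ^ n * of_int m / 2 ^ M"
    by eventually_elim (simp add: \<Phi>_def chain_eval_diff)
  then obtain n where "(2::complex) ^ n / 2 ^ Suc M = 2 ^ n * of_int m / 2 ^ M"
    unfolding eventually_sequentially by blast
  then have "(of_int 1 :: complex) = of_int (2 * m)"
    by (simp add: field_simps)
  then have "1 = 2 * m" by (simp only: of_int_eq_iff)
  then show False by presburger
qed

section \<open>Homogeneous coordinates for the Newton map\<close>

lemma continuous_map_ratio:
  assumes a: "continuous_map X euclidean a" and c: "continuous_map X euclidean c"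
    and nz: "\<And>x. x \<in> topspace X \<Longrightarrow> a x \<noteq> 0 \<or> c x \<noteq> 0"
  shows "continuous_map X P1 (\<lambda>x. ratio (a x) (c x))"
  unfolding continuous_map_def
proof (intro conjI allI impI)
  show "(\<lambda>x. ratio (a x) (c x)) \<in> topspace X \<rightarrow> topspace P1"
    by (auto simp: P1_def ratio_def)
  have ac: "continuous_map X euclidean (\<lambda>x. (a x, c x))"
    using continuous_map_pairedI[OF a c] by simp
  have pre: "openin X {x \<in> topspace X. (a x, c x) \<in> G}" if "open G" for G
    using openin_continuous_map_preimage[OF ac] that by simp
  have fin: "openin X {x \<in> topspace X. c x \<noteq> 0 \<and> a x / c x \<in> U}" if "open U" for U
  proof -
    have "open ((UNIV \<times> - {0}) \<inter> (\<lambda>z. fst z / snd z) -` U)"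
      by (intro continuous_open_preimage that open_Times) (auto intro!: continuous_intros)
    from pre[OF this] show ?thesis by (simp add: conj_ac)
  qed
  fix V assume "openin P1 V"
  then consider U where "open U" "V = Some ` U"
    | K where "compact K" "V = insert None (Some ` (- K))"
    by (auto simp: P1_def openin_Alexandroff_compactification Compl_eq_Diff_UNIV)
  then show "openin X {x \<in> topspace X. ratio (a x) (c x) \<in> V}"
  proof cases
    case 1
    have "{x \<in> topspace X. ratio (a x) (c x) \<in> V} = {x \<in> topspace X. c x \<noteq> 0 \<and> a x / c x \<in> U}"
      using 1 by (auto simp: ratio_def)
    then show ?thesis using fin[OF 1(1)] by simp
  next
    case 2
    obtain M where M: "\<And>z. z \<in> K \<Longrightarrow> cmod z \<le> M"
      using compact_imp_bounded[OF 2(1)] unfolding bounded_iff by blast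
    \<comment> \<open>The first set misses the zeros of \<open>c\<close>. The second, where
      \<open>M\<close> bounds \<open>K\<close>, is open, contains those zeros because
      \<open>a\<close> is nonzero there, and elsewhere forces the quotient out of
      \<open>K\<close>.\<close>
    have "{x \<in> topspace X. ratio (a x) (c x) \<in> V} =
        {x \<in> topspace X. c x \<noteq> 0 \<and> a x / c x \<in> - K} \<union> {x \<in> topspace X. cmod (a x) > M * cmod (c x)}"
    proof (intro Set.set_eqI iffI)
      fix x assume x: "x \<in> {x \<in> topspace X. c x \<noteq> 0 \<and> a x / c x \<in> - K} \<union>
        {x \<in> topspace X. cmod (a x) > M * cmod (c x)}"
      show "x \<in> {x \<in> topspace X. ratio (a x) (c x) \<in> V}"
      proof (cases "c x = 0")
        case False
        then have "a x / c x \<notin> K" if "cmod (a x) > M * cmod (c x)"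
          using M[of "a x / c x"] that by (auto simp: norm_divide field_simps)
        then show ?thesis using x False 2 by (auto simp: ratio_def)
      qed (use x 2 in \<open>auto simp: ratio_def\<close>)
    qed (use 2 nz in \<open>auto simp: ratio_def split: if_splits\<close>)
    moreover have "open {z::complex \<times> complex. M * cmod (snd z) < cmod (fst z)}"
      by (intro open_Collect_less continuous_intros)
    then have "openin X {x \<in> topspace X. cmod (a x) > M * cmod (c x)}"
      using pre by fastforce
    ultimately show ?thesis
      using fin[of "- K"] 2(1) by (simp add: compact_imp_closed open_Compl openin_Un)
  qed
qed

lemma Hausdorff_space_P1: "Hausdorff_space P1"
  unfolding P1_def
  by (rule Hausdorff_space_Alexandroff_compactification[THEN iffD2])
     (auto simp: Hausdorff_space_euclidean locally_compact_space_euclidean)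

lemma Hausdorff_space_P1xP1: "Hausdorff_space P1xP1"
  by (simp add: P1xP1_def Hausdorff_space_prod_topology Hausdorff_space_P1)

lemma ratio_eqD: "ratio a c = ratio a' c' \<Longrightarrow> a * c' = a' * c"
  by (auto simp: ratio_def field_simps split: if_splits)

text \<open>After clearing the positive denominator |1 - w|^2 the left condition reads |w|^2 < 1. So
  the base of \<open>X_r\<close> becomes the unit disc, with w = 0 over the line x = 1.\<close>

lemma Re_inverse_gt_half_iff:
  assumes "w \<noteq> 1"
  shows "Re (1 / (1 - w)) > 1 / 2 \<longleftrightarrow> cmod w < 1"
proof -
  have "(1 - Re w)\<^sup>2 + (Im w)\<^sup>2 > 0"
    using assms by (auto simp: complex_eq_iff sum_power2_gt_zero_iff)
  then have "Re (1 / (1 - w)) > 1 / 2 \<longleftrightarrow> (cmod w)\<^sup>2 < 1"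
    unfolding cmod_power2 by (simp add: Re_divide field_simps power2_eq_square)
  then show ?thesis by (simp add: power_less_one_iff abs_square_less_1)
qed

section \<open>The critical values as functions of the base coordinate\<close>

locale newton_parabola =
  fixes B :: complex
  assumes norm_gt_1: "cmod (1 - B) > 1"
begin

text \<open>The function \<open>s\<close>. Both arguments of the principal root lie in the right half plane.\<close>

definition crit :: "complex \<Rightarrow> complex" where
  "crit w = (1 - B) * csqrt (1 - w / (1 - B)\<^sup>2) / csqrt (1 - w)"

lemma Re_diff_pos: "cmod w < 1 \<Longrightarrow> Re (1 - w) > 0"
  using complex_Re_le_cmod[of w] by simp

text \<open>Here the condition on \<open>B\<close> acts: the square of \<open>crit\<close> is
  \<open>((1 - B)\<^sup>2 - w) / (1 - w)\<close>, and this keeps its zero, like its pole, out of the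
  open disc.\<close>

lemma norm_divide_lt_1: "cmod w < 1 \<Longrightarrow> cmod (w / (1 - B)\<^sup>2) < 1"
proof -
  assume w: "cmod w < 1"
  have "1 < (cmod (1 - B))\<^sup>2"
    using norm_gt_1 by (simp add: one_less_power)
  with w have "cmod w < (cmod (1 - B))\<^sup>2" by linarith
  then show ?thesis
    using norm_gt_1 by (simp add: norm_divide norm_power divide_less_eq)
qed

text \<open>With x = 1 / (1 - w) the right-hand side is the discriminant in y of the equation of the
  critical value parabola.\<close>

lemma crit_sq: "cmod w < 1 \<Longrightarrow> (crit w)\<^sup>2 = 1 - (2 * B - B\<^sup>2) / (1 - w)"
proof -
  assume w: "cmod w < 1"
  have "1 - w \<noteq> 0" "1 - B \<noteq> 0" using w norm_gt_1 by auto
  have "(crit w)\<^sup>2 = ((1 - B)\<^sup>2 - w) / (1 - w)"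
    using \<open>1 - B \<noteq> 0\<close> by (simp add: crit_def power_mult_distrib power_divide right_diff_distrib)
  also have "(1 - B)\<^sup>2 - w = (1 - w) - (2 * B - B\<^sup>2)"
    by (simp add: power2_eq_square algebra_simps)
  also have "\<dots> / (1 - w) = 1 - (2 * B - B\<^sup>2) / (1 - w)"
    using \<open>1 - w \<noteq> 0\<close> by (simp add: diff_divide_distrib)
  finally show ?thesis .
qed

lemma crit_nonzero: "cmod w < 1 \<Longrightarrow> crit w \<noteq> 0"
proof -
  assume w: "cmod w < 1"
  have "1 - w \<noteq> 0" "1 - B \<noteq> 0" "1 - w / (1 - B)\<^sup>2 \<noteq> 0"
    using w norm_gt_1 norm_divide_lt_1[OF w] by auto
  then show ?thesis by (simp add: crit_def)
qed

text \<open>Hence z = 0 and z = infinity over w = 0 are the points y = 1 - B and y = 0, the two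
  common zeros on x = 1, and |z| = 1 is their bisector.\<close>

lemma crit_0: "crit 0 = 1 - B"
  by (simp add: crit_def)

lemma continuous_on_crit: "continuous_on (ball 0 1) crit"
proof -
  have "1 - w \<notin> \<real>\<^sub>\<le>\<^sub>0" "1 - w / (1 - B)\<^sup>2 \<notin> \<real>\<^sub>\<le>\<^sub>0" "1 - w \<noteq> 0" if "w \<in> ball 0 1" for w
    using that Re_diff_pos[of w] Re_diff_pos[OF norm_divide_lt_1, of w]
    by (auto simp: complex_nonpos_Reals_iff)
  note nz = this
  have "(1 - B)\<^sup>2 \<noteq> 0" using norm_gt_1 by auto
  moreover have "continuous_on (ball 0 1) (\<lambda>w. csqrt (1 - w / (1 - B)\<^sup>2))" "continuous_on (ball 0 1) (\<lambda>w. csqrt (1 - w))"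
    using nz(1,2) calculation
    by (auto intro!: continuous_on_compose2[where g=csqrt and t="- \<real>\<^sub>\<le>\<^sub>0"] continuous_on_csqrt continuous_intros)
  ultimately show ?thesis
    unfolding crit_def using nz(3) by (intro continuous_intros) auto
qed

text \<open>For \<open>U = crit w * (q + p) / (q - p)\<close> and s1 =
  \<open>crit (w\<^sup>2)\<close>, the two linear forms that \<open>F\<close> builds from these
  coefficients are (q - p) (U - s1) and (q - p) (U + s1). At w = 0 \<open>off_coeff\<close> vanishes
  and the Moebius transformation is the identity.\<close>

definition diag_coeff :: "complex \<Rightarrow> complex" where "diag_coeff w = crit w + crit (w\<^sup>2)"
definition off_coeff :: "complex \<Rightarrow> complex" where "off_coeff w = crit w - crit (w\<^sup>2)"

lemma norm_sq_lt_1: "cmod w < 1 \<Longrightarrow> cmod (w\<^sup>2) < 1"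
  by (simp add: norm_power power_less_one_iff)

lemma continuous_on_diag_coeff: "continuous_on (ball 0 1) diag_coeff" and continuous_on_off_coeff: "continuous_on (ball 0 1) off_coeff"
proof -
  have "continuous_on (ball 0 1) (\<lambda>w. crit (w\<^sup>2))"
    by (rule continuous_on_compose2[OF continuous_on_crit])
       (use norm_sq_lt_1 in \<open>auto intro!: continuous_intros\<close>)
  then show "continuous_on (ball 0 1) diag_coeff" "continuous_on (ball 0 1) off_coeff"
    unfolding diag_coeff_def off_coeff_def using continuous_on_crit by (auto intro!: continuous_intros)
qed

text \<open>This determinant of the two linear forms is
  \<open>4 * crit w * crit (w\<^sup>2)\<close>. That it is nonzero keeps \<open>F\<close> inside
  \<open>hcoords\<close> and allows solving for \<open>p\<close> and \<open>q\<close> when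
  lifting.\<close>

lemma coeff_det_nonzero: "cmod w < 1 \<Longrightarrow> (diag_coeff w)\<^sup>2 - (off_coeff w)\<^sup>2 \<noteq> 0"
proof -
  assume w: "cmod w < 1"
  have "(diag_coeff w)\<^sup>2 - (off_coeff w)\<^sup>2 = 4 * crit w * crit (w\<^sup>2)"
    by (simp add: diag_coeff_def off_coeff_def power2_eq_square algebra_simps)
  then show ?thesis using crit_nonzero[OF w] crit_nonzero[OF norm_sq_lt_1[OF w]] by simp
qed

text \<open>A point of \<^const>\<open>X_r\<close> is represented by \<open>w\<close> and homogeneous coordinates \<open>p\<close>, \<open>q\<close> with
  \<open>z = p / q\<close>. The map \<open>F\<close> is the Newton map in these coordinates; it is defined on all
  of the domain, and the points at infinity of the fibres are not special.\<close>

definition hcoords :: "(complex \<times> complex \<times> complex) set" where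
  "hcoords = {(w, p, q). cmod w < 1 \<and> (p \<noteq> 0 \<or> q \<noteq> 0)}"

fun F :: "complex \<times> complex \<times> complex \<Rightarrow> complex \<times> complex \<times> complex" where
  "F (w, p, q) = (w\<^sup>2, (diag_coeff w * p + off_coeff w * q)\<^sup>2, (off_coeff w * p + diag_coeff w * q)\<^sup>2)"

text \<open>Inverts the coordinate z: from \<open>U = crit w * (q + p) / (q - p)\<close> one has y =
  (U + 1 - B x) / 2, and clearing the denominator \<open>q - p\<close> sends \<open>p = q\<close> to
  infinity.\<close>

fun proj :: "complex \<times> complex \<times> complex \<Rightarrow> complex option \<times> complex option" where
  "proj (w, p, q) = (Some (1 / (1 - w)),
     ratio (crit w * (q + p) + (1 - B / (1 - w)) * (q - p)) (2 * (q - p)))"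

lemma proj_None_iff: "(w, p, q) \<in> hcoords \<Longrightarrow> snd (proj (w, p, q)) = None \<longleftrightarrow> p = q"
  by (auto simp: ratio_def)

lemma proj_defined:
  assumes "(w, p, q) \<in> hcoords"
  shows "crit w * (q + p) + (1 - B / (1 - w)) * (q - p) \<noteq> 0 \<or> 2 * (q - p) \<noteq> 0"
  using assms crit_nonzero[of w] by (auto simp: hcoords_def)

lemma proj_in_X_r: "x \<in> hcoords \<Longrightarrow> proj x \<in> X_r"
proof (cases x)
  fix w p q assume x: "x \<in> hcoords" "x = (w, p, q)"
  then have "cmod w < 1" by (auto simp: hcoords_def)
  moreover from this have "w \<noteq> 1" by auto
  ultimately have "Re (1 / (1 - w)) > 1 / 2" using Re_inverse_gt_half_iff by blast
  then show "proj x \<in> X_r" by (simp add: X_r_def x(2))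
qed

text \<open>For fixed \<open>w\<close> the second component is a Moebius transformation of p / q
  with determinant 4 \<open>crit w\<close>, so equal images force proportional coordinates.\<close>

lemma proj_eqD:
  assumes "proj (w, p, q) = proj (w', p', q')" "(w, p, q) \<in> hcoords" "(w', p', q') \<in> hcoords"
  shows "w' = w" "p * q' = p' * q"
proof -
  have w: "1 - w \<noteq> 0" "1 - w' \<noteq> 0" using assms(2,3) by (auto simp: hcoords_def)
  have "1 / (1 - w) = 1 / (1 - w')" using assms(1) by simp
  then show ww: "w' = w" using w by (simp add: field_simps)
  have "(crit w * (q + p) + (1 - B / (1 - w)) * (q - p)) * (2 * (q' - p')) =
    (crit w * (q' + p') + (1 - B / (1 - w)) * (q' - p')) * (2 * (q - p))"
    using assms(1) by (intro ratio_eqD) (simp add: ww)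
  moreover have "(\<alpha> * (q + p) + \<beta> * (q - p)) * (2 * (q' - p')) - (\<alpha> * (q' + p') + \<beta> * (q' - p')) * (2 * (q - p))
     = 2 * (\<alpha> * ((q + p) * (q' - p') - (q' + p') * (q - p)))" for \<alpha> \<beta>
    by (simp add: algebra_simps)
  ultimately have "2 * (crit w * ((q + p) * (q' - p') - (q' + p') * (q - p))) = 0"
    by (metis eq_iff_diff_eq_0)
  then have "crit w * ((q + p) * (q' - p') - (q' + p') * (q - p)) = 0" by simp
  then have "(q + p) * (q' - p') - (q' + p') * (q - p) = 0"
    using crit_nonzero assms(2) by (auto simp: hcoords_def)
  then have "2 * (p * q') = 2 * (p' * q)" by (simp add: algebra_simps)
  then show "p * q' = p' * q" by simp
qed

lemma proj_scale: "c \<noteq> 0 \<Longrightarrow> proj (w, c * p, c * q) = proj (w, p, q)"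
proof -
  assume c: "c \<noteq> 0"
  have "ratio (c * a) (c * d) = ratio a d" for a d
    using c by (simp add: ratio_def)
  moreover have "\<alpha> * (c * q + c * p) + \<beta> * (c * q - c * p) = c * (\<alpha> * (q + p) + \<beta> * (q - p))"
    "2 * (c * q - c * p) = c * (2 * (q - p))" for \<alpha> \<beta>
    by (simp_all add: algebra_simps)
  ultimately show ?thesis by (simp only: proj.simps)
qed

lemma proj_surj:
  assumes "y \<in> X_r"
  obtains x where "x \<in> hcoords" "proj x = y"
proof -
  obtain x v where y: "y = (Some x, v)" and x: "Re x > 1 / 2" using assms by (auto simp: X_r_def)
  define w where "w = 1 - 1 / x"
  have x0: "x \<noteq> 0" using x by auto
  have xw: "x = 1 / (1 - w)" using x0 by (simp add: w_def)
  have "w \<noteq> 1" using x0 by (auto simp: w_def)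
  then have w: "cmod w < 1" using x Re_inverse_gt_half_iff unfolding xw by simp
  show ?thesis
  proof (cases v)
    case None
    then show ?thesis
      using w xw by (intro that[of "(w, 1, 1)"]) (auto simp: hcoords_def y ratio_def)
  next
    case (Some u)
    define U where "U = 2 * u + B * x - 1"
    have "crit w * ((U + crit w) + (U - crit w)) + (1 - B / (1 - w)) * ((U + crit w) - (U - crit w))
        = 4 * crit w * u"
      unfolding U_def xw by (simp add: algebra_simps)
    then show ?thesis
      using w xw Some crit_nonzero[OF w]
      by (intro that[of "(w, U - crit w, U + crit w)"]) (auto simp: hcoords_def y ratio_def)
  qed
qed

lemma F_in_hcoords: "x \<in> hcoords \<Longrightarrow> F x \<in> hcoords"
proof (cases x)
  fix w p q assume x: "x \<in> hcoords" "x = (w, p, q)"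
  then have w: "cmod w < 1" and pq: "p \<noteq> 0 \<or> q \<noteq> 0" by (auto simp: hcoords_def)
  have "False" if "diag_coeff w * p + off_coeff w * q = 0" "off_coeff w * p + diag_coeff w * q = 0"
  proof -
    have "((diag_coeff w)\<^sup>2 - (off_coeff w)\<^sup>2) * p = diag_coeff w * (diag_coeff w * p + off_coeff w * q) - off_coeff w * (off_coeff w * p + diag_coeff w * q)"
      "((diag_coeff w)\<^sup>2 - (off_coeff w)\<^sup>2) * q = diag_coeff w * (off_coeff w * p + diag_coeff w * q) - off_coeff w * (diag_coeff w * p + off_coeff w * q)"
      by (simp_all add: algebra_simps power2_eq_square)
    then have "((diag_coeff w)\<^sup>2 - (off_coeff w)\<^sup>2) * p = 0" "((diag_coeff w)\<^sup>2 - (off_coeff w)\<^sup>2) * q = 0"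
      using that by simp_all
    then show False using coeff_det_nonzero[OF w] pq by simp
  qed
  then show "F x \<in> hcoords"
    using norm_sq_lt_1[OF w] by (auto simp: x(2) hcoords_def)
qed

text \<open>The heart is \<open>main\<close>: the new value of U is (U^2 + s1^2) / (2 U), and the
  squares of the two linear forms give the same quotient. The values U = infinity
  (\<open>p = q\<close>) and U = 0 (\<open>q + p = 0\<close>), both sent to y = infinity, are
  treated apart.\<close>

lemma newton_proj: "x \<in> hcoords \<Longrightarrow> newton B (proj x) = proj (F x)"
proof (cases x)
  fix w p q assume x: "x \<in> hcoords" "x = (w, p, q)"
  then have w: "cmod w < 1" and pq: "p \<noteq> 0 \<or> q \<noteq> 0" by (auto simp: hcoords_def)
  define X where "X = 1 / (1 - w)"
  define X1 where "X1 = 1 / (1 - w\<^sup>2)"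
  have w2: "cmod (w\<^sup>2) < 1" using norm_sq_lt_1[OF w] .
  have nz: "1 - w \<noteq> 0" "1 - w\<^sup>2 \<noteq> 0" "1 + w \<noteq> 0"
    using w w2 by (auto simp: add_eq_0_iff)
  have X: "2 * X - 1 \<noteq> 0" "X\<^sup>2 / (2 * X - 1) = X1"
  proof -
    have e: "2 * X - 1 = (1 + w) / (1 - w)" using nz by (simp add: X_def field_simps)
    then show "2 * X - 1 \<noteq> 0" using nz by simp
    have "(1 - w\<^sup>2) = (1 - w) * (1 + w)" by (simp add: power2_eq_square algebra_simps)
    then show "X\<^sup>2 / (2 * X - 1) = X1"
      unfolding e using nz by (simp add: X_def X1_def power2_eq_square)
  qed
  then have XX: "X1 * (2 * X - 1) = X\<^sup>2" by (simp add: field_simps)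
  define s s1 where "s = crit w" and "s1 = crit (w\<^sup>2)"
  have s: "s \<noteq> 0" "s1 \<noteq> 0" using crit_nonzero w w2 by (auto simp: s_def s1_def)
  have s1sq: "s1\<^sup>2 = 1 - (2 * B - B\<^sup>2) * X1" using crit_sq[OF w2] by (simp add: s1_def X1_def)
  define P Q where "P = diag_coeff w * p + off_coeff w * q" and "Q = off_coeff w * p + diag_coeff w * q"
  have PQ: "Q - P = 2 * s1 * (q - p)" "Q + P = 2 * s * (q + p)"
    by (simp_all add: P_def Q_def diag_coeff_def off_coeff_def s_def s1_def algebra_simps)
  have PQ2: "Q\<^sup>2 - P\<^sup>2 = 4 * s * s1 * ((q - p) * (q + p))"
      "Q\<^sup>2 + P\<^sup>2 = 2 * (s1\<^sup>2 * (q - p)\<^sup>2 + s\<^sup>2 * (q + p)\<^sup>2)"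
  proof -
    have "Q\<^sup>2 - P\<^sup>2 = (Q - P) * (Q + P)" "2 * (Q\<^sup>2 + P\<^sup>2) = (Q - P)\<^sup>2 + (Q + P)\<^sup>2"
      by (simp_all add: algebra_simps power2_eq_square)
    note h = this[unfolded PQ]
    show "Q\<^sup>2 - P\<^sup>2 = 4 * s * s1 * ((q - p) * (q + p))"
      unfolding h(1) by simp
    have "2 * (Q\<^sup>2 + P\<^sup>2) = 2 * (2 * (s1\<^sup>2 * (q - p)\<^sup>2 + s\<^sup>2 * (q + p)\<^sup>2))"
      unfolding h(2) by (simp only: power_mult_distrib) (simp add: distrib_left)
    then show "Q\<^sup>2 + P\<^sup>2 = 2 * (s1\<^sup>2 * (q - p)\<^sup>2 + s\<^sup>2 * (q + p)\<^sup>2)"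
      by (simp only: mult_cancel_left) simp
  qed
  have fst_eq: "ratio (X\<^sup>2) (2 * X - 1) = Some X1" using X by (simp add: ratio_def)
  have F: "proj (F x) = (Some X1, ratio (s1 * (Q\<^sup>2 + P\<^sup>2) + (1 - B * X1) * (Q\<^sup>2 - P\<^sup>2)) (2 * (Q\<^sup>2 - P\<^sup>2)))"
    by (simp add: x(2) P_def Q_def s1_def X1_def)
  show "newton B (proj x) = proj (F x)"
  proof (cases "p = q")
    case True
    then have "proj x = (Some X, None)" by (simp add: x(2) ratio_def X_def)
    moreover have "Q\<^sup>2 - P\<^sup>2 = 0" using True PQ2 by simp
    ultimately show ?thesis using F fst_eq by (simp add: ratio_def)
  next
    case False
    define U where "U = s * (q + p) / (q - p)"
    define y where "y = (U + (1 - B * X)) / 2"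
    have qp: "q - p \<noteq> 0" using False by simp
    have px: "proj x = (Some X, Some y)"
    proof -
      have "(a + e * d) / (2 * d) = (a / d + e) / 2" if "d \<noteq> 0" for a e d :: complex
        using that by (simp add: field_simps)
      from this[OF qp] have "(s * (q + p) + (1 - B / (1 - w)) * (q - p)) / (2 * (q - p)) = y"
        by (simp add: y_def U_def X_def)
      then show ?thesis
        using qp unfolding x(2) proj.simps ratio_def s_def[symmetric] by (simp add: X_def)
    qed
    have U: "B * X + 2 * y - 1 = U" by (simp add: y_def field_simps)
    show ?thesis
    proof (cases "q + p = 0")
      case True
      then have "U = 0" by (simp add: U_def)
      moreover have "Q\<^sup>2 - P\<^sup>2 = 0" using True PQ2 by simp
      ultimately show ?thesis using F fst_eq U by (simp add: px ratio_def)
    next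
      case nqp: False
      then have U0: "U \<noteq> 0" using s qp by (simp add: U_def)
      define y1 where "y1 = y * (B * X\<^sup>2 + 2 * X * y - B * X - y) / ((2 * X - 1) * U)"
      have y1: "y1 * ((2 * X - 1) * U) = y * (B * X\<^sup>2 + 2 * X * y - B * X - y)"
        using X U0 by (simp add: y1_def)
      have y2: "2 * y = U + (1 - B * X)" by (simp add: y_def)
      \<comment> \<open>The factor \<open>2 * X - 1\<close> clears the denominators of both
        \<open>y1\<close> and \<open>X1\<close>.\<close>
      have "(2 * X - 1) * (2 * ((2 * y1 + B * X1 - 1) * U) - (U\<^sup>2 + s1\<^sup>2)) = 0"
      proof -
        have a: "4 * (y1 * ((2 * X - 1) * U)) = 2 * (2 * y) * (B * (X\<^sup>2 - X)) + (2 * y)\<^sup>2 * (2 * X - 1)"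
          unfolding y1 by (simp add: algebra_simps power2_eq_square)
        have b: "(2 * X - 1) * s1\<^sup>2 = (2 * X - 1) - (2 * B - B\<^sup>2) * X\<^sup>2"
          unfolding s1sq XX[symmetric] by (simp add: algebra_simps)
        have "(2 * X - 1) * (2 * ((2 * y1 + B * X1 - 1) * U) - (U\<^sup>2 + s1\<^sup>2)) =
          4 * (y1 * ((2 * X - 1) * U)) + 2 * U * (B * (X1 * (2 * X - 1)) - (2 * X - 1))
           - U\<^sup>2 * (2 * X - 1) - (2 * X - 1) * s1\<^sup>2"
          by (simp add: algebra_simps)
        then show ?thesis
          unfolding a b XX y2 by (simp add: algebra_simps power2_eq_square)
      qed
      then have main: "2 * ((2 * y1 + B * X1 - 1) * U) = U\<^sup>2 + s1\<^sup>2"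
        using X(1) by (metis eq_iff_diff_eq_0 mult_eq_0_iff)
      have D: "Q\<^sup>2 - P\<^sup>2 \<noteq> 0" unfolding PQ2(1) using s qp nqp by simp
      have Uqp: "U * (q - p) = s * (q + p)" using qp by (simp add: U_def)
      have PQ3: "Q\<^sup>2 - P\<^sup>2 = 4 * s1 * (q - p)\<^sup>2 * U" "Q\<^sup>2 + P\<^sup>2 = 2 * (U\<^sup>2 + s1\<^sup>2) * (q - p)\<^sup>2"
      proof -
        have "Q\<^sup>2 - P\<^sup>2 = 4 * s1 * (q - p) * (s * (q + p))" by (simp add: PQ2)
        then show "Q\<^sup>2 - P\<^sup>2 = 4 * s1 * (q - p)\<^sup>2 * U"
          unfolding Uqp[symmetric] by (simp add: power2_eq_square algebra_simps)
        have "Q\<^sup>2 + P\<^sup>2 = 2 * (s1\<^sup>2 * (q - p)\<^sup>2 + (s * (q + p))\<^sup>2)" by (simp add: PQ2 power_mult_distrib)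
        then show "Q\<^sup>2 + P\<^sup>2 = 2 * (U\<^sup>2 + s1\<^sup>2) * (q - p)\<^sup>2"
          unfolding Uqp[symmetric] by (simp add: power2_eq_square algebra_simps)
      qed
      have "s1 * (Q\<^sup>2 + P\<^sup>2) = (2 * y1 + B * X1 - 1) * (Q\<^sup>2 - P\<^sup>2)"
        unfolding PQ3 main[symmetric] by (simp add: algebra_simps)
      then have "s1 * (Q\<^sup>2 + P\<^sup>2) + (1 - B * X1) * (Q\<^sup>2 - P\<^sup>2) = y1 * (2 * (Q\<^sup>2 - P\<^sup>2))"
        by (simp add: algebra_simps)
      then have "proj (F x) = (Some X1, ratio (y1 * (2 * (Q\<^sup>2 - P\<^sup>2))) (2 * (Q\<^sup>2 - P\<^sup>2)))"
        using F by (simp only:)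
      also have "\<dots> = (Some X1, Some y1)"
        using D unfolding ratio_def by simp
      also have "\<dots> = newton B (proj x)"
        unfolding px newton.simps U fst_eq using X U0 by (simp add: ratio_def y1_def)
      finally show ?thesis by (rule sym)
    qed
  qed
qed

lemma funpow_F_in_hcoords: "x \<in> hcoords \<Longrightarrow> (F ^^ n) x \<in> hcoords"
  by (induction n) (auto intro: F_in_hcoords)

lemma newton_funpow_proj: "x \<in> hcoords \<Longrightarrow> (newton B ^^ n) (proj x) = proj ((F ^^ n) x)"
  by (induction n) (auto simp: newton_proj funpow_F_in_hcoords)

lemma funpow_F_fst: "fst ((F ^^ n) x) = fst x ^ 2 ^ n"
proof (induction n)
  case (Suc n)
  have "fst (F y) = (fst y)\<^sup>2" for y by (cases y) simp
  then show ?case using Suc by (simp add: power_mult[symmetric] mult.commute)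
qed simp

text \<open>Change of representative. Loops in \<open>W_1\<close> are handled as paths in
  \<open>hcoords\<close> whose ends may differ by such a factor.\<close>

definition scale :: "complex \<Rightarrow> complex \<times> complex \<times> complex \<Rightarrow> complex \<times> complex \<times> complex" where
  "scale c x = (fst x, c * fst (snd x), c * snd (snd x))"

lemma scale_scale: "scale c (scale c' x) = scale (c * c') x"
  by (simp add: scale_def)

lemma F_scale: "F (scale c x) = scale (c\<^sup>2) (F x)"
  by (cases x) (simp add: scale_def power2_eq_square algebra_simps)

lemma funpow_F_scale: "(F ^^ n) (scale c x) = scale (c ^ 2 ^ n) ((F ^^ n) x)"
  by (induction n) (simp_all add: F_scale power_mult[symmetric] mult.commute)

lemma proj_scale': "c \<noteq> 0 \<Longrightarrow> proj (scale c x) = proj x"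
  using proj_scale by (cases x) (simp add: scale_def)

lemma scale_in_hcoords: "c \<noteq> 0 \<Longrightarrow> x \<in> hcoords \<Longrightarrow> scale c x \<in> hcoords"
  by (cases x) (simp add: scale_def hcoords_def)

lemma proj_eq_scale:
  assumes "proj x = proj y" "x \<in> hcoords" "y \<in> hcoords"
  shows "\<exists>c. c \<noteq> 0 \<and> y = scale c x"
proof -
  obtain w p q where x: "x = (w, p, q)" by (cases x)
  obtain w' p' q' where y: "y = (w', p', q')" by (cases y)
  have e: "w' = w" "p * q' = p' * q" using proj_eqD[OF assms[unfolded x y]] .
  have nz: "p \<noteq> 0 \<or> q \<noteq> 0" "p' \<noteq> 0 \<or> q' \<noteq> 0" using assms(2,3) by (auto simp: x y hcoords_def)
  show ?thesis
  proof (cases "p = 0")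
    case True
    then have "q \<noteq> 0" "p' = 0" using nz e by auto
    then have "y = scale (q' / q) x" "q' / q \<noteq> 0"
      using nz(2) True e(1) by (simp_all add: x y scale_def)
    then show ?thesis by blast
  next
    case False
    then have q': "q' = p' * q / p" using e by (simp add: field_simps)
    then have "p' \<noteq> 0" using nz by auto
    then have "y = scale (p' / p) x" "p' / p \<noteq> 0"
      using False e(1) q' by (simp_all add: x y scale_def)
    then show ?thesis by blast
  qed
qed

lemma continuous_map_proj: "continuous_map (top_of_set hcoords) P1xP1 proj"
proof -
  have sub: "fst ` hcoords \<subseteq> ball 0 1" by (auto simp: hcoords_def)
  have c: "continuous_on hcoords (\<lambda>x. crit (fst x))"
    by (rule continuous_on_compose2[OF continuous_on_crit _ sub]) (auto intro!: continuous_intros)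
  have nz: "1 - fst x \<noteq> 0" if "x \<in> hcoords" for x using that by (auto simp: hcoords_def)
  have 1: "continuous_map (top_of_set hcoords) P1 (\<lambda>x. Some (1 / (1 - fst x)))"
  proof -
    have "continuous_map (top_of_set hcoords) euclidean (\<lambda>x. 1 / (1 - fst x))"
      using nz by (auto intro!: continuous_intros)
    from continuous_map_compose[OF this continuous_map_Some] show ?thesis
      by (simp add: P1_def o_def)
  qed
  have 2: "continuous_map (top_of_set hcoords) P1 (\<lambda>x. ratio
      (crit (fst x) * (snd (snd x) + fst (snd x)) + (1 - B / (1 - fst x)) * (snd (snd x) - fst (snd x)))
      (2 * (snd (snd x) - fst (snd x))))"
    by (rule continuous_map_ratio)
       (use c nz proj_defined in \<open>auto intro!: continuous_intros simp del: mult_eq_0_iff\<close>)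
  have "proj = (\<lambda>x. (Some (1 / (1 - fst x)), ratio
      (crit (fst x) * (snd (snd x) + fst (snd x)) + (1 - B / (1 - fst x)) * (snd (snd x) - fst (snd x)))
      (2 * (snd (snd x) - fst (snd x)))))"
    by (auto simp: fun_eq_iff)
  then show ?thesis
    unfolding P1xP1_def using continuous_map_pairedI[OF 1 2] by metis
qed

end

section \<open>Orbits of the stable set near the invariant circle\<close>

text \<open>Applied to log |z| along an orbit. Doubling expands: once the errors are below r / 2, a
  term of modulus at least \<open>r\<close> makes the excess over r / 2 at least double in each
  step, against boundedness.\<close>

lemma doubling_bounded_tendsto_0:
  fixes t :: "nat \<Rightarrow> real"
  assumes bd: "\<And>n. n \<ge> N \<Longrightarrow> \<bar>t n\<bar> \<le> M" and lim: "(\<lambda>n. t (Suc n) - 2 * t n) \<longlonglongrightarrow> 0"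
  shows "t \<longlonglongrightarrow> 0"
proof (rule LIMSEQ_I)
  fix r :: real assume r: "0 < r"
  obtain N' where N': "\<And>n. n \<ge> N' \<Longrightarrow> \<bar>t (Suc n) - 2 * t n\<bar> < r / 2"
    using LIMSEQ_D[OF lim, of "r / 2"] r by auto
  have "\<bar>t n\<bar> < r" if n: "n \<ge> max N N'" for n
  proof (rule ccontr)
    assume "\<not> \<bar>t n\<bar> < r"
    then have big: "\<bar>t n\<bar> - r / 2 \<ge> r / 2" by simp
    have grow: "\<bar>t (n + k)\<bar> - r / 2 \<ge> 2 ^ k * (r / 2)" for k
    proof (induction k)
      case (Suc k)
      have "\<bar>t (Suc (n + k)) - 2 * t (n + k)\<bar> < r / 2" using N' n by simp
      then have "\<bar>t (Suc (n + k))\<bar> - r / 2 \<ge> 2 * (\<bar>t (n + k)\<bar> - r / 2)"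
        using abs_triangle_ineq2[of "2 * t (n + k)" "t (Suc (n + k))"]
        by (simp add: abs_mult abs_minus_commute right_diff_distrib)
      then show ?case using Suc.IH by simp
    qed (use big in simp)
    obtain k where k: "M / (r / 2) < 2 ^ k"
      using real_arch_pow[of 2 "M / (r / 2)"] by auto
    then have "M < 2 ^ k * (r / 2)" using r by (simp add: divide_less_eq)
    then show False using grow[of k] bd[of "n + k"] n r by simp
  qed
  then show "\<exists>no. \<forall>n\<ge>no. norm (t n - 0) < r" by (intro exI[of _ "max N N'"]) simp
qed

context newton_parabola
begin

text \<open>By continuity from w = 0, where \<open>off_coeff\<close> vanishes. The constant 1 / 100
  leaves ample room in \<open>half_step\<close> and makes the estimates in
  \<open>pull_bounds\<close> close up.\<close>

lemma exists_radius:
  "\<exists>e>0. e < 1 \<and> (\<forall>w. cmod w \<le> e \<longrightarrow> diag_coeff w \<noteq> 0 \<and> cmod (off_coeff w) \<le> cmod (diag_coeff w) / 100)"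
proof -
  define h where "h = (\<lambda>w. cmod (diag_coeff w) / 100 - cmod (off_coeff w))"
  have "continuous_on (ball 0 1) h"
    unfolding h_def using continuous_on_diag_coeff continuous_on_off_coeff by (intro continuous_intros) auto
  moreover have "h 0 > 0"
    using norm_gt_1 by (auto simp: h_def diag_coeff_def off_coeff_def crit_0)
  ultimately have "open (ball 0 1 \<inter> h -` {0<..})" "0 \<in> ball 0 1 \<inter> h -` {0<..}"
    by (auto intro: continuous_open_preimage)
  then obtain e where e: "e > 0" "cball 0 e \<subseteq> ball 0 1 \<inter> h -` {0<..}"
    unfolding open_contains_cball by blast
  have "diag_coeff w \<noteq> 0 \<and> cmod (off_coeff w) \<le> cmod (diag_coeff w) / 100" if "cmod w \<le> e" for w
  proof -
    have "h w > 0" using e that by force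
    then show ?thesis by (auto simp: h_def)
  qed
  moreover have "complex_of_real e \<in> cball 0 e" using e(1) by simp
  with e(2) have "complex_of_real e \<in> ball 0 1" by blast
  then have "e < 1" using e(1) by simp
  ultimately show ?thesis using e(1) by blast
qed

definition core_radius :: real where
  "core_radius = (SOME e. e > 0 \<and> e < 1 \<and> (\<forall>w. cmod w \<le> e \<longrightarrow> diag_coeff w \<noteq> 0 \<and> cmod (off_coeff w) \<le> cmod (diag_coeff w) / 100))"

lemma core_radius:
  "core_radius > 0" "core_radius < 1" "cmod w \<le> core_radius \<Longrightarrow> diag_coeff w \<noteq> 0"
  "cmod w \<le> core_radius \<Longrightarrow> cmod (off_coeff w) \<le> cmod (diag_coeff w) / 100"
  using someI_ex[OF exists_radius] unfolding core_radius_def[symmetric] by blast+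

text \<open>The annulus 1 / K < |p / q| < K, written without quotients; it excludes zero
  coordinates.\<close>

definition balanced :: "real \<Rightarrow> complex \<times> complex \<times> complex \<Rightarrow> bool" where
  "balanced K x \<longleftrightarrow> cmod (fst (snd x)) < K * cmod (snd (snd x)) \<and> cmod (snd (snd x)) < K * cmod (fst (snd x))"

lemma balanced_scale: "c \<noteq> 0 \<Longrightarrow> balanced K (scale c x) \<longleftrightarrow> balanced K x"
  by (simp add: balanced_def scale_def norm_mult mult.left_commute[of K])

text \<open>Outside the annulus squaring wins over the perturbation: the moduli of the two forms
  have ratio at most 0.51 / 0.995, whose square is below 1 / 2.\<close>

lemma half_step:
  fixes \<alpha> \<beta> p q :: complex
  assumes ab: "cmod \<beta> \<le> cmod \<alpha> / 100" and pq: "2 * cmod p \<le> cmod q"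
  shows "2 * cmod ((\<alpha> * p + \<beta> * q)\<^sup>2) \<le> cmod ((\<beta> * p + \<alpha> * q)\<^sup>2)"
proof -
  define T where "T = cmod \<alpha> * cmod q"
  have T: "T \<ge> 0" by (simp add: T_def)
  have ap: "cmod (\<alpha> * p) \<le> T / 2"
    using mult_left_mono[OF pq, of "cmod \<alpha>"] by (simp add: T_def norm_mult)
  have bq: "cmod (\<beta> * q) \<le> T / 100"
    using mult_right_mono[OF ab, of "cmod q"] by (simp add: T_def norm_mult)
  have "cmod (\<beta> * p) \<le> (cmod \<alpha> / 100) * (cmod q / 2)"
    unfolding norm_mult using ab pq by (intro mult_mono) auto
  then have bp: "cmod (\<beta> * p) \<le> T / 200" by (simp add: T_def)
  have P: "cmod (\<alpha> * p + \<beta> * q) \<le> 51 / 100 * T"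
    using norm_triangle_ineq[of "\<alpha> * p" "\<beta> * q"] ap bq by linarith
  have "T \<le> cmod (\<beta> * p + \<alpha> * q) + cmod (\<beta> * p)"
    using norm_triangle_ineq4[of "\<beta> * p + \<alpha> * q" "\<beta> * p"] by (simp add: T_def norm_mult)
  then have Q: "cmod (\<beta> * p + \<alpha> * q) \<ge> 199 / 200 * T" using bp by linarith
  have "2 * (cmod (\<alpha> * p + \<beta> * q))\<^sup>2 \<le> 2 * (51 / 100 * T)\<^sup>2"
    using P by (intro mult_left_mono power_mono) auto
  also have "\<dots> \<le> (199 / 200 * T)\<^sup>2"
    by (simp add: power_mult_distrib power2_eq_square)
  also have "\<dots> \<le> (cmod (\<beta> * p + \<alpha> * q))\<^sup>2"
    using Q T by (intro power_mono) auto
  finally show ?thesis by (simp add: norm_power)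
qed

lemma unbalanced_step:
  assumes "x \<in> hcoords" "cmod (fst x) \<le> core_radius" "\<not> balanced 2 x"
  shows "\<not> balanced 2 (F x)"
proof (cases x)
  case (fields w p q)
  have w: "cmod (off_coeff w) \<le> cmod (diag_coeff w) / 100" using assms(2) core_radius(4) fields by simp
  have "2 * cmod p \<le> cmod q \<or> 2 * cmod q \<le> cmod p"
    using assms(3) by (auto simp: balanced_def fields)
  then show ?thesis
  proof
    assume "2 * cmod p \<le> cmod q"
    from half_step[OF w this] show ?thesis by (auto simp: balanced_def fields)
  next
    assume "2 * cmod q \<le> cmod p"
    from half_step[OF w this] show ?thesis by (auto simp: balanced_def fields add.commute)
  qed
qed

lemma power_2_power_le: "0 \<le> (r::real) \<Longrightarrow> r \<le> 1 \<Longrightarrow> r ^ 2 ^ n \<le> r"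
  using power_decreasing[of 1 "2 ^ n" r] by simp

lemma unbalanced_forever:
  assumes "x \<in> hcoords" "cmod (fst x) \<le> core_radius" "\<not> balanced 2 x"
  shows "\<not> balanced 2 ((F ^^ n) x)"
proof (induction n)
  case (Suc n)
  have "cmod (fst ((F ^^ n) x)) \<le> core_radius"
    unfolding funpow_F_fst norm_power
    using power_2_power_le[of "cmod (fst x)" n] assms(2) core_radius(2) by (meson norm_ge_zero less_imp_le order_trans)
  then show ?case
    using unbalanced_step[OF funpow_F_in_hcoords[OF assms(1)]] Suc by simp
qed (use assms in simp)

text \<open>Over w = 0 one has y = (1 - B) q / (q - p) and y - (1 - B) = (1 - B) p / (q - p), so
  equidistance means |p| = |q|; the point at infinity is p = q.\<close>

lemma S_1_eq: "S_1 B = {proj (0, p, q) |p q. p \<noteq> 0 \<and> cmod p = cmod q}"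
proof (intro Set.set_eqI iffI)
  have B: "1 - B \<noteq> 0" using norm_gt_1 by auto
  have mem: "y \<in> {proj (0, p, q) |p q. p \<noteq> 0 \<and> cmod p = cmod q}"
    if "y = proj (0, p, q)" "p \<noteq> 0" "cmod p = cmod q" for y p q
    using that by (intro CollectI exI[of _ p] exI[of _ q] conjI)
  {
    fix y assume "y \<in> S_1 B"
    then consider "y = (Some 1, None)" | u where "y = (Some 1, Some u)" "cmod u = cmod (u - (1 - B))"
      by (auto simp: S_1_def dist_norm)
    then show "y \<in> {proj (0, p, q) |p q. p \<noteq> 0 \<and> cmod p = cmod q}"
    proof cases
      case 1
      then have "y = proj (0, 1, 1)" by (simp add: ratio_def)
      then show ?thesis by (rule mem) simp_all
    next
      case 2
      have "(1 - B) * (u + (u - (1 - B))) + (1 - B) * (u - (u - (1 - B))) = 2 * (1 - B) * u"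
        by (simp add: algebra_simps)
      then have "y = proj (0, u - (1 - B), u)"
        using B 2 by (simp add: ratio_def crit_0)
      moreover have "u - (1 - B) \<noteq> 0" using 2 B by auto
      moreover have "cmod (u - (1 - B)) = cmod u" using 2(2) by simp
      ultimately show ?thesis by (rule mem)
    qed
  next
    fix y assume "y \<in> {proj (0, p, q) |p q. p \<noteq> 0 \<and> cmod p = cmod q}"
    then obtain p q where y: "y = proj (0, p, q)" and pq: "p \<noteq> 0" "cmod p = cmod q" by blast
    show "y \<in> S_1 B"
    proof (cases "p = q")
      case True
      then show ?thesis by (simp add: y ratio_def S_1_def)
    next
      case False
      have "(1 - B) * (q + p) + (1 - B) * (q - p) = 2 * ((1 - B) * q)" by (simp add: algebra_simps)
      then have e: "y = (Some 1, Some ((1 - B) * q / (q - p)))"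
        using False by (simp add: y ratio_def crit_0 del: right_diff_distrib_numeral)
      have "(1 - B) * q / (q - p) - (1 - B) = (1 - B) * p / (q - p)"
        using False by (simp add: field_simps)
      then have "cmod ((1 - B) * q / (q - p) - (1 - B)) = cmod ((1 - B) * q / (q - p))"
        by (simp add: norm_divide norm_mult pq)
      then show ?thesis by (simp add: e S_1_def dist_norm)
    qed
  }
qed

text \<open>The complement of \<open>U\<close> is the image of the unbalanced points of norm 1 over
  |w| \<le> 1 / 2. Normalisation makes that set compact, so its image is closed in the Hausdorff
  space \<open>P1xP1\<close>.\<close>

lemma S_1_neighbourhood:
  obtains U where "openin P1xP1 U" "S_1 B \<subseteq> U"
    "\<And>x. x \<in> hcoords \<Longrightarrow> cmod (fst x) \<le> 1 / 2 \<Longrightarrow> proj x \<in> U \<Longrightarrow> balanced 2 x"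
proof -
  define K where "K = {x::complex \<times> complex \<times> complex. cmod (fst x) \<le> 1 / 2} \<inter>
      {x. (cmod (fst (snd x)))\<^sup>2 + (cmod (snd (snd x)))\<^sup>2 = 1} \<inter>
      ({x. 2 * cmod (fst (snd x)) \<le> cmod (snd (snd x))} \<union> {x. 2 * cmod (snd (snd x)) \<le> cmod (fst (snd x))})"
  have nrm: "cmod p \<le> 1 \<and> cmod q \<le> 1" if "(cmod p)\<^sup>2 + (cmod q)\<^sup>2 = 1" for p q
    using that power2_le_imp_le[of "cmod p" 1] power2_le_imp_le[of "cmod q" 1]
      zero_le_power2[of "cmod p"] zero_le_power2[of "cmod q"] by simp
  have "closed K"
    unfolding K_def
    by (intro closed_Int closed_Un closed_Collect_le closed_Collect_eq)
       (auto intro!: continuous_intros)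
  moreover have "K \<subseteq> cball 0 1 \<times> cball 0 1 \<times> cball 0 1"
    using nrm by (auto simp: K_def)
  then have "bounded K"
    using bounded_Times[OF bounded_cball bounded_Times[OF bounded_cball bounded_cball]] bounded_subset by blast
  ultimately have "compact K" by (simp add: compact_eq_bounded_closed)
  moreover have Kd: "K \<subseteq> hcoords" by (auto simp: K_def hcoords_def)
  ultimately have "compactin P1xP1 (proj ` K)"
    by (intro image_compactin[OF _ continuous_map_proj]) (simp add: compactin_subtopology)
  then have "closedin P1xP1 (proj ` K)"
    by (rule compactin_imp_closedin[OF Hausdorff_space_P1xP1])
  then have o: "openin P1xP1 (topspace P1xP1 - proj ` K)" by blast
  have top: "topspace P1xP1 = UNIV"
    using UNIV_option_conv[where 'a=complex] by (simp add: P1xP1_def P1_def image_def)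
  have "proj (0, p, q) \<notin> proj ` K" if pq: "p \<noteq> 0" "cmod p = cmod q" for p q
  proof
    assume "proj (0, p, q) \<in> proj ` K"
    then obtain x where x: "x \<in> K" "proj (0, p, q) = proj x" by blast
    have "(0, p, q) \<in> hcoords" using pq by (simp add: hcoords_def)
    moreover have "x \<in> hcoords" using x(1) Kd by blast
    ultimately obtain c where c: "c \<noteq> 0" "x = scale c (0, p, q)"
      using proj_eq_scale[OF x(2)] by auto
    then show False using x(1) pq by (auto simp: K_def scale_def norm_mult)
  qed
  then have S: "S_1 B \<subseteq> topspace P1xP1 - proj ` K"
    unfolding S_1_eq top by auto
  have "balanced 2 x" if x: "x \<in> hcoords" "cmod (fst x) \<le> 1 / 2" "proj x \<in> topspace P1xP1 - proj ` K" for x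
  proof (rule ccontr)
    assume nb: "\<not> balanced 2 x"
    define n where "n = sqrt ((cmod (fst (snd x)))\<^sup>2 + (cmod (snd (snd x)))\<^sup>2)"
    have "n > 0" using x(1) by (auto simp: n_def hcoords_def sum_power2_gt_zero_iff)
    define c where "c = complex_of_real (1 / n)"
    have c: "c \<noteq> 0" using \<open>n > 0\<close> by (simp add: c_def)
    have n2: "n\<^sup>2 = (cmod (fst (snd x)))\<^sup>2 + (cmod (snd (snd x)))\<^sup>2" by (simp add: n_def)
    have "(cmod (c * fst (snd x)))\<^sup>2 + (cmod (c * snd (snd x)))\<^sup>2 = n\<^sup>2 * (1 / n)\<^sup>2"
      unfolding n2 by (simp add: c_def norm_mult norm_divide power_mult_distrib power_divide add_divide_distrib)
    also have "\<dots> = 1" using \<open>n > 0\<close> by (simp add: power_divide)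
    finally have n1: "(cmod (c * fst (snd x)))\<^sup>2 + (cmod (c * snd (snd x)))\<^sup>2 = 1" .
    have "\<not> balanced 2 (scale c x)" by (simp only: balanced_scale[OF c] nb not_False_eq_True)
    then have "2 * cmod (c * fst (snd x)) \<le> cmod (c * snd (snd x)) \<or> 2 * cmod (c * snd (snd x)) \<le> cmod (c * fst (snd x))"
      unfolding balanced_def scale_def fst_conv snd_conv by linarith
    then have "scale c x \<in> K"
      unfolding K_def scale_def Int_iff Un_iff mem_Collect_eq fst_conv snd_conv using x(2) n1 by blast
    then have "proj x \<in> proj ` K" using imageI[of "scale c x" K proj] proj_scale'[OF c, of x] by simp
    then show False using x(3) by simp
  qed
  from that[OF o S this] show ?thesis .
qed

section \<open>The stable set in homogeneous coordinates\<close>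

definition W_lift :: "(complex \<times> complex \<times> complex) set" where
  "W_lift = {x \<in> hcoords. proj x \<in> W_1 B}"

lemma W_lift_hcoords: "x \<in> W_lift \<Longrightarrow> x \<in> hcoords" by (simp add: W_lift_def)

lemma W_lift_norm: "x \<in> W_lift \<Longrightarrow> cmod (fst x) < 1" by (auto simp: W_lift_def hcoords_def)

text \<open>Convergence ignores the first term of an orbit. The implication from \<open>F x\<close>
  to \<open>x\<close> is what keeps lifts through \<open>F\<close> in the stable set.\<close>

lemma F_W_lift_iff: "x \<in> hcoords \<Longrightarrow> F x \<in> W_lift \<longleftrightarrow> x \<in> W_lift"
proof -
  assume x: "x \<in> hcoords"
  have "(newton B ^^ n) (newton B (proj x)) = (newton B ^^ Suc n) (proj x)" for n
    by (simp add: funpow_swap1)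
  then have "converges_to_set P1xP1 (\<lambda>n. (newton B ^^ n) (newton B (proj x))) (S_1 B) \<longleftrightarrow>
      converges_to_set P1xP1 (\<lambda>n. (newton B ^^ n) (proj x)) (S_1 B)"
    unfolding converges_to_set_def
    using eventually_sequentially_Suc[of "\<lambda>n. (newton B ^^ n) (proj x) \<in> _"] by simp
  then show ?thesis
    using x proj_in_X_r F_in_hcoords newton_proj[OF x] by (auto simp: W_lift_def W_1_def)
qed

lemma funpow_F_W_lift: "x \<in> W_lift \<Longrightarrow> (F ^^ n) x \<in> W_lift"
  by (induction n) (auto simp: F_W_lift_iff W_lift_hcoords)

lemma scale_W_lift: "c \<noteq> 0 \<Longrightarrow> x \<in> W_lift \<Longrightarrow> scale c x \<in> W_lift"
  by (simp add: W_lift_def scale_in_hcoords proj_scale')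

lemma fst_tendsto_0: "x \<in> hcoords \<Longrightarrow> (\<lambda>n. fst ((F ^^ n) x)) \<longlonglongrightarrow> 0"
proof -
  assume "x \<in> hcoords"
  then have "cmod (fst x) < 1" by (auto simp: hcoords_def)
  then have "(\<lambda>n. fst x ^ n) \<longlonglongrightarrow> 0" by (rule LIMSEQ_power_zero)
  moreover have "filterlim (\<lambda>n. 2 ^ n :: nat) at_top sequentially"
    by (rule filterlim_subseq) (simp add: strict_mono_def)
  ultimately show ?thesis unfolding funpow_F_fst by (rule filterlim_compose)
qed

text \<open>An unbalanced point over the core stays unbalanced by \<open>unbalanced_forever\<close>,
  whereas near \<open>S_1\<close> all points are balanced.\<close>

lemma W_lift_balanced:
  assumes x: "x \<in> W_lift" "cmod (fst x) \<le> core_radius"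
  shows "balanced 2 x"
proof (rule ccontr)
  assume nb: "\<not> balanced 2 x"
  obtain U where U: "openin P1xP1 U" "S_1 B \<subseteq> U"
    "\<And>x. x \<in> hcoords \<Longrightarrow> cmod (fst x) \<le> 1 / 2 \<Longrightarrow> proj x \<in> U \<Longrightarrow> balanced 2 x"
    by (rule S_1_neighbourhood) blast
  have "\<forall>\<^sub>F n in sequentially. (newton B ^^ n) (proj x) \<in> U"
    using x(1) U by (auto simp: W_lift_def W_1_def converges_to_set_def)
  moreover have "\<forall>\<^sub>F n in sequentially. dist (fst ((F ^^ n) x)) 0 < 1 / 2"
    using fst_tendsto_0[OF W_lift_hcoords[OF x(1)]] by (rule tendstoD) simp
  ultimately have "\<forall>\<^sub>F n in sequentially. balanced 2 ((F ^^ n) x)"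
  proof eventually_elim
    case (elim n)
    show ?case
      by (rule U(3)[OF funpow_F_in_hcoords[OF W_lift_hcoords[OF x(1)]]])
         (use elim newton_funpow_proj[OF W_lift_hcoords[OF x(1)], of n] in simp_all)
  qed
  then show False
    using unbalanced_forever[OF W_lift_hcoords[OF x(1)] x(2) nb] by simp
qed

lemma coeff_ratio_tendsto_0: "x \<in> hcoords \<Longrightarrow> (\<lambda>n. off_coeff (fst ((F ^^ n) x)) / diag_coeff (fst ((F ^^ n) x))) \<longlonglongrightarrow> 0"
proof -
  assume x: "x \<in> hcoords"
  have 0: "diag_coeff 0 \<noteq> 0" "off_coeff 0 = 0" using core_radius(1) core_radius(3)[of 0] by (simp_all add: off_coeff_def)
  have "isCont diag_coeff 0" "isCont off_coeff 0"
    using continuous_on_diag_coeff continuous_on_off_coeff by (auto simp: continuous_on_eq_continuous_at)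
  then have "isCont (\<lambda>w. off_coeff w / diag_coeff w) 0" using 0 by (intro continuous_intros)
  from isCont_tendsto_compose[OF this fst_tendsto_0[OF x]] show ?thesis using 0 by simp
qed

text \<open>A converse of \<open>W_lift_balanced\<close> for annuli of any width. Along the orbit
  log |z| is bounded and doubles up to an error tending to 0, so it tends to 0. The argument of z
  may be arbitrary, as convergence is to the circle and not to one of its points.\<close>

lemma W_1_if_bounded:
  assumes x: "x \<in> hcoords" and K: "\<And>n. n \<ge> N \<Longrightarrow> balanced K ((F ^^ n) x)"
  shows "proj x \<in> W_1 B"
proof -
  define w p q where "w = (\<lambda>n. fst ((F ^^ n) x))" and "p = (\<lambda>n. fst (snd ((F ^^ n) x)))"
    and "q = (\<lambda>n. snd (snd ((F ^^ n) x)))"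
  have Fn: "(F ^^ n) x = (w n, p n, q n)" for n by (simp add: w_def p_def q_def)
  have bal: "cmod (p n) < K * cmod (q n)" "cmod (q n) < K * cmod (p n)" if "n \<ge> N" for n
    using K[OF that] by (simp_all add: balanced_def Fn)
  have pq: "p n \<noteq> 0" "q n \<noteq> 0" if "n \<ge> N" for n
    using bal[OF that] by auto
  have K0: "K > 0" using bal(1)[of N] pq(2)[of N]
    by (metis less_le_trans mult_nonpos_nonneg norm_ge_zero not_le order_refl)
  have rat: "cmod (p n / q n) < K" "cmod (q n / p n) < K" if "n \<ge> N" for n
    using bal[OF that] pq[OF that] by (simp_all add: norm_divide divide_less_eq)
  define \<delta> where "\<delta> = (\<lambda>n. off_coeff (w n) / diag_coeff (w n))"
  have \<delta>: "\<delta> \<longlonglongrightarrow> 0" unfolding \<delta>_def w_def using coeff_ratio_tendsto_0[OF x] .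
  have small: "(\<lambda>n. \<delta> n * f n) \<longlonglongrightarrow> 0" if "\<And>n. n \<ge> N \<Longrightarrow> cmod (f n) < K" for f
  proof (rule Lim_null_comparison)
    show "\<forall>\<^sub>F n in sequentially. norm (\<delta> n * f n) \<le> cmod (\<delta> n) * K"
      unfolding eventually_sequentially using that
      by (intro exI[of _ N]) (auto simp: norm_mult intro!: mult_left_mono intro: less_imp_le)
    show "(\<lambda>n. cmod (\<delta> n) * K) \<longlonglongrightarrow> 0"
      by (intro tendsto_mult_left_zero tendsto_norm_zero \<delta>)
  qed
  \<comment> \<open>\<open>h n\<close> is the relative error caused by the Moebius transformation:
    the next ratio is \<open>(p n / q n)\<^sup>2 * (h n)\<^sup>2\<close>.\<close>
  define h where "h = (\<lambda>n. (1 + \<delta> n * (q n / p n)) / (1 + \<delta> n * (p n / q n)))"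
  have "h \<longlonglongrightarrow> (1 + 0) / (1 + 0)"
    unfolding h_def by (intro tendsto_intros small rat) auto
  then have "(\<lambda>n. ln (cmod (h n))) \<longlonglongrightarrow> ln (cmod 1)"
    by (intro tendsto_intros) auto
  then have h0: "(\<lambda>n. 2 * ln (cmod (h n))) \<longlonglongrightarrow> 0"
    using tendsto_mult_right_zero[of "\<lambda>n. ln (cmod (h n))" sequentially 2] by simp
  define t where "t = (\<lambda>n. ln (cmod (p n / q n)))"
  have step: "t (Suc n) - 2 * t n = 2 * ln (cmod (h n))" if n: "n \<ge> N" "cmod (w n) \<le> core_radius" for n
  proof -
    have diag_coeff: "diag_coeff (w n) \<noteq> 0" using core_radius(3) n by blast
    have S: "p (Suc n) = (diag_coeff (w n) * p n + off_coeff (w n) * q n)\<^sup>2" "q (Suc n) = (off_coeff (w n) * p n + diag_coeff (w n) * q n)\<^sup>2"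
      using Fn[of "Suc n"] by (simp_all add: Fn)
    have nz: "diag_coeff (w n) * p n + off_coeff (w n) * q n \<noteq> 0" "off_coeff (w n) * p n + diag_coeff (w n) * q n \<noteq> 0"
      using pq[of "Suc n"] n(1) S by auto
    have h1: "1 + \<delta> n * (q n / p n) = (diag_coeff (w n) * p n + off_coeff (w n) * q n) / (diag_coeff (w n) * p n)"
      "1 + \<delta> n * (p n / q n) = (off_coeff (w n) * p n + diag_coeff (w n) * q n) / (diag_coeff (w n) * q n)"
      using diag_coeff pq[OF n(1)] by (simp_all add: \<delta>_def field_simps)
    have "p (Suc n) / q (Suc n) = (p n / q n)\<^sup>2 * (h n)\<^sup>2"
      unfolding S h_def h1 using diag_coeff pq[OF n(1)] nz by (simp add: power_divide power_mult_distrib)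
    moreover have "h n \<noteq> 0" unfolding h_def h1 using nz diag_coeff pq[OF n(1)] by simp
    ultimately show ?thesis
      unfolding t_def using pq[OF n(1)] by (simp add: norm_mult norm_power ln_mult ln_realpow)
  qed
  have ev: "\<forall>\<^sub>F n in sequentially. n \<ge> N \<and> cmod (w n) \<le> core_radius"
  proof -
    have "\<forall>\<^sub>F n in sequentially. dist (w n) 0 < core_radius"
      using fst_tendsto_0[OF x] core_radius(1) unfolding w_def by (rule tendstoD)
    then show ?thesis using eventually_ge_at_top[of N] by eventually_elim auto
  qed
  have "(\<lambda>n. t (Suc n) - 2 * t n) \<longlonglongrightarrow> 0"
    by (rule Lim_transform_eventually[OF h0 eventually_mono[OF ev]]) (simp add: step)
  moreover have "\<bar>t n\<bar> \<le> ln K" if n: "n \<ge> N" for n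
  proof -
    have "t n \<le> ln K"
      unfolding t_def using rat(1)[OF n] pq[OF n] K0 by (subst ln_le_cancel_iff) auto
    moreover have "- t n = ln (cmod (q n / p n))"
      unfolding t_def using pq[OF n] by (simp add: norm_divide ln_div)
    then have "- t n \<le> ln K"
      using rat(2)[OF n] pq[OF n] K0 by (simp only:) (subst ln_le_cancel_iff, auto)
    ultimately show ?thesis by simp
  qed
  ultimately have "t \<longlonglongrightarrow> 0" using doubling_bounded_tendsto_0 by blast
  then have "(\<lambda>n. exp (t n)) \<longlonglongrightarrow> exp 0" by (rule tendsto_exp)
  moreover have "\<forall>\<^sub>F n in sequentially. exp (t n) = cmod (p n / q n)"
    unfolding eventually_sequentially t_def using pq by (intro exI[of _ N]) auto
  ultimately have lim1: "(\<lambda>n. cmod (p n / q n)) \<longlonglongrightarrow> 1"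
    using Lim_transform_eventually by fastforce
  have "converges_to_set P1xP1 (\<lambda>n. (newton B ^^ n) (proj x)) (S_1 B)"
    unfolding converges_to_set_def
  proof (intro allI impI)
    fix U assume U: "openin P1xP1 U \<and> S_1 B \<subseteq> U"
    \<comment> \<open>In the chart q = 1 the set \<open>S_1\<close> is {0} times the unit circle,
      which is compact, so a uniform neighbourhood of it maps into \<open>U\<close>. Below,
      \<open>sgn z\<close> is the point of the circle closest to \<open>z\<close>.\<close>
    define g where "g = (\<lambda>y::complex \<times> complex. (fst y, snd y, 1::complex))"
    define D where "D = {y::complex \<times> complex. cmod (fst y) < 1}"
    have D: "open D" unfolding D_def by (intro open_Collect_less continuous_intros)
    have "continuous_map (top_of_set D) (top_of_set hcoords) g"
      by (auto simp: g_def D_def hcoords_def intro!: continuous_intros)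
    note c = continuous_map_compose[OF this continuous_map_proj]
    have "openin (top_of_set D) {y \<in> topspace (top_of_set D). (proj \<circ> g) y \<in> U}"
      by (rule openin_continuous_map_preimage[OF c]) (use U in simp)
    then have "openin (top_of_set D) {y \<in> D. proj (g y) \<in> U}" by simp
    then have op: "open {y \<in> D. proj (g y) \<in> U}"
      using D openin_open_trans by blast
    have sub: "{0} \<times> sphere 0 1 \<subseteq> {y \<in> D. proj (g y) \<in> U}"
    proof
      fix y :: "complex \<times> complex" assume "y \<in> {0} \<times> sphere 0 1"
      then obtain z where z: "y = (0, z)" "cmod z = 1" by auto
      then have "proj (0, z, 1) \<in> S_1 B"
        unfolding S_1_eq by (intro CollectI exI[of _ z] exI[of _ 1] conjI) auto
      then show "y \<in> {y \<in> D. proj (g y) \<in> U}"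
        using z U by (auto simp: g_def D_def simp del: proj.simps)
    qed
    have "compact ({0::complex} \<times> sphere (0::complex) 1)" by (intro compact_Times) auto
    from compact_subset_open_imp_ball_epsilon_subset[OF this op sub] obtain e where e: "e > 0"
      "(\<Union>y\<in>{0} \<times> sphere 0 1. ball y e) \<subseteq> {y \<in> D. proj (g y) \<in> U}"
      by blast
    have "\<forall>\<^sub>F n in sequentially. dist (w n) 0 < e / 2"
      using fst_tendsto_0[OF x] e(1) unfolding w_def by (intro tendstoD) auto
    moreover have "\<forall>\<^sub>F n in sequentially. dist (cmod (p n / q n)) 1 < e / 2"
      using lim1 e(1) by (intro tendstoD) auto
    ultimately show "\<forall>\<^sub>F n in sequentially. (newton B ^^ n) (proj x) \<in> U"
      using eventually_ge_at_top[of N]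
    proof eventually_elim
      case (elim n)
      define z where "z = p n / q n"
      have z: "z \<noteq> 0" using pq elim(3) by (simp add: z_def)
      have "dist z (sgn z) = \<bar>cmod z - 1\<bar>"
      proof -
        have "z - sgn z = of_real (cmod z - 1) * sgn z"
          using z by (simp add: sgn_eq field_simps)
        then show ?thesis using z by (simp add: dist_norm norm_mult norm_sgn del: of_real_diff)
      qed
      then have "dist (w n, z) (0, sgn z) < e"
        using elim(1,2) sqrt_sum_squares_le_sum_abs[of "dist (w n) 0" "dist z (sgn z)"]
        by (simp add: dist_prod_def dist_real_def flip: z_def)
      then have "(w n, z) \<in> (\<Union>y\<in>{0} \<times> sphere 0 1. ball y e)"
        by (intro UN_I[of "(0, sgn z)"]) (use z in \<open>simp_all add: norm_sgn dist_commute\<close>)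
      then have "(w n, z) \<in> {y \<in> D. proj (g y) \<in> U}"
        by (rule subsetD[OF e(2)])
      then have "proj (w n, z, 1) \<in> U" by (simp add: g_def)
      moreover have "proj (w n, q n * z, q n * 1) = proj (w n, z, 1)"
        using pq elim(3) by (intro proj_scale) auto
      ultimately show ?case
        using newton_funpow_proj[OF x] Fn pq[OF elim(3)] by (simp add: z_def del: proj.simps)
    qed
  qed
  then show ?thesis using proj_in_X_r[OF x] by (simp add: W_1_def)
qed

end

section \<open>Lifting paths and the leaves of the stable set\<close>

text \<open>The path may pass through 0, so this is not lifting through a covering. Off its zeros
  the parameters form a union of intervals, on which there is a continuous logarithm; at a zero any
  choice of signs is continuous, because the modulus of the root is
  \<open>sqrt (cmod (f t))\<close>.\<close>

lemma path_square_root: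
  fixes f :: "real \<Rightarrow> complex"
  assumes f: "continuous_on {0..1} f" and r: "r\<^sup>2 = f 0"
  shows "\<exists>g. continuous_on {0..1} g \<and> g 0 = r \<and> (\<forall>t\<in>{0..1}. (g t)\<^sup>2 = f t)"
proof -
  define S where "S = {0..1} \<inter> f -` (- {0})"
  have S_open: "openin (top_of_set {0..1}) S"
    unfolding S_def by (rule continuous_openin_preimage_gen[OF f]) auto
  have "locally connected {0..1::real}" by (simp add: convex_imp_locally_connected)
  then have lc: "locally connected S"
    using S_open by (rule locally_open_subset)
  have "Borsukian C" if "C \<in> components S" for C
    using in_components_connected[OF that] by (intro convex_imp_Borsukian) (simp add: connected_convex_1)
  then have "Borsukian S" using Borsukian_componentwise_eq[of S] lc by blast
  moreover have "continuous_on S f" using f by (rule continuous_on_subset) (auto simp: S_def)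
  moreover have "f \<in> S \<rightarrow> - {0}" by (auto simp: S_def)
  ultimately obtain l where l: "continuous_on S l" "\<And>t. t \<in> S \<Longrightarrow> f t = exp (l t)"
    unfolding Borsukian_continuous_logarithm by blast
  define g where "g = (\<lambda>t. if t \<in> S then exp (l t / 2) else 0)"
  have sq: "(g t)\<^sup>2 = f t" if "t \<in> {0..1}" for t
    using l(2)[of t] that by (auto simp: g_def S_def simp flip: exp_double)
  have "continuous (at t within {0..1}) g" if t: "t \<in> {0..1}" for t
  proof (cases "t \<in> S")
    case True
    obtain T where T: "open T" "S = {0..1} \<inter> T" using S_open by (auto simp: openin_open)
    have "continuous_on S (\<lambda>t. exp (l t / 2))" using l(1) by (intro continuous_intros) auto
    then have "continuous_on S g" by (rule continuous_on_eq) (simp add: g_def)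
    then have "continuous (at t within S) g" using True by (simp add: continuous_on_eq_continuous_within)
    moreover have "at t within S = at t within {0..1}"
      using T True by (intro at_within_nhd[of t T]) auto
    ultimately show ?thesis by simp
  next
    case False
    then have ft: "f t = 0" "g t = 0" using t by (auto simp: S_def g_def)
    have "((\<lambda>s. sqrt (cmod (f s))) \<longlongrightarrow> sqrt (cmod (f t))) (at t within {0..1})"
      using f t by (intro tendsto_intros) (auto simp: continuous_on_def)
    moreover have "\<forall>\<^sub>F s in at t within {0..1}. norm (g s) \<le> sqrt (cmod (f s))"
      unfolding eventually_at_filter
      by (intro always_eventually) (auto simp: real_le_rsqrt norm_power simp flip: sq)
    ultimately have "(g \<longlongrightarrow> 0) (at t within {0..1})"
      using ft Lim_null_comparison[of g "\<lambda>s. sqrt (cmod (f s))"] by simp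
    then show ?thesis using ft by (simp add: continuous_within)
  qed
  then have g: "continuous_on {0..1} g" by (simp add: continuous_on_eq_continuous_within)
  have "(g 0)\<^sup>2 = r\<^sup>2" using sq[of 0] r by simp
  then consider "g 0 = r" | "- g 0 = r" by (auto simp: power2_eq_iff)
  then show ?thesis
  proof cases
    case 1
    then show ?thesis using g sq by (intro exI[of _ g]) auto
  next
    case 2
    then show ?thesis using g sq by (intro exI[of _ "\<lambda>t. - g t"]) (auto intro!: continuous_intros)
  qed
qed

text \<open>A bootstrap from |s - 1| |s + 1| \<le> 1 / 2 for the root s: Re s \<ge> 0 gives |s - 1|
  \<le> 1 / 2, hence Re s \<ge> 1 / 2, and then |s + 1| \<ge> 3 / 2 improves the bound to 1 /
  3.\<close>

lemma near_1_csqrt: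
  assumes "cmod (e - 1) \<le> 1 / 2"
  shows "cmod (csqrt e - 1) \<le> 1 / 3"
proof -
  define s where "s = csqrt e"
  have s: "s\<^sup>2 = e" "Re s \<ge> 0" by (simp_all add: s_def Re_csqrt del: csqrt.simps)
  have "e - 1 = (s - 1) * (s + 1)" using s(1) by (simp add: power2_eq_square algebra_simps)
  then have prod: "cmod (s - 1) * cmod (s + 1) \<le> 1 / 2" using assms by (simp add: norm_mult)
  have r: "cmod (s + 1) \<ge> Re s + 1" using complex_Re_le_cmod[of "s + 1"] by simp
  have "cmod (s - 1) * 1 \<le> cmod (s - 1) * cmod (s + 1)"
    using r s(2) by (intro mult_left_mono) auto
  then have h: "cmod (s - 1) \<le> 1 / 2" using prod by simp
  then have "Re s \<ge> 1 / 2" using abs_Re_le_cmod[of "s - 1"] by simp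
  then have "cmod (s - 1) * (3 / 2) \<le> cmod (s - 1) * cmod (s + 1)"
    using r by (intro mult_left_mono) auto
  then show ?thesis using prod unfolding s_def by linarith
qed

text \<open>The inverse branch of \<open>z \<mapsto> ((z + d) / (1 + d * z))\<^sup>2\<close> used to construct the leaf of \<open>W_1\<close> through
  a point: the argument and the value are given relative to the orbit of that point, which
  corresponds to \<open>e = 1\<close>.\<close>

definition pull :: "complex \<Rightarrow> complex \<Rightarrow> complex \<Rightarrow> complex \<Rightarrow> complex" where
  "pull d a z e = ((a * csqrt e - d) / (1 - d * (a * csqrt e))) / z"

text \<open>\<open>z\<close> lies on the reference orbit, with coefficient \<open>d1\<close>, and
  \<open>a\<close> is its image before squaring; \<open>d\<close> is the coefficient at the point of
  the leaf over another base point.\<close>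

locale pull_bounds =
  fixes d d1 a z :: complex
  assumes d: "cmod d \<le> 1 / 100" and d1: "cmod d1 \<le> 1 / 100"
    and z: "1 / 2 < cmod z" "cmod z < 2" and a: "a = (z + d1) / (1 + d1 * z)"
begin

lemma z0: "z \<noteq> 0" using z by auto

lemma norm_d1_z: "cmod (d1 * z) \<le> 1 / 50" "cmod (d1 / z) \<le> 1 / 50" "cmod (d / z) \<le> 1 / 50"
proof -
  have "cmod d1 * cmod z \<le> 1 / 100 * 2" using d1 z by (intro mult_mono) auto
  then show "cmod (d1 * z) \<le> 1 / 50" by (simp add: norm_mult)
  have "x / cmod z \<le> (1 / 100) / (1 / 2)" if "x \<le> 1 / 100" "x \<ge> 0" for x
    using that z by (intro frac_le) auto
  from this[OF d1] this[OF d] show "cmod (d1 / z) \<le> 1 / 50" "cmod (d / z) \<le> 1 / 50" by (simp_all add: norm_divide)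
qed

lemma a_over_z: "cmod (a / z - 1) \<le> 42 / 1000" "cmod (a / z) \<le> 1042 / 1000" "cmod a \<le> 2084 / 1000"
proof -
  have "cmod 1 \<le> cmod (1 + d1 * z) + cmod (d1 * z)"
    using norm_triangle_ineq4[of "1 + d1 * z" "d1 * z"] by simp
  then have den: "cmod (1 + d1 * z) \<ge> 49 / 50" using norm_d1_z by simp
  then have nz: "1 + d1 * z \<noteq> 0" by auto
  have "a / z - 1 = (d1 / z - d1 * z) / (1 + d1 * z)"
  proof -
    define N where "N = 1 + d1 * z"
    have "N \<noteq> 0" using nz by (simp add: N_def)
    then have "(z + d1) / N / z - 1 = (d1 / z - d1 * z) / N"
      using z0 by (simp add: field_simps) (simp add: N_def algebra_simps)
    then show ?thesis by (simp add: a N_def)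
  qed
  then have "cmod (a / z - 1) = cmod (d1 / z - d1 * z) / cmod (1 + d1 * z)" by (simp add: norm_divide)
  also have "\<dots> \<le> (1 / 25) / (49 / 50)"
    using norm_triangle_ineq4[of "d1 / z" "d1 * z"] norm_d1_z den by (intro frac_le) auto
  also have "\<dots> \<le> 42 / 1000" by simp
  finally show 1: "cmod (a / z - 1) \<le> 42 / 1000" .
  show 2: "cmod (a / z) \<le> 1042 / 1000"
    using norm_triangle_ineq[of "a / z - 1" 1] 1 by simp
  have "cmod a = cmod (a / z) * cmod z" using z0 by (simp add: norm_divide)
  also have "\<dots> \<le> 1042 / 1000 * 2" using 2 z by (intro mult_mono) auto
  finally show "cmod a \<le> 2084 / 1000" by simp
qed

lemma den_bound:
  assumes "cmod (e - 1) \<le> 1 / 2"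
  shows "cmod (d * (a * csqrt e)) \<le> 28 / 1000" "cmod (1 - d * (a * csqrt e)) \<ge> 972 / 1000"
proof -
  have s: "cmod (csqrt e) \<le> 4 / 3"
    using near_1_csqrt[OF assms] norm_triangle_ineq[of "csqrt e - 1" 1] by simp
  have "cmod a * cmod (csqrt e) \<le> 2084 / 1000 * (4 / 3)"
    using s a_over_z(3) by (intro mult_mono) auto
  then have "cmod d * (cmod a * cmod (csqrt e)) \<le> 1 / 100 * (2084 / 1000 * (4 / 3))"
    by (rule mult_mono[OF d]) auto
  then show 1: "cmod (d * (a * csqrt e)) \<le> 28 / 1000" by (simp only: norm_mult)
  show "cmod (1 - d * (a * csqrt e)) \<ge> 972 / 1000"
    using norm_triangle_ineq2[of 1 "d * (a * csqrt e)"] 1 by simp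
qed

text \<open>The root shrinks the ball to radius 1 / 3 and the other terms are small: the numerator
  is at most 0.056 + 1/3 + 0.02 + 0.028 < 0.438, and 0.438 / 0.972 < 1 / 2.\<close>

lemma pull_ball:
  assumes e: "cmod (e - 1) \<le> 1 / 2"
  shows "cmod (pull d a z e - 1) \<le> 1 / 2"
proof -
  define s where "s = csqrt e"
  define D where "D = 1 - d * (a * s)"
  have D: "cmod D \<ge> 972 / 1000" "cmod (d * (a * s)) \<le> 28 / 1000" using den_bound[OF e] by (simp_all add: D_def s_def)
  have s1: "cmod (s - 1) \<le> 1 / 3" using near_1_csqrt[OF e] by (simp add: s_def)
  then have s: "cmod s \<le> 4 / 3" using norm_triangle_ineq[of "s - 1" 1] by simp
  have D0: "D \<noteq> 0" using D by auto
  have "pull d a z e - 1 = ((a / z - 1) * s + (s - 1) - d / z + d * (a * s)) / D"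
    unfolding pull_def s_def[symmetric] D_def[symmetric] using D0 z0
    by (simp add: field_simps) (simp add: D_def algebra_simps)
  moreover have "cmod ((a / z - 1) * s + (s - 1) - d / z + d * (a * s)) \<le> 438 / 1000"
  proof -
    have "cmod ((a / z - 1) * s) \<le> 42 / 1000 * (4 / 3)"
      unfolding norm_mult using a_over_z(1) s by (intro mult_mono) auto
    then show ?thesis
      using s1 norm_d1_z(3) D(2) norm_triangle_ineq[of "(a / z - 1) * s + (s - 1) - d / z" "d * (a * s)"]
        norm_triangle_ineq4[of "(a / z - 1) * s + (s - 1)" "d / z"] norm_triangle_ineq[of "(a / z - 1) * s" "s - 1"]
      by linarith
  qed
  ultimately have "cmod (pull d a z e - 1) \<le> (438 / 1000) / (972 / 1000)"
    using D(1) by (simp only: norm_divide) (intro frac_le, auto)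
  then show ?thesis by simp
qed

text \<open>The square root contracts by 3 / 4, since the sum of the two roots has modulus at least
  4 / 3. The Moebius factors cost at most 1.042 * 1.0001 / 0.972^2, and the product stays below 9 /
  10.\<close>

lemma pull_contract:
  assumes e: "cmod (e - 1) \<le> 1 / 2" and e': "cmod (e' - 1) \<le> 1 / 2"
  shows "cmod (pull d a z e - pull d a z e') \<le> 9 / 10 * cmod (e - e')"
proof -
  define s s' where "s = csqrt e" and "s' = csqrt e'"
  define D D' where "D = 1 - d * (a * s)" and "D' = 1 - d * (a * s')"
  have D: "cmod D \<ge> 972 / 1000" "cmod D' \<ge> 972 / 1000"
    using den_bound[OF e] den_bound[OF e'] by (simp_all add: D_def s_def D'_def s'_def)
  have D0: "D \<noteq> 0" "D' \<noteq> 0" using D by auto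
  have s1: "cmod (s - 1) \<le> 1 / 3" "cmod (s' - 1) \<le> 1 / 3"
    using near_1_csqrt[OF e] near_1_csqrt[OF e'] by (simp_all add: s_def s'_def)
  have "Re s \<ge> 2 / 3" "Re s' \<ge> 2 / 3"
    using s1 abs_Re_le_cmod[of "s - 1"] abs_Re_le_cmod[of "s' - 1"] by auto
  then have ss: "cmod (s + s') \<ge> 4 / 3" using complex_Re_le_cmod[of "s + s'"] by simp
  have "e - e' = (s - s') * (s + s')" by (simp add: s_def s'_def algebra_simps flip: power2_eq_square)
  then have "cmod (e - e') = cmod (s - s') * cmod (s + s')" by (simp add: norm_mult)
  moreover have "cmod (s - s') * (4 / 3) \<le> cmod (s - s') * cmod (s + s')"
    using ss by (intro mult_left_mono) auto
  ultimately have sdiff: "cmod (s - s') \<le> 3 / 4 * cmod (e - e')" by linarith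
  have "pull d a z e - pull d a z e' = (a / z) * ((1 - d\<^sup>2) * (s - s')) / (D * D')"
    unfolding pull_def s_def[symmetric] s'_def[symmetric] D_def[symmetric] D'_def[symmetric] using D0 z0
    by (simp add: field_simps) (simp add: D_def D'_def algebra_simps power2_eq_square)
  then have "cmod (pull d a z e - pull d a z e') = cmod (a / z) * (cmod (1 - d\<^sup>2) * cmod (s - s')) / (cmod D * cmod D')"
    by (simp add: norm_mult norm_divide)
  also have "\<dots> \<le> (1042 / 1000 * (10001 / 10000 * (3 / 4 * cmod (e - e')))) / (972 / 1000 * (972 / 1000))"
  proof (intro frac_le mult_mono)
    have "cmod d * cmod d \<le> 1 / 100 * (1 / 100)" using d by (intro mult_mono) auto
    then show "cmod (1 - d\<^sup>2) \<le> 10001 / 10000"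
      using norm_triangle_ineq4[of 1 "d\<^sup>2"] by (simp add: norm_mult power2_eq_square)
  qed (use a_over_z D sdiff in auto)
  also have "\<dots> \<le> 9 / 10 * cmod (e - e')"
    by simp
  finally show ?thesis .
qed

end

text \<open>\<open>F\<close> moves the base point r w to r^2 w^2, so radius \<open>r\<close> at time
  \<open>n\<close> is tied to radius r^2 at time n + 1, and the unknown is the whole sequence
  \<open>E\<close>. The iterates of \<open>\<Gamma>\<close> from the constant 1 converge uniformly,
  at the rate (9/10)^k, so the limit is continuous. At \<open>r = 1\<close> the constant 1 is fixed:
  the leaf passes through the reference orbit.\<close>

lemma pull_orbit:
  fixes z :: "nat \<Rightarrow> complex" and d :: "nat \<Rightarrow> real \<Rightarrow> complex"
  assumes d: "\<And>n r. r \<in> {0..1} \<Longrightarrow> cmod (d n r) \<le> 1 / 100" "\<And>n. continuous_on {0..1} (d n)"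
    and z: "\<And>n. 1 / 2 < cmod (z n)" "\<And>n. cmod (z n) < 2"
    and a: "\<And>n. a n = (z n + d n 1) / (1 + d n 1 * z n)"
  shows "\<exists>E. \<forall>n. continuous_on {0..1} (E n) \<and> E n 1 = 1 \<and>
    (\<forall>r\<in>{0..1}. cmod (E n r - 1) \<le> 1 / 2 \<and> E n r = pull (d n r) (a n) (z n) (E (Suc n) (r\<^sup>2)))"
proof -
  have pb: "pull_bounds (d n r) (d n 1) (a n) (z n)" if "r \<in> {0..1}" for n r
    by unfold_locales (use that d z a in auto)
  define \<Gamma> where "\<Gamma> = (\<lambda>E n r. pull (d n r) (a n) (z n) (E (Suc n) (r\<^sup>2)))"
  define Es where "Es = (\<lambda>k. (\<Gamma> ^^ k) (\<lambda>n r. 1))"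
  have Es_Suc: "Es (Suc k) n r = pull (d n r) (a n) (z n) (Es k (Suc n) (r\<^sup>2))" for k n r
    by (simp add: Es_def \<Gamma>_def)
  have sq: "r\<^sup>2 \<in> {0..1}" if "r \<in> {0..1}" for r :: real
    using that by (auto simp: power_le_one)
  have ball: "cmod (Es k n r - 1) \<le> 1 / 2" if "r \<in> {0..1}" for k n r
    using that
  proof (induction k arbitrary: n r)
    case (Suc k)
    show ?case
      unfolding Es_Suc using Suc.IH[OF sq[OF Suc.prems]] by (rule pull_bounds.pull_ball[OF pb[OF Suc.prems]])
  qed (simp add: Es_def)
  have cont: "continuous_on {0..1} (Es k n)" for k n
  proof (induction k arbitrary: n)
    case (Suc k)
    have c: "continuous_on {0..1} (\<lambda>r. Es k (Suc n) (r\<^sup>2))"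
      by (rule continuous_on_compose2[OF Suc.IH]) (use sq in \<open>auto intro!: continuous_intros\<close>)
    have "Es k (Suc n) (r\<^sup>2) \<notin> \<real>\<^sub>\<le>\<^sub>0" if "r \<in> {0..1}" for r
      using ball[OF sq[OF that], of k "Suc n"] abs_Re_le_cmod[of "Es k (Suc n) (r\<^sup>2) - 1"]
      by (auto simp: complex_nonpos_Reals_iff)
    then have cs: "continuous_on {0..1} (\<lambda>r. csqrt (Es k (Suc n) (r\<^sup>2)))"
      by (intro continuous_on_compose2[OF continuous_on_csqrt c]) auto
    have "1 - d n r * (a n * csqrt (Es k (Suc n) (r\<^sup>2))) \<noteq> 0" if "r \<in> {0..1}" for r
      using pull_bounds.den_bound(2)[OF pb[OF that, of n] ball[OF sq[OF that], of k "Suc n"]] by auto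
    moreover have "z n \<noteq> 0" using z(1)[of n] by auto
    ultimately show ?case
      unfolding Es_Suc pull_def using cs d(2) by (intro continuous_intros) auto
  qed (simp add: Es_def)
  have one: "Es k n 1 = 1" for k n
  proof (induction k arbitrary: n)
    case (Suc k)
    interpret pull_bounds "d n 1" "d n 1" "a n" "z n" by (rule pb) simp
    have nz: "1 - d n 1 * a n \<noteq> 0" using den_bound(2)[of 1] by auto
    have "cmod (d n 1 * z n) < 1" using norm_d1_z(1) by linarith
    then have "1 + d n 1 * z n \<noteq> 0" by (auto simp: add_eq_0_iff)
    then have "a n * (1 + d n 1 * z n) = z n + d n 1" by (simp add: a)
    then have "a n - d n 1 = z n * (1 - d n 1 * a n)" by (simp add: algebra_simps)
    then have "pull (d n 1) (a n) (z n) 1 = 1"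
      using nz z0 by (simp add: pull_def)
    then show ?case by (simp add: Es_Suc Suc.IH)
  qed (simp add: Es_def)
  have diff: "cmod (Es (Suc k) n r - Es k n r) \<le> (9 / 10) ^ k" if "r \<in> {0..1}" for k n r
    using that
  proof (induction k arbitrary: n r)
    case 0
    then show ?case using ball[of r 1 n] by (simp add: Es_def)
  next
    case (Suc k)
    have "cmod (Es (Suc (Suc k)) n r - Es (Suc k) n r) \<le> 9 / 10 * cmod (Es (Suc k) (Suc n) (r\<^sup>2) - Es k (Suc n) (r\<^sup>2))"
      unfolding Es_Suc[of "Suc k"] Es_Suc[of k n r]
      by (rule pull_bounds.pull_contract[OF pb[OF Suc.prems] ball ball]) (use sq Suc.prems in blast)+
    then show ?case using Suc.IH[OF sq[OF Suc.prems], of "Suc n"] by simp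
  qed
  define E where "E = (\<lambda>n r. 1 + suminf (\<lambda>k. Es (Suc k) n r - Es k n r))"
  have "uniform_limit {0..1} (\<lambda>m r. \<Sum>k<m. Es (Suc k) n r - Es k n r) (\<lambda>r. suminf (\<lambda>k. Es (Suc k) n r - Es k n r)) sequentially" for n
    by (rule Weierstrass_m_test[where M="\<lambda>k. (9 / 10) ^ k"]) (use diff in \<open>auto intro: summable_geometric\<close>)
  from uniform_limit_add[OF uniform_limit_const this]
  have "uniform_limit {0..1} (\<lambda>m r. 1 + (\<Sum>k<m. Es (Suc k) n r - Es k n r)) (E n) sequentially" for n
    unfolding E_def .
  moreover have "1 + (\<Sum>k<m. Es (Suc k) n r - Es k n r) = Es m n r" for m n r
    by (simp add: sum_lessThan_telescope[of "\<lambda>k. Es k n r"]) (simp add: Es_def)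
  ultimately have lim: "uniform_limit {0..1} (\<lambda>m. Es m n) (E n) sequentially" for n by simp
  have pt: "(\<lambda>m. Es m n r) \<longlonglongrightarrow> E n r" if "r \<in> {0..1}" for n r
    using tendsto_uniform_limitI[OF lim that] .
  have E_cont: "continuous_on {0..1} (E n)" for n
    by (rule uniform_limit_theorem[OF _ lim]) (use cont in auto)
  have E_one: "E n 1 = 1" for n
    using pt[of 1 n] one by (simp add: LIMSEQ_const_iff)
  have E_ball: "cmod (E n r - 1) \<le> 1 / 2" if "r \<in> {0..1}" for n r
  proof (rule LIMSEQ_le_const2)
    show "(\<lambda>m. cmod (Es m n r - 1)) \<longlonglongrightarrow> cmod (E n r - 1)" using pt[OF that] by (intro tendsto_intros)
  qed (use ball[OF that] in auto)
  have "E n r = pull (d n r) (a n) (z n) (E (Suc n) (r\<^sup>2))" if r: "r \<in> {0..1}" for n r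
  proof -
    have "(\<lambda>m. Es (Suc m) n r) \<longlonglongrightarrow> pull (d n r) (a n) (z n) (E (Suc n) (r\<^sup>2))"
    proof (rule LIM_zero_cancel, rule Lim_null_comparison)
      show "\<forall>\<^sub>F m in sequentially. norm (Es (Suc m) n r - pull (d n r) (a n) (z n) (E (Suc n) (r\<^sup>2)))
          \<le> 9 / 10 * cmod (Es m (Suc n) (r\<^sup>2) - E (Suc n) (r\<^sup>2))"
        unfolding Es_Suc using pull_bounds.pull_contract[OF pb[OF r] ball[OF sq[OF r]] E_ball[OF sq[OF r]]] by simp
      have "(\<lambda>m. Es m (Suc n) (r\<^sup>2) - E (Suc n) (r\<^sup>2)) \<longlonglongrightarrow> 0"
        using LIM_zero[OF pt[OF sq[OF r]]] .
      then show "(\<lambda>m. 9 / 10 * cmod (Es m (Suc n) (r\<^sup>2) - E (Suc n) (r\<^sup>2))) \<longlonglongrightarrow> 0"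
        by (intro tendsto_mult_right_zero tendsto_norm_zero)
    qed
    moreover have "(\<lambda>m. Es (Suc m) n r) \<longlonglongrightarrow> E n r" using pt[OF r] by (rule LIMSEQ_Suc)
    ultimately show ?thesis by (rule LIMSEQ_unique[rotated])
  qed
  then show ?thesis using E_cont E_one E_ball by (intro exI[of _ E]) blast
qed

context newton_parabola
begin

text \<open>\<open>F\<close> squares two linear forms in p and q, so lifting amounts to a square
  root of each coordinate path and the inversion of a linear system. This works through critical
  values, where one root vanishes. The lift of the base path is prescribed, since w = 0 is a branch
  point of its own.\<close>

lemma F_path_lift:
  fixes g :: "real \<Rightarrow> complex \<times> complex \<times> complex"
  assumes g: "continuous_on {0..1} g" "\<And>t. t \<in> {0..1} \<Longrightarrow> g t \<in> hcoords"
    and w: "continuous_on {0..1} w" "\<And>t. t \<in> {0..1} \<Longrightarrow> (w t)\<^sup>2 = fst (g t)"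
    and x: "F x = g 0" "fst x = w 0"
  shows "\<exists>h. continuous_on {0..1} h \<and> h 0 = x \<and>
    (\<forall>t\<in>{0..1}. fst (h t) = w t \<and> F (h t) = g t \<and> h t \<in> hcoords)"
proof -
  obtain p0 q0 where x': "x = (w 0, p0, q0)" using x(2) by (cases x) auto
  have cfst: "continuous_on {0..1} (\<lambda>t. fst (snd (g t)))" "continuous_on {0..1} (\<lambda>t. snd (snd (g t)))"
    using g(1) by (auto intro!: continuous_intros)
  have g0: "g 0 = ((w 0)\<^sup>2, (diag_coeff (w 0) * p0 + off_coeff (w 0) * q0)\<^sup>2, (off_coeff (w 0) * p0 + diag_coeff (w 0) * q0)\<^sup>2)"
    using x(1) by (simp add: x')
  obtain P where P: "continuous_on {0..1} P" "P 0 = diag_coeff (w 0) * p0 + off_coeff (w 0) * q0"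
    "\<And>t. t \<in> {0..1} \<Longrightarrow> (P t)\<^sup>2 = fst (snd (g t))"
    using path_square_root[OF cfst(1), of "diag_coeff (w 0) * p0 + off_coeff (w 0) * q0"] g0 by auto
  obtain Q where Q: "continuous_on {0..1} Q" "Q 0 = off_coeff (w 0) * p0 + diag_coeff (w 0) * q0"
    "\<And>t. t \<in> {0..1} \<Longrightarrow> (Q t)\<^sup>2 = snd (snd (g t))"
    using path_square_root[OF cfst(2), of "off_coeff (w 0) * p0 + diag_coeff (w 0) * q0"] g0 by auto
  have wl: "cmod (w t) < 1" if "t \<in> {0..1}" for t
  proof -
    have "cmod ((w t)\<^sup>2) < 1" using w(2)[OF that] g(2)[OF that] by (auto simp: hcoords_def)
    then show ?thesis by (simp add: norm_power power_less_one_iff)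
  qed
  define D where "D = (\<lambda>t. (diag_coeff (w t))\<^sup>2 - (off_coeff (w t))\<^sup>2)"
  have D: "D t \<noteq> 0" if "t \<in> {0..1}" for t
    using coeff_det_nonzero[OF wl[OF that]] by (simp add: D_def)
  have ca: "continuous_on {0..1} (\<lambda>t. diag_coeff (w t))" "continuous_on {0..1} (\<lambda>t. off_coeff (w t))"
    by (rule continuous_on_compose2[OF continuous_on_diag_coeff w(1)], use wl in auto)
       (rule continuous_on_compose2[OF continuous_on_off_coeff w(1)], use wl in auto)
  define h where "h = (\<lambda>t. (w t, (diag_coeff (w t) * P t - off_coeff (w t) * Q t) / D t, (diag_coeff (w t) * Q t - off_coeff (w t) * P t) / D t))"
  have "continuous_on {0..1} D" unfolding D_def using ca by (intro continuous_intros)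
  then have h: "continuous_on {0..1} h"
    unfolding h_def using D by (intro continuous_intros w(1) ca P(1) Q(1)) auto
  have Fh: "F (h t) = g t" if t: "t \<in> {0..1}" for t
  proof -
    have inv: "diag_coeff (w t) * ((diag_coeff (w t) * u - off_coeff (w t) * v) / D t) + off_coeff (w t) * ((diag_coeff (w t) * v - off_coeff (w t) * u) / D t) = u" for u v
    proof -
      have "diag_coeff (w t) * ((diag_coeff (w t) * u - off_coeff (w t) * v) / D t) + off_coeff (w t) * ((diag_coeff (w t) * v - off_coeff (w t) * u) / D t)
        = (diag_coeff (w t) * (diag_coeff (w t) * u - off_coeff (w t) * v) + off_coeff (w t) * (diag_coeff (w t) * v - off_coeff (w t) * u)) / D t"
        by (simp add: add_divide_distrib)
      also have "diag_coeff (w t) * (diag_coeff (w t) * u - off_coeff (w t) * v) + off_coeff (w t) * (diag_coeff (w t) * v - off_coeff (w t) * u) = D t * u"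
        by (simp add: D_def power2_eq_square algebra_simps)
      finally show ?thesis using D[OF t] by simp
    qed
    have "F (h t) = ((w t)\<^sup>2, (P t)\<^sup>2, (Q t)\<^sup>2)"
      unfolding h_def F.simps using inv[of "P t" "Q t"] inv[of "Q t" "P t"] by (simp add: add.commute)
    then show ?thesis using P(3)[OF t] Q(3)[OF t] w(2)[OF t] by (cases "g t") simp
  qed
  have "h 0 = x"
  proof -
    have "diag_coeff (w 0) * P 0 - off_coeff (w 0) * Q 0 = D 0 * p0" "diag_coeff (w 0) * Q 0 - off_coeff (w 0) * P 0 = D 0 * q0"
      unfolding P(2) Q(2) D_def by (simp_all add: power2_eq_square algebra_simps)
    then show ?thesis using D[of 0] by (simp add: h_def x')
  qed
  moreover have "h t \<in> hcoords" if t: "t \<in> {0..1}" for t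
  proof (rule ccontr)
    assume "h t \<notin> hcoords"
    then have "fst (snd (h t)) = 0 \<and> snd (snd (h t)) = 0" using wl[OF t] by (auto simp: hcoords_def h_def)
    then have "F (h t) = (fst (h t) ^ 2, 0, 0)" by (cases "h t") simp
    then show False using Fh[OF t] g(2)[OF t] by (auto simp: hcoords_def)
  qed
  ultimately show ?thesis using h Fh by (intro exI[of _ h]) (auto simp: h_def)
qed

text \<open>\<open>pull_orbit\<close>, for the orbit of \<open>x\<close>, yields a path over the
  segment from \<open>fst x\<close> to 0 whose orbits stay within a bounded factor of that of
  \<open>x\<close>; \<open>W_1_if_bounded\<close> then applies.\<close>

lemma path_to_core_small:
  assumes x: "x \<in> W_lift" "cmod (fst x) \<le> core_radius"
  shows "\<exists>g. continuous_on {0..1::real} g \<and> g 0 = x \<and>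
    (\<forall>t\<in>{0..1}. g t \<in> W_lift \<and> fst (g t) = of_real (1 - t) * fst x)"
proof -
  define w p q where "w = (\<lambda>n. fst ((F ^^ n) x))" and "p = (\<lambda>n. fst (snd ((F ^^ n) x)))"
    and "q = (\<lambda>n. snd (snd ((F ^^ n) x)))"
  have Fn: "(F ^^ n) x = (w n, p n, q n)" for n by (simp add: w_def p_def q_def)
  have w_le: "cmod (w n) \<le> core_radius" for n
    unfolding w_def funpow_F_fst norm_power
    using power_2_power_le[of "cmod (fst x)" n] x(2) core_radius(2) by (meson norm_ge_zero less_imp_le order_trans)
  have w_Suc: "w (Suc n) = (w n)\<^sup>2" for n
    using Fn[of "Suc n"] by (simp add: Fn)
  have rw: "cmod (of_real r * w n) \<le> core_radius" if "r \<in> {0..1}" for r n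
    using w_le[of n] that by (simp add: norm_mult) (meson mult_left_le_one_le norm_ge_zero order_trans)
  have bal: "balanced 2 (w n, p n, q n)" for n
    using W_lift_balanced[OF funpow_F_W_lift[OF x(1), of n]] w_le[of n] unfolding Fn by simp
  have pq: "p n \<noteq> 0" "q n \<noteq> 0" for n
    using bal[of n] by (auto simp: balanced_def)
  define z where "z = (\<lambda>n. p n / q n)"
  have z: "1 / 2 < cmod (z n)" "cmod (z n) < 2" for n
    using bal[of n] pq[of n] by (auto simp: balanced_def z_def norm_divide field_simps)
  define d where "d = (\<lambda>n r. off_coeff (of_real r * w n) / diag_coeff (of_real r * w n))"
  define a where "a = (\<lambda>n. (z n + d n 1) / (1 + d n 1 * z n))"
  have al0: "diag_coeff (of_real r * w n) \<noteq> 0" if "r \<in> {0..1}" for r n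
    using core_radius(3)[OF rw[OF that]] .
  have d: "cmod (d n r) \<le> 1 / 100" if "r \<in> {0..1}" for n r
    using core_radius(4)[OF rw[OF that], of n] al0[OF that, of n] by (simp add: d_def norm_divide field_simps)
  have d_cont: "continuous_on {0..1} (d n)" for n
  proof -
    have i: "continuous_on {0..1} (\<lambda>r. complex_of_real r * w n)" by (intro continuous_intros)
    have sub: "(\<lambda>r. complex_of_real r * w n) ` {0..1} \<subseteq> ball 0 1"
      by (rule image_subsetI, simp only: mem_ball_0, rule le_less_trans[OF rw core_radius(2)])
    show ?thesis
      unfolding d_def using al0
      by (intro continuous_on_divide continuous_on_compose2[OF continuous_on_off_coeff i sub]
          continuous_on_compose2[OF continuous_on_diag_coeff i sub]) auto
  qed
  have "\<exists>E. \<forall>n. continuous_on {0..1} (E n) \<and> E n 1 = 1 \<and>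
    (\<forall>r\<in>{0..1}. cmod (E n r - 1) \<le> 1 / 2 \<and> E n r = pull (d n r) (a n) (z n) (E (Suc n) (r\<^sup>2)))"
    by (rule pull_orbit[OF d d_cont z]) (simp_all add: a_def)
  then obtain E where E0: "\<forall>n. continuous_on {0..1} (E n) \<and> E n 1 = 1 \<and>
    (\<forall>r\<in>{0..1}. cmod (E n r - 1) \<le> 1 / 2 \<and> E n r = pull (d n r) (a n) (z n) (E (Suc n) (r\<^sup>2)))"
    by (elim exE)
  have E: "\<And>n. continuous_on {0..1} (E n)" "\<And>n. E n 1 = 1"
    "\<And>n r. r \<in> {0..1} \<Longrightarrow> cmod (E n r - 1) \<le> 1 / 2"
    "\<And>n r. r \<in> {0..1} \<Longrightarrow> E n r = pull (d n r) (a n) (z n) (E (Suc n) (r\<^sup>2))"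
    using E0 by blast+
  \<comment> \<open>The point of the n-th leaf over \<open>r * w n\<close>, in the chart q = 1. By
    \<open>step\<close>, \<open>F\<close> carries it, up to scaling, to the point of the next leaf
    over \<open>r\<^sup>2 * w (Suc n)\<close>.\<close>
  define G where "G = (\<lambda>n r. (of_real r * w n, z n * E n r, 1::complex))"
  have sq: "r\<^sup>2 \<in> {0..1}" if "r \<in> {0..1}" for r :: real
    using that by (auto simp: power_le_one)
  have z0: "z n \<noteq> 0" for n using z(1)[of n] by auto
  have step: "\<exists>c. c \<noteq> 0 \<and> F (G n r) = scale c (G (Suc n) (r\<^sup>2))" if r: "r \<in> {0..1}" for n r
  proof -
    interpret pb: pull_bounds "d n r" "d n 1" "a n" "z n"
      by unfold_locales (use d r z in \<open>auto simp: a_def\<close>)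
    define s where "s = a n * csqrt (E (Suc n) (r\<^sup>2))"
    have den: "1 - d n r * s \<noteq> 0"
      using pb.den_bound(2)[OF E(3)[OF sq[OF r], of "Suc n"]] by (auto simp: s_def)
    have zE: "z n * E n r * (1 - d n r * s) = s - d n r"
      using E(4)[OF r, of n] den z0[of n] by (simp add: pull_def s_def)
    define A where "A = diag_coeff (of_real r * w n)"
    have A: "A \<noteq> 0" and off_coeff: "off_coeff (of_real r * w n) = A * d n r"
      using al0[OF r, of n] by (simp_all add: A_def d_def)
    define m where "m = A * (1 + d n r * (z n * E n r))"
    have m: "(1 + d n r * (z n * E n r)) * (1 - d n r * s) = 1 - (d n r)\<^sup>2"
    proof -
      have "(1 + d n r * (z n * E n r)) * (1 - d n r * s) = (1 - d n r * s) + d n r * (z n * E n r * (1 - d n r * s))"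
        by (simp add: algebra_simps)
      then show ?thesis unfolding zE by (simp add: algebra_simps power2_eq_square)
    qed
    have "cmod ((d n r)\<^sup>2) < 1"
      using d[OF r, of n] power_strict_mono[of "cmod (d n r)" 1 2] by (simp add: norm_power)
    then have m0: "m \<noteq> 0" using m A by (auto simp: m_def)
    have num: "A * (z n * E n r + d n r) = m * s"
    proof -
      have "(z n * E n r + d n r) * (1 - d n r * s) = (z n * E n r * (1 - d n r * s)) + d n r * (1 - d n r * s)"
        by (simp add: algebra_simps)
      also have "\<dots> = s * (1 - (d n r)\<^sup>2)" unfolding zE by (simp add: algebra_simps power2_eq_square)
      also have "\<dots> = s * (1 + d n r * (z n * E n r)) * (1 - d n r * s)" unfolding m[symmetric] by simp
      finally have "z n * E n r + d n r = s * (1 + d n r * (z n * E n r))" using den by simp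
      then show ?thesis by (simp add: m_def)
    qed
    have a2: "(a n)\<^sup>2 = z (Suc n)"
    proof -
      have A1: "diag_coeff (w n) \<noteq> 0" using al0[of 1 n] by simp
      have "a n = (diag_coeff (w n) * p n + off_coeff (w n) * q n) / (off_coeff (w n) * p n + diag_coeff (w n) * q n)"
      proof -
        have "a n = (diag_coeff (w n) * (q n * (z n + d n 1))) / (diag_coeff (w n) * (q n * (1 + d n 1 * z n)))"
          unfolding a_def using A1 pq(2)[of n] by simp
        also have "diag_coeff (w n) * (q n * (z n + d n 1)) = diag_coeff (w n) * p n + off_coeff (w n) * q n"
          using A1 pq(2)[of n] by (simp add: z_def d_def field_simps)
        also have "diag_coeff (w n) * (q n * (1 + d n 1 * z n)) = off_coeff (w n) * p n + diag_coeff (w n) * q n"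
          using A1 pq(2)[of n] by (simp add: z_def d_def field_simps)
        finally show ?thesis .
      qed
      then show ?thesis using Fn[of "Suc n"] by (simp add: Fn z_def power_divide)
    qed
    have "F (G n r) = ((of_real r * w n)\<^sup>2, (A * (z n * E n r + d n r))\<^sup>2, m\<^sup>2)"
      by (simp add: G_def off_coeff m_def A_def[symmetric] algebra_simps)
    also have "\<dots> = ((of_real r * w n)\<^sup>2, m\<^sup>2 * (z (Suc n) * E (Suc n) (r\<^sup>2)), m\<^sup>2 * 1)"
      unfolding num by (simp add: s_def power_mult_distrib a2)
    also have "\<dots> = scale (m\<^sup>2) (G (Suc n) (r\<^sup>2))"
      by (simp add: scale_def G_def w_Suc power_mult_distrib)
    finally show ?thesis using m0 by (intro exI[of _ "m\<^sup>2"]) simp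
  qed
  have GW: "G 0 r \<in> W_lift" if r: "r \<in> {0..1}" for r
  proof -
    have pow: "r ^ 2 ^ n \<in> {0..1}" for n using r by (auto simp: power_le_one)
    have orbit: "\<exists>c. c \<noteq> 0 \<and> (F ^^ n) (G 0 r) = scale c (G n (r ^ 2 ^ n))" for n
    proof (induction n)
      case 0
      show ?case by (intro exI[of _ 1]) (simp add: scale_def)
    next
      case (Suc n)
      then obtain c where c: "c \<noteq> 0" "(F ^^ n) (G 0 r) = scale c (G n (r ^ 2 ^ n))" by blast
      obtain c' where c': "c' \<noteq> 0" "F (G n (r ^ 2 ^ n)) = scale c' (G (Suc n) ((r ^ 2 ^ n)\<^sup>2))"
        using step[OF pow] by blast
      have "(F ^^ Suc n) (G 0 r) = scale (c\<^sup>2 * c') (G (Suc n) (r ^ 2 ^ Suc n))"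
        using c c' by (simp add: F_scale scale_scale power_mult[symmetric] mult.commute)
      then show ?case using c c' by (intro exI[of _ "c\<^sup>2 * c'"]) simp
    qed
    have gdom: "G 0 r \<in> hcoords"
      using rw[OF r, of 0] core_radius(2) by (simp add: G_def hcoords_def)
    \<comment> \<open>The modulus of \<open>z n\<close> lies in (1/2, 2) and that of
      \<open>E\<close> in [1/2, 3/2], so their product lies in (1/4, 3).\<close>
    have "balanced 4 ((F ^^ n) (G 0 r))" for n
    proof -
      obtain c where c: "c \<noteq> 0" "(F ^^ n) (G 0 r) = scale c (G n (r ^ 2 ^ n))" using orbit by blast
      have e: "cmod (E n (r ^ 2 ^ n) - 1) \<le> 1 / 2" using E(3)[OF pow] .
      then have lo: "1 / 2 \<le> cmod (E n (r ^ 2 ^ n))" and hi: "cmod (E n (r ^ 2 ^ n)) \<le> 3 / 2"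
        using norm_triangle_ineq2[of 1 "1 - E n (r ^ 2 ^ n)"] norm_triangle_ineq[of "E n (r ^ 2 ^ n) - 1" 1]
        by (simp_all add: norm_minus_commute)
      have "cmod (z n) * cmod (E n (r ^ 2 ^ n)) \<le> 2 * (3 / 2)"
        using z(2)[of n] hi by (intro mult_mono) auto
      moreover have "1 / 2 * (1 / 2) < cmod (z n) * cmod (E n (r ^ 2 ^ n))"
        using z(1)[of n] lo by (intro mult_less_le_imp_less) auto
      ultimately have "balanced 4 (G n (r ^ 2 ^ n))"
        by (simp add: balanced_def G_def norm_mult)
      then show ?thesis using c balanced_scale by simp
    qed
    then have "proj (G 0 r) \<in> W_1 B" using W_1_if_bounded[OF gdom, of 0 4] by simp
    then show ?thesis using gdom by (simp add: W_lift_def)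
  qed
  define g where "g = (\<lambda>t. scale (q 0) (G 0 (1 - t)))"
  have "continuous_on {0..1} (\<lambda>t. E 0 (1 - t))"
    by (rule continuous_on_compose2[OF E(1)]) (auto intro!: continuous_intros)
  then have "continuous_on {0..1} g"
    unfolding g_def scale_def G_def by (auto intro!: continuous_intros)
  moreover have "g 0 = x"
    using Fn[of 0] E(2) pq(2)[of 0] by (simp add: g_def scale_def G_def z_def)
  moreover have "g t \<in> W_lift" if "t \<in> {0..1}" for t
    unfolding g_def using that pq by (intro scale_W_lift GW) auto
  moreover have "fst (g t) = of_real (1 - t) * fst x" for t
    by (simp add: g_def scale_def G_def w_def)
  ultimately show ?thesis by blast
qed

text \<open>Over the core this is \<open>path_to_core_small\<close>; elsewhere the path for
  \<open>F x\<close> is lifted, by induction on the number of steps that bring the base coordinate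
  into the core. Taking the square root of \<open>\<rho>\<close> lifts the radial motion along the
  ray through \<open>fst x\<close>.\<close>

lemma path_to_core:
  assumes "x \<in> W_lift"
  shows "\<exists>g \<rho>. continuous_on {0..1::real} g \<and> g 0 = x \<and> continuous_on {0..1} \<rho> \<and> \<rho> 0 = 1 \<and> \<rho> 1 = 0 \<and>
    (\<forall>t\<in>{0..1}. g t \<in> W_lift \<and> \<rho> t \<in> {0..1::real} \<and> fst (g t) = of_real (\<rho> t) * fst x)"
proof -
  have main: "\<exists>g \<rho>. continuous_on {0..1::real} g \<and> g 0 = x \<and> continuous_on {0..1} \<rho> \<and> \<rho> 0 = 1 \<and> \<rho> 1 = 0 \<and>
    (\<forall>t\<in>{0..1}. g t \<in> W_lift \<and> \<rho> t \<in> {0..1::real} \<and> fst (g t) = of_real (\<rho> t) * fst x)"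
    if "x \<in> W_lift" "cmod (fst x) ^ 2 ^ n \<le> core_radius" for x n
    using that
  proof (induction n arbitrary: x)
    case 0
    then obtain g where "continuous_on {0..1::real} g \<and> g 0 = x \<and>
      (\<forall>t\<in>{0..1}. g t \<in> W_lift \<and> fst (g t) = of_real (1 - t) * fst x)"
      using path_to_core_small[of x] by auto
    then show ?case
      by (intro exI[of _ g] exI[of _ "\<lambda>t. 1 - t"]) (auto intro!: continuous_intros)
  next
    case (Suc n)
    have xd: "x \<in> hcoords" using Suc.prems W_lift_hcoords by blast
    have fx: "fst (F x) = (fst x)\<^sup>2" by (cases x) simp
    have "F x \<in> W_lift" using Suc.prems F_W_lift_iff[OF xd] by blast
    moreover have "cmod (fst (F x)) ^ 2 ^ n \<le> core_radius"
      using Suc.prems(2) by (simp add: fx norm_power power_mult[symmetric] mult.commute)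
    ultimately have "\<exists>g \<rho>. continuous_on {0..1::real} g \<and> g 0 = F x \<and> continuous_on {0..1} \<rho> \<and> \<rho> 0 = 1 \<and> \<rho> 1 = 0 \<and>
      (\<forall>t\<in>{0..1}. g t \<in> W_lift \<and> \<rho> t \<in> {0..1::real} \<and> fst (g t) = of_real (\<rho> t) * fst (F x))"
      by (rule Suc.IH)
    then obtain g \<rho> where gr: "continuous_on {0..1::real} g \<and> g 0 = F x \<and> continuous_on {0..1} \<rho> \<and> \<rho> 0 = 1 \<and> \<rho> 1 = 0 \<and>
      (\<forall>t\<in>{0..1}. g t \<in> W_lift \<and> \<rho> t \<in> {0..1::real} \<and> fst (g t) = of_real (\<rho> t) * fst (F x))"
      by (elim exE)
    then have g: "continuous_on {0..1} g" "g 0 = F x"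
      and \<rho>: "continuous_on {0..1} \<rho>" "\<rho> 0 = 1" "\<rho> 1 = 0"
      and gt: "\<And>t. t \<in> {0..1} \<Longrightarrow> g t \<in> W_lift" "\<And>t. t \<in> {0..1} \<Longrightarrow> \<rho> t \<in> {0..1::real}"
        "\<And>t. t \<in> {0..1} \<Longrightarrow> fst (g t) = of_real (\<rho> t) * fst (F x)"
      by simp_all
    define w where "w = (\<lambda>t. of_real (sqrt (\<rho> t)) * fst x)"
    have "continuous_on {0..1} w" unfolding w_def using \<rho>(1) by (intro continuous_intros)
    moreover have "(w t)\<^sup>2 = fst (g t)" if "t \<in> {0..1}" for t
      using gt(2,3)[OF that] by (simp add: w_def fx power_mult_distrib flip: of_real_power)
    moreover have "fst x = w 0" by (simp add: w_def \<rho>)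
    ultimately obtain h where h: "continuous_on {0..1} h" "h 0 = x"
      "\<And>t. t \<in> {0..1} \<Longrightarrow> fst (h t) = w t \<and> F (h t) = g t \<and> h t \<in> hcoords"
      using F_path_lift[OF g(1) W_lift_hcoords[OF gt(1)], of w x] g(2) by auto
    have "h t \<in> W_lift" if "t \<in> {0..1}" for t
      using h(3)[OF that] gt(1)[OF that] F_W_lift_iff by metis
    moreover have "continuous_on {0..1} (\<lambda>t. sqrt (\<rho> t))" using \<rho>(1) by (intro continuous_intros)
    ultimately show ?case
      using h gt(2) \<rho>(2,3) by (intro exI[of _ h] exI[of _ "\<lambda>t. sqrt (\<rho> t)"]) (auto simp: w_def)
  qed
  have "(\<lambda>n. cmod (fst ((F ^^ n) x))) \<longlonglongrightarrow> 0"
    using fst_tendsto_0[OF W_lift_hcoords[OF assms]] by (rule tendsto_norm_zero)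
  then have "\<forall>\<^sub>F n in sequentially. cmod (fst ((F ^^ n) x)) < core_radius"
    using core_radius(1) by (rule order_tendstoD(2))
  then obtain n where "cmod (fst ((F ^^ n) x)) < core_radius" by (auto simp: eventually_sequentially)
  then show ?thesis using main[OF assms, of n] by (simp add: funpow_F_fst norm_power)
qed

end

section \<open>The winding invariant on the stable set\<close>

lemma continuous_map_the: "continuous_map (subtopology P1 (range Some)) euclidean the"
  unfolding continuous_map_def
proof (intro conjI allI impI)
  fix U :: "complex set" assume "openin euclidean U"
  then have "openin P1 (Some ` U)" by (simp add: P1_def)
  moreover have "{x \<in> topspace (subtopology P1 (range Some)). the x \<in> U} = Some ` U \<inter> range Some"
    by (auto simp: P1_def)
  ultimately show "openin (subtopology P1 (range Some)) {x \<in> topspace (subtopology P1 (range Some)). the x \<in> U}"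
    by (auto simp: openin_subtopology)
qed auto

context newton_parabola
begin

section \<open>The z-coordinate of the iterates and its descent to \<open>W_1\<close>\<close>

definition Z :: "nat \<Rightarrow> complex \<times> complex \<times> complex \<Rightarrow> complex" where
  "Z n x = fst (snd ((F ^^ n) x)) / snd (snd ((F ^^ n) x))"

lemma Z_scale: "c \<noteq> 0 \<Longrightarrow> Z n (scale c x) = Z n x"
  unfolding Z_def funpow_F_scale by (simp add: scale_def)

lemma Z_Suc: "Z (Suc n) x = Z n (F x)"
  by (simp add: Z_def funpow_swap1)

definition Z_down :: "nat \<Rightarrow> complex option \<times> complex option \<Rightarrow> complex" where
  "Z_down n y = Z n (SOME x. x \<in> hcoords \<and> proj x = y)"

lemma Z_down_proj: "x \<in> hcoords \<Longrightarrow> Z_down n (proj x) = Z n x"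
proof -
  assume x: "x \<in> hcoords"
  define x' where "x' = (SOME x'. x' \<in> hcoords \<and> proj x' = proj x)"
  have "x' \<in> hcoords \<and> proj x' = proj x"
    unfolding x'_def by (rule someI[of _ x]) (use x in simp)
  then obtain c where "c \<noteq> 0" "x = scale c x'"
    using proj_eq_scale[of x' x] x by auto
  then have "Z n x = Z n x'" by (simp add: Z_scale)
  moreover have "Z_down n (proj x) = Z n x'" by (simp add: Z_down_def x'_def)
  ultimately show ?thesis by simp
qed

lemma Z_bounds:
  assumes "x \<in> W_lift" "cmod (fst x) ^ 2 ^ n \<le> core_radius"
  shows "snd (snd ((F ^^ n) x)) \<noteq> 0" "1 / 2 < cmod (Z n x)" "cmod (Z n x) < 2" "Z n x \<noteq> 0"
proof -
  have "cmod (fst ((F ^^ n) x)) \<le> core_radius" using assms(2) by (simp add: funpow_F_fst norm_power)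
  from W_lift_balanced[OF funpow_F_W_lift[OF assms(1)] this]
  have b: "cmod (fst (snd ((F ^^ n) x))) < 2 * cmod (snd (snd ((F ^^ n) x)))"
    "cmod (snd (snd ((F ^^ n) x))) < 2 * cmod (fst (snd ((F ^^ n) x)))"
    by (simp_all add: balanced_def)
  then show q: "snd (snd ((F ^^ n) x)) \<noteq> 0" by auto
  show "1 / 2 < cmod (Z n x)" "cmod (Z n x) < 2"
    using b q by (simp_all add: Z_def norm_divide field_simps)
  then show "Z n x \<noteq> 0" by auto
qed

text \<open>The quotient is the square of \<open>m / Z n x\<close>, where \<open>m\<close> is the
  image before squaring; \<open>a_over_z\<close> places \<open>m / Z n x\<close> within 42 / 1000 of
  1.\<close>

lemma Z_doubling:
  assumes "x \<in> W_lift" "cmod (fst x) ^ 2 ^ n \<le> core_radius"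
  shows "Re (Z (Suc n) x / (Z n x)\<^sup>2) > 0"
proof -
  obtain w p q where Fn: "(F ^^ n) x = (w, p, q)" by (cases "(F ^^ n) x")
  have z: "Z n x = p / q" by (simp add: Z_def Fn)
  have q: "q \<noteq> 0" using Z_bounds(1)[OF assms] by (simp add: Fn)
  have w: "cmod w \<le> core_radius" using assms(2) funpow_F_fst[of n x] by (simp add: Fn norm_power)
  have diag_coeff: "diag_coeff w \<noteq> 0" using core_radius(3)[OF w] .
  define \<delta> where "\<delta> = off_coeff w / diag_coeff w"
  have \<delta>: "cmod \<delta> \<le> 1 / 100" using core_radius(4)[OF w] diag_coeff by (simp add: \<delta>_def norm_divide field_simps)
  define m where "m = (Z n x + \<delta>) / (1 + \<delta> * Z n x)"
  interpret pb: pull_bounds \<delta> \<delta> m "Z n x"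
    by unfold_locales (use \<delta> Z_bounds[OF assms] in \<open>auto simp: m_def\<close>)
  have "m = (diag_coeff w * (q * (p / q + \<delta>))) / (diag_coeff w * (q * (1 + \<delta> * (p / q))))"
    unfolding m_def z using diag_coeff q by simp
  also have "diag_coeff w * (q * (p / q + \<delta>)) = diag_coeff w * p + off_coeff w * q"
    using diag_coeff q by (simp add: \<delta>_def field_simps)
  also have "diag_coeff w * (q * (1 + \<delta> * (p / q))) = off_coeff w * p + diag_coeff w * q"
    using diag_coeff q by (simp add: \<delta>_def field_simps)
  finally have "Z (Suc n) x = m\<^sup>2" by (simp add: Z_def Fn power_divide)
  then have e: "Z (Suc n) x / (Z n x)\<^sup>2 = (m / Z n x)\<^sup>2" by (simp add: power_divide)
  define h where "h = m / Z n x"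
  have h: "cmod (h - 1) \<le> 42 / 1000" using pb.a_over_z(1) by (simp add: h_def)
  have "h\<^sup>2 - 1 = (h - 1) * ((h - 1) + 2)" by (simp add: power2_eq_square algebra_simps)
  then have "cmod (h\<^sup>2 - 1) \<le> 42 / 1000 * (42 / 1000 + 2)"
    unfolding norm_mult using h norm_triangle_ineq[of "h - 1" 2]
    by (simp only: norm_mult) (intro mult_mono, auto)
  then have "Re (h\<^sup>2) > 0"
    using abs_Re_le_cmod[of "h\<^sup>2 - 1"] by auto
  then show ?thesis by (simp add: e h_def)
qed

lemma continuous_on_F: "continuous_on hcoords F"
proof -
  have i: "continuous_on hcoords fst" by (intro continuous_intros)
  have sub: "fst ` hcoords \<subseteq> ball 0 1" by (auto simp: hcoords_def)
  have c: "continuous_on hcoords (\<lambda>x. diag_coeff (fst x))" "continuous_on hcoords (\<lambda>x. off_coeff (fst x))"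
    by (rule continuous_on_compose2[OF continuous_on_diag_coeff i sub])
       (rule continuous_on_compose2[OF continuous_on_off_coeff i sub])
  have "F = (\<lambda>x. ((fst x)\<^sup>2, (diag_coeff (fst x) * fst (snd x) + off_coeff (fst x) * snd (snd x))\<^sup>2,
      (off_coeff (fst x) * fst (snd x) + diag_coeff (fst x) * snd (snd x))\<^sup>2))"
    by (auto simp: fun_eq_iff)
  then show ?thesis using c by (simp only:) (intro continuous_intros)
qed

lemma continuous_on_funpow_F: "continuous_on hcoords (F ^^ n)"
proof (induction n)
  case (Suc n)
  have "continuous_on hcoords (\<lambda>x. F ((F ^^ n) x))"
    by (rule continuous_on_compose2[OF continuous_on_F Suc]) (use funpow_F_in_hcoords in blast)
  then show ?case by (simp add: o_def)
qed (simp add: id_def)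

lemma continuous_on_Z: "continuous_on {x \<in> W_lift. cmod (fst x) ^ 2 ^ n \<le> core_radius} (Z n)"
proof -
  have "continuous_on {x \<in> W_lift. cmod (fst x) ^ 2 ^ n \<le> core_radius} (F ^^ n)"
    by (rule continuous_on_subset[OF continuous_on_funpow_F]) (auto simp: W_lift_hcoords)
  then show ?thesis
    unfolding Z_def using Z_bounds(1) by (intro continuous_intros) auto
qed

definition base_coord :: "complex option \<times> complex option \<Rightarrow> complex" where
  "base_coord y = 1 - 1 / the (fst y)"

lemma base_coord_proj: "x \<in> hcoords \<Longrightarrow> base_coord (proj x) = fst x"
proof (cases x)
  fix w p q assume x: "x \<in> hcoords" "x = (w, p, q)"
  then have "w \<noteq> 1" by (auto simp: hcoords_def)
  then show "base_coord (proj x) = fst x" by (simp add: base_coord_def x(2))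
qed

text \<open>The projection of the compact set of normalised homogeneous coordinates is a closed map, hence
  a quotient map, so continuity downstairs can be tested on homogeneous coordinates.\<close>

lemma continuous_map_Z_down:
  assumes r: "r < 1" "r ^ 2 ^ n \<le> core_radius"
  shows "continuous_map (subtopology P1xP1 {y \<in> W_1 B. cmod (base_coord y) \<le> r}) euclidean (Z_down n)"
proof -
  define Y where "Y = {y \<in> W_1 B. cmod (base_coord y) \<le> r}"
  define K where "K = {x::complex \<times> complex \<times> complex. cmod (fst x) \<le> r} \<inter>
      {x. (cmod (fst (snd x)))\<^sup>2 + (cmod (snd (snd x)))\<^sup>2 = 1}"
  define U where "U = {x \<in> K. proj x \<in> Y}"
  have nrm: "cmod p \<le> 1 \<and> cmod q \<le> 1" if "(cmod p)\<^sup>2 + (cmod q)\<^sup>2 = 1" for p q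
    using that power2_le_imp_le[of "cmod p" 1] power2_le_imp_le[of "cmod q" 1]
      zero_le_power2[of "cmod p"] zero_le_power2[of "cmod q"] by simp
  have "closed K"
    unfolding K_def by (intro closed_Int closed_Collect_le closed_Collect_eq) (auto intro!: continuous_intros)
  moreover have "K \<subseteq> cball 0 1 \<times> cball 0 1 \<times> cball 0 1"
    using nrm r(1) by (auto simp: K_def)
  then have "bounded K"
    using bounded_Times[OF bounded_cball bounded_Times[OF bounded_cball bounded_cball]] bounded_subset by blast
  ultimately have K: "compact K" by (simp add: compact_eq_bounded_closed)
  have Kd: "K \<subseteq> hcoords" using r(1) by (auto simp: K_def hcoords_def)
  have cK: "continuous_map (top_of_set K) P1xP1 proj"
    using continuous_map_from_subtopology_mono[OF continuous_map_proj Kd] .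
  have "closed_map (top_of_set K) P1xP1 proj"
    by (rule continuous_imp_closed_map[OF cK _ Hausdorff_space_P1xP1])
       (use K in \<open>simp add: compact_space_subtopology\<close>)
  then have cl: "closed_map (subtopology (top_of_set K) U) (subtopology P1xP1 Y) proj"
    by (rule closed_map_restriction) (auto simp: U_def)
  have ct: "continuous_map (subtopology (top_of_set K) U) (subtopology P1xP1 Y) proj"
    using continuous_map_from_subtopology[OF cK] by (auto simp: continuous_map_in_subtopology U_def)
  have top: "topspace P1xP1 = UNIV"
    using UNIV_option_conv[where 'a=complex] by (simp add: P1xP1_def P1_def image_def)
  have surj: "proj ` topspace (subtopology (top_of_set K) U) = topspace (subtopology P1xP1 Y)"
  proof -
    have "\<exists>x\<in>U. proj x = y" if y: "y \<in> Y" for y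
    proof -
      have "y \<in> X_r" using y by (simp add: Y_def W_1_def)
      then obtain x where x: "x \<in> hcoords" "proj x = y" by (rule proj_surj)
      define m where "m = sqrt ((cmod (fst (snd x)))\<^sup>2 + (cmod (snd (snd x)))\<^sup>2)"
      have "m > 0" using x(1) by (auto simp: m_def hcoords_def sum_power2_gt_zero_iff)
      define c where "c = complex_of_real (1 / m)"
      have c: "c \<noteq> 0" using \<open>m > 0\<close> by (simp add: c_def)
      have m2: "m\<^sup>2 = (cmod (fst (snd x)))\<^sup>2 + (cmod (snd (snd x)))\<^sup>2" by (simp add: m_def)
      have "(cmod (c * fst (snd x)))\<^sup>2 + (cmod (c * snd (snd x)))\<^sup>2 = m\<^sup>2 * (1 / m)\<^sup>2"
        unfolding m2 by (simp add: c_def norm_mult norm_divide power_mult_distrib power_divide add_divide_distrib)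
      also have "\<dots> = 1" using \<open>m > 0\<close> by (simp add: power_divide)
      finally have "scale c x \<in> K"
        using y base_coord_proj[OF x(1)] x(2) by (simp add: K_def scale_def Y_def)
      then have "scale c x \<in> U" using y x(2) proj_scale'[OF c, of x] by (simp add: U_def)
      then show ?thesis using x(2) proj_scale'[OF c, of x] by blast
    qed
    then have "Y \<subseteq> proj ` U" by blast
    moreover have "proj ` U \<subseteq> Y" unfolding U_def by blast
    moreover have "K \<inter> U = U" unfolding U_def by blast
    ultimately show ?thesis by (simp add: top subset_antisym)
  qed
  have q: "quotient_map (subtopology (top_of_set K) U) (subtopology P1xP1 Y) proj"
    by (rule continuous_closed_imp_quotient_map[OF ct cl surj])
  have UU: "U \<subseteq> {x \<in> W_lift. cmod (fst x) ^ 2 ^ n \<le> core_radius}"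
  proof
    fix x assume x: "x \<in> U"
    then have d: "x \<in> hcoords" using Kd by (auto simp: U_def)
    have "cmod (fst x) ^ 2 ^ n \<le> r ^ 2 ^ n" using x by (intro power_mono) (auto simp: U_def K_def)
    then show "x \<in> {x \<in> W_lift. cmod (fst x) ^ 2 ^ n \<le> core_radius}"
      using x d r(2) by (auto simp: U_def Y_def W_lift_def)
  qed
  have "continuous_on U (Z n)" by (rule continuous_on_subset[OF continuous_on_Z UU])
  moreover have "Z n x = (Z_down n \<circ> proj) x" if "x \<in> U" for x
    using Z_down_proj[of x n] subsetD[OF UU that] W_lift_hcoords by simp
  ultimately have "continuous_on U (Z_down n \<circ> proj)"
    by (rule continuous_on_eq)
  moreover have "subtopology (top_of_set K) U = top_of_set U"
  proof -
    have "K \<inter> U = U" unfolding U_def by blast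
    then show ?thesis by (simp add: subtopology_subtopology)
  qed
  ultimately have "continuous_map (subtopology (top_of_set K) U) euclidean (Z_down n \<circ> proj)" by simp
  from continuous_compose_quotient_map[OF q this] show ?thesis unfolding Y_def .
qed

text \<open>A simplex has compact image, so |w| has a maximum r < 1 on it. As soon as r^(2^n) is
  below \<open>core_radius\<close>, the estimates for \<open>Z\<close> hold on the whole
  simplex.\<close>

lemma simplex_eventually_tame:
  assumes \<sigma>: "singular_simplex k (subtopology P1xP1 (W_1 B)) \<sigma>"
  shows "\<forall>\<^sub>F n in sequentially. nonvanishing_on_simplex k (Z_down n) \<sigma> \<and>
    (\<forall>x\<in>standard_simplex k. Re (Z_down (Suc n) (\<sigma> x) / (Z_down n (\<sigma> x))\<^sup>2) > 0)"
proof -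
  let ?\<Delta> = "subtopology (powertop_real UNIV) (standard_simplex k)"
  have c: "continuous_map ?\<Delta> P1xP1 \<sigma>" and im: "\<And>x. x \<in> standard_simplex k \<Longrightarrow> \<sigma> x \<in> W_1 B"
    using \<sigma> by (auto simp: singular_simplex_def continuous_map_in_subtopology)
  have "continuous_map ?\<Delta> P1 (fst \<circ> \<sigma>)"
    using continuous_map_compose[OF c] continuous_map_fst unfolding P1xP1_def by blast
  moreover have "(fst \<circ> \<sigma>) x \<in> range Some" if "x \<in> standard_simplex k" for x
    using im[OF that] by (auto simp: W_1_def X_r_def)
  ultimately have "continuous_map ?\<Delta> (subtopology P1 (range Some)) (fst \<circ> \<sigma>)"
    by (auto simp: continuous_map_in_subtopology)
  from continuous_map_compose[OF this continuous_map_the]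
  have ct: "continuous_map ?\<Delta> euclidean (\<lambda>x. the (fst (\<sigma> x)))" by (simp add: o_def)
  have wlt: "cmod (base_coord (\<sigma> x)) < 1 \<and> the (fst (\<sigma> x)) \<noteq> 0" if "x \<in> standard_simplex k" for x
  proof -
    have X: "\<sigma> x \<in> X_r" using im[OF that] by (simp add: W_1_def)
    then obtain u where u: "u \<in> hcoords" "proj u = \<sigma> x" by (rule proj_surj)
    have "cmod (fst u) < 1" using u(1) by (auto simp: hcoords_def)
    then show ?thesis using base_coord_proj[OF u(1)] u(2) X by (auto simp: X_r_def)
  qed
  have "continuous_map (top_of_set (- {0})) euclideanreal (\<lambda>z::complex. cmod (1 - 1 / z))"
    by (auto intro!: continuous_intros)
  moreover have "continuous_map ?\<Delta> (top_of_set (- {0})) (\<lambda>x. the (fst (\<sigma> x)))"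
    using ct wlt by (auto simp: continuous_map_in_subtopology)
  ultimately have cw: "continuous_map ?\<Delta> euclideanreal (\<lambda>x. cmod (base_coord (\<sigma> x)))"
    using continuous_map_compose[of ?\<Delta> "top_of_set (- {0})" "\<lambda>x. the (fst (\<sigma> x))" euclideanreal "\<lambda>z. cmod (1 - 1 / z)"]
    by (simp add: o_def base_coord_def)
  have "compactin euclideanreal ((\<lambda>x. cmod (base_coord (\<sigma> x))) ` standard_simplex k)"
    by (rule image_compactin[OF _ cw]) (simp add: compactin_subtopology compactin_standard_simplex)
  then obtain x0 where x0: "x0 \<in> standard_simplex k"
    "\<And>x. x \<in> standard_simplex k \<Longrightarrow> cmod (base_coord (\<sigma> x)) \<le> cmod (base_coord (\<sigma> x0))"
    using compact_attains_sup[of "(\<lambda>x. cmod (base_coord (\<sigma> x))) ` standard_simplex k"] nonempty_standard_simplex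
    by auto
  define r where "r = cmod (base_coord (\<sigma> x0))"
  have r: "r < 1" "r \<ge> 0" using wlt[OF x0(1)] by (auto simp: r_def)
  have "(\<lambda>n. r ^ n) \<longlonglongrightarrow> 0" using r by (intro LIMSEQ_power_zero) simp
  moreover have "filterlim (\<lambda>n. 2 ^ n :: nat) at_top sequentially"
    by (rule filterlim_subseq) (simp add: strict_mono_def)
  ultimately have "(\<lambda>n. r ^ 2 ^ n) \<longlonglongrightarrow> 0" by (rule filterlim_compose)
  then have "\<forall>\<^sub>F n in sequentially. r ^ 2 ^ n < core_radius" using core_radius(1) by (rule order_tendstoD(2))
  then show ?thesis
  proof eventually_elim
    case (elim n)
    then have rn: "r ^ 2 ^ n \<le> core_radius" by simp
    have "continuous_map ?\<Delta> (subtopology P1xP1 {y \<in> W_1 B. cmod (base_coord y) \<le> r}) \<sigma>"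
      using c im x0(2) by (auto simp: continuous_map_in_subtopology r_def)
    from continuous_map_compose[OF this continuous_map_Z_down[OF r(1) rn]]
    have "continuous_map ?\<Delta> euclidean (Z_down n \<circ> \<sigma>)" .
    moreover have "Z_down n (\<sigma> x) \<noteq> 0 \<and> Re (Z_down (Suc n) (\<sigma> x) / (Z_down n (\<sigma> x))\<^sup>2) > 0" if x: "x \<in> standard_simplex k" for x
    proof -
      have X: "\<sigma> x \<in> X_r" using im[OF x] by (simp add: W_1_def)
      then obtain u where u: "u \<in> hcoords" "proj u = \<sigma> x" by (rule proj_surj)
      have uW: "u \<in> W_lift" using im[OF x] u by (simp add: W_lift_def)
      have "cmod (fst u) \<le> r" using x0(2)[OF x] base_coord_proj[OF u(1)] u(2) by (simp add: r_def)
      then have "cmod (fst u) ^ 2 ^ n \<le> core_radius"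
        using rn power_mono[of "cmod (fst u)" r "2 ^ n"] by simp
      then show ?thesis
        using Z_bounds(4)[OF uW] Z_doubling[OF uW] Z_down_proj[OF u(1)] u(2) by metis
    qed
    ultimately show ?case by (simp add: nonvanishing_on_simplex_def)
  qed
qed

end

section \<open>Loops at a critical value\<close>

text \<open>The boundary point 0 is included, as paths reach w = 0; continuity there follows from
  the modulus sqrt |u| of the root.\<close>

lemma continuous_on_csqrt_right: "continuous_on {z. Re z \<ge> 0} csqrt"
  unfolding continuous_on_eq_continuous_within
proof
  fix z :: complex assume z: "z \<in> {z. Re z \<ge> 0}"
  show "continuous (at z within {z. Re z \<ge> 0}) csqrt"
  proof (cases "z = 0")
    case True
    have "((\<lambda>u. sqrt (cmod u)) \<longlongrightarrow> sqrt (cmod 0)) (at 0 within {z. Re z \<ge> 0})"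
      by (intro tendsto_intros)
    then have "(csqrt \<longlongrightarrow> 0) (at 0 within {z. Re z \<ge> 0})"
      by (intro Lim_null_comparison[of csqrt "\<lambda>u. sqrt (cmod u)"]) simp_all
    then show ?thesis by (simp add: continuous_within True)
  next
    case False
    then have "z \<notin> \<real>\<^sub>\<le>\<^sub>0" using z by (auto simp: complex_nonpos_Reals_iff complex_eq_iff)
    then show ?thesis by (rule continuous_within_csqrt)
  qed
qed

text \<open>A closed half plane bounded by the real line carries a continuous square root into itself.
  Lifting base coordinates by it keeps lifted loops closed, without following winding around 0.\<close>

lemma half_plane_root:
  obtains T rt where "w0 \<in> T" "continuous_on T rt" "rt ` T \<subseteq> T"
    "\<And>w::complex. w \<in> T \<Longrightarrow> (rt w)\<^sup>2 = w" "\<And>w r. w \<in> T \<Longrightarrow> 0 \<le> r \<Longrightarrow> of_real r * w \<in> T"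
proof -
  \<comment> \<open>A square root of \<i>. The factor -\<i> turns the upper half plane into the
    right one, the principal root lands in the sector |Im u| \<le> Re u, and the rotation by
    \<open>c\<close> brings that sector into the upper half plane.\<close>
  define c where "c = (1 + \<i>) / of_real (sqrt 2)"
  have c2: "c\<^sup>2 = \<i>" by (simp add: c_def power_divide power2_eq_square algebra_simps flip: of_real_mult)
  define rt where "rt = (\<lambda>w. c * csqrt (- \<i> * w))"
  have cont: "continuous_on {w. Im w \<ge> 0} rt"
    unfolding rt_def by (intro continuous_intros continuous_on_compose2[OF continuous_on_csqrt_right]) auto
  have sq: "(rt w)\<^sup>2 = w" for w by (simp add: rt_def power_mult_distrib c2 del: csqrt.simps)
  have im: "Im (rt w) \<ge> 0" if "Im w \<ge> 0" for w
  proof -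
    define u where "u = csqrt (- \<i> * w)"
    have "Re (u\<^sup>2) \<ge> 0" using that by (simp add: u_def del: csqrt.simps)
    then have "(Im u)\<^sup>2 \<le> (Re u)\<^sup>2" by (simp add: power2_eq_square)
    then have "\<bar>Im u\<bar> \<le> Re u"
      using Re_csqrt[of "- \<i> * w"] abs_le_square_iff[of "Im u" "Re u"] by (simp add: u_def del: csqrt.simps)
    moreover have "rt w = c * u" by (simp only: rt_def u_def)
    ultimately show ?thesis by (simp add: c_def)
  qed
  show ?thesis
  proof (cases "Im w0 \<ge> 0")
    case True
    show ?thesis
      by (rule that[of "{w. Im w \<ge> 0}" rt]) (use True cont sq im in auto)
  next
    case False
    have c': "continuous_on {w. Im w \<le> 0} (\<lambda>w. cnj (rt (cnj w)))"
      by (intro continuous_on_cnj continuous_on_compose2[OF cont]) (auto intro!: continuous_intros)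
    have sq': "(cnj (rt (cnj w)))\<^sup>2 = w" for w
      by (metis complex_cnj_cnj complex_cnj_power sq)
    have "(\<lambda>w. cnj (rt (cnj w))) ` {w. Im w \<le> 0} \<subseteq> {w. Im w \<le> 0}"
      using im by auto
    then show ?thesis
      by (intro that[of "{w. Im w \<le> 0}" "\<lambda>w. cnj (rt (cnj w))"])
         (use False c' sq' in \<open>auto simp: mult_nonneg_nonpos\<close>)
  qed
qed

context newton_parabola
begin

lemma F_preimage:
  assumes x: "x \<in> hcoords" and w: "w\<^sup>2 = fst x"
  shows "\<exists>x'. x' \<in> hcoords \<and> F x' = x \<and> fst x' = w"
proof -
  define P Q where "P = csqrt (fst (snd x))" and "Q = csqrt (snd (snd x))"
  have "cmod (w\<^sup>2) < 1" unfolding w using x by (auto simp: hcoords_def)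
  then have wl: "cmod w < 1" by (simp add: norm_power power_less_one_iff)
  define D where "D = (diag_coeff w)\<^sup>2 - (off_coeff w)\<^sup>2"
  have D: "D \<noteq> 0" using coeff_det_nonzero[OF wl] by (simp add: D_def)
  have inv: "diag_coeff w * ((diag_coeff w * u - off_coeff w * v) / D) + off_coeff w * ((diag_coeff w * v - off_coeff w * u) / D) = u" for u v
  proof -
    have "diag_coeff w * ((diag_coeff w * u - off_coeff w * v) / D) + off_coeff w * ((diag_coeff w * v - off_coeff w * u) / D)
      = (diag_coeff w * (diag_coeff w * u - off_coeff w * v) + off_coeff w * (diag_coeff w * v - off_coeff w * u)) / D"
      by (simp add: add_divide_distrib)
    also have "diag_coeff w * (diag_coeff w * u - off_coeff w * v) + off_coeff w * (diag_coeff w * v - off_coeff w * u) = D * u"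
      by (simp add: D_def power2_eq_square algebra_simps)
    finally show ?thesis using D by simp
  qed
  define x' where "x' = (w, (diag_coeff w * P - off_coeff w * Q) / D, (diag_coeff w * Q - off_coeff w * P) / D)"
  have "F x' = (w\<^sup>2, P\<^sup>2, Q\<^sup>2)"
    unfolding x'_def F.simps using inv[of P Q] inv[of Q P] by (simp add: add.commute)
  then have Fx: "F x' = x" using w by (simp add: P_def Q_def del: csqrt.simps)
  have "x' \<in> hcoords"
  proof (rule ccontr)
    assume "x' \<notin> hcoords"
    then have "fst (snd x') = 0 \<and> snd (snd x') = 0" using wl by (auto simp: hcoords_def x'_def)
    then have "F x' = (fst x' ^ 2, 0, 0)" by (cases x') simp
    then show False using Fx x by (auto simp: hcoords_def)
  qed
  then show ?thesis using Fx by (intro exI[of _ x']) (simp add: x'_def)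
qed

section \<open>The fibre over w = 0\<close>

lemma funpow_F_core: "\<exists>c. c \<noteq> 0 \<and> (F ^^ n) (0, p, q) = (0, c * p ^ 2 ^ n, c * q ^ 2 ^ n)"
proof (induction n)
  case 0
  show ?case by (intro exI[of _ 1]) simp
next
  case (Suc n)
  then obtain c where c: "c \<noteq> 0" "(F ^^ n) (0, p, q) = (0, c * p ^ 2 ^ n, c * q ^ 2 ^ n)" by blast
  have "off_coeff 0 = 0" "diag_coeff 0 \<noteq> 0" using core_radius(1) core_radius(3)[of 0] by (simp_all add: off_coeff_def)
  then show ?case using c
    by (intro exI[of _ "(diag_coeff 0 * c)\<^sup>2"]) (simp add: power_mult_distrib power_mult[symmetric] mult.commute mult.assoc)
qed

lemma Z_core: "Z n (0, p, q) = (p / q) ^ 2 ^ n"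
  using funpow_F_core[of n p q] by (auto simp: Z_def power_divide)

lemma core_in_W_lift:
  assumes "p \<noteq> 0" "cmod p = cmod q"
  shows "(0, p, q) \<in> W_lift"
proof -
  have d: "(0, p, q) \<in> hcoords" using assms by (simp add: hcoords_def)
  have "q \<noteq> 0" using assms by auto
  then have "balanced 2 ((F ^^ n) (0, p, q))" for n
    using funpow_F_core[of n p q] assms by (auto simp: balanced_def norm_mult norm_power)
  then have "proj (0, p, q) \<in> W_1 B" by (intro W_1_if_bounded[OF d, of 0 2])
  then show ?thesis using d by (simp add: W_lift_def)
qed

text \<open>Over w = 0 the iterates have coordinate z^(2^n), which by \<open>Z_bounds\<close> stays
  between 1 / 2 and 2 in modulus for all n; only |z| = 1 allows this.\<close>

lemma W_lift_core:
  assumes x: "x \<in> W_lift" "fst x = 0"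
  shows "\<exists>p q. x = (0, p, q) \<and> p \<noteq> 0 \<and> cmod p = cmod q"
proof -
  obtain p q where pq: "x = (0, p, q)" using x(2) by (cases x) auto
  have "1 / 2 < cmod (Z n x) \<and> cmod (Z n x) < 2" for n
  proof -
    have "(0::real) ^ 2 ^ n \<le> core_radius" using core_radius(1) by (simp add: power_0_left)
    then show ?thesis using Z_bounds(2,3)[OF x(1), of n] x(2) by simp
  qed
  then have b: "1 / 2 < cmod (p / q) ^ 2 ^ n" "cmod (p / q) ^ 2 ^ n < 2" for n
    unfolding pq Z_core norm_power by auto
  have nz: "p \<noteq> 0" "q \<noteq> 0" using b(1)[of 0] by auto
  have le: "k \<le> 2 ^ k" for k :: nat by (simp add: less_imp_le)
  have "cmod (p / q) = 1"
  proof (rule antisym; rule ccontr)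
    assume "\<not> cmod (p / q) \<le> 1"
    then obtain k where k: "2 < cmod (p / q) ^ k" using real_arch_pow[of "cmod (p / q)" 2] by auto
    have "cmod (p / q) ^ k \<le> cmod (p / q) ^ 2 ^ k"
      using \<open>\<not> cmod (p / q) \<le> 1\<close> le by (intro power_increasing) auto
    then show False using k b(2)[of k] by simp
  next
    assume lt: "\<not> 1 \<le> cmod (p / q)"
    then obtain k where k: "cmod (p / q) ^ k < 1 / 2" using real_arch_pow_inv[of "1 / 2" "cmod (p / q)"] by auto
    have "cmod (p / q) ^ 2 ^ k \<le> cmod (p / q) ^ k"
      using lt le by (intro power_decreasing) auto
    then show False using k b(1)[of k] by simp
  qed
  then show ?thesis using pq nz by (simp add: norm_divide)
qed

section \<open>Winding numbers of paths in the stable set\<close>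

definition loop_winding :: "nat \<Rightarrow> (real \<Rightarrow> complex \<times> complex \<times> complex) \<Rightarrow> complex" where
  "loop_winding n g = winding_number (\<lambda>t. Z n (g t)) 0"

lemma path_eventually_small:
  assumes "path g" "path_image g \<subseteq> W_lift"
  shows "\<forall>\<^sub>F n in sequentially. \<forall>x\<in>path_image g. cmod (fst x) ^ 2 ^ n \<le> core_radius"
proof -
  have "compact (path_image g)" using assms(1) by (rule compact_path_image)
  moreover have "continuous_on (path_image g) (\<lambda>x. cmod (fst x))" by (intro continuous_intros)
  ultimately obtain x0 where x0: "x0 \<in> path_image g" "\<And>x. x \<in> path_image g \<Longrightarrow> cmod (fst x) \<le> cmod (fst x0)"
    using continuous_attains_sup[of "path_image g" "\<lambda>x. cmod (fst x)"] by auto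
  define r where "r = cmod (fst x0)"
  have r: "r < 1" "r \<ge> 0" using W_lift_norm[of x0] x0(1) assms(2) by (auto simp: r_def)
  have "(\<lambda>n. r ^ n) \<longlonglongrightarrow> 0" using r by (intro LIMSEQ_power_zero) simp
  moreover have "filterlim (\<lambda>n. 2 ^ n :: nat) at_top sequentially"
    by (rule filterlim_subseq) (simp add: strict_mono_def)
  ultimately have "(\<lambda>n. r ^ 2 ^ n) \<longlonglongrightarrow> 0" by (rule filterlim_compose)
  then have "\<forall>\<^sub>F n in sequentially. r ^ 2 ^ n < core_radius" using core_radius(1) by (rule order_tendstoD(2))
  then show ?thesis
  proof eventually_elim
    case (elim n)
    show ?case
    proof
      fix x assume "x \<in> path_image g"
      then have "cmod (fst x) ^ 2 ^ n \<le> r ^ 2 ^ n" using x0(2) by (intro power_mono) (auto simp: r_def)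
      then show "cmod (fst x) ^ 2 ^ n \<le> core_radius" using elim by simp
    qed
  qed
qed

lemma path_eventually_nonzero:
  assumes "path g" "path_image g \<subseteq> W_lift"
  shows "\<forall>\<^sub>F n in sequentially. path (Z n \<circ> g) \<and> 0 \<notin> path_image (Z n \<circ> g)"
  using path_eventually_small[OF assms]
proof eventually_elim
  case (elim n)
  have sub: "path_image g \<subseteq> {x \<in> W_lift. cmod (fst x) ^ 2 ^ n \<le> core_radius}" using elim assms(2) by auto
  have "path (Z n \<circ> g)"
    using assms(1) continuous_on_subset[OF continuous_on_Z sub] by (rule path_continuous_image)
  moreover have "0 \<notin> path_image (Z n \<circ> g)"
    unfolding path_image_compose using sub Z_bounds(4) by force
  ultimately show ?case by simp
qed

lemma loop_winding_join:
  assumes "path g" "path_image g \<subseteq> W_lift" "path h" "path_image h \<subseteq> W_lift" "pathfinish g = pathstart h"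
  shows "\<forall>\<^sub>F n in sequentially. loop_winding n (g +++ h) = loop_winding n g + loop_winding n h"
  using path_eventually_nonzero[OF assms(1,2)] path_eventually_nonzero[OF assms(3,4)]
proof eventually_elim
  case (elim n)
  have "loop_winding n (g +++ h) = winding_number ((Z n \<circ> g) +++ (Z n \<circ> h)) 0"
    by (simp add: loop_winding_def flip: path_compose_join) (simp add: o_def)
  also have "\<dots> = winding_number (Z n \<circ> g) 0 + winding_number (Z n \<circ> h) 0"
    using elim assms(5) by (intro winding_number_join) (auto simp: pathfinish_compose pathstart_compose)
  finally show ?case by (simp add: loop_winding_def o_def)
qed

lemma loop_winding_reversepath:
  assumes "path g" "path_image g \<subseteq> W_lift"
  shows "\<forall>\<^sub>F n in sequentially. loop_winding n (reversepath g) = - loop_winding n g"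
  using path_eventually_nonzero[OF assms]
proof eventually_elim
  case (elim n)
  have "loop_winding n (reversepath g) = winding_number (reversepath (Z n \<circ> g)) 0"
    by (simp add: loop_winding_def reversepath_def o_def)
  then show ?case using elim winding_number_reversepath by (simp add: loop_winding_def o_def)
qed

lemma loop_winding_scale: "c \<noteq> 0 \<Longrightarrow> loop_winding n (\<lambda>t. scale c (g t)) = loop_winding n g"
  by (simp add: loop_winding_def Z_scale)

text \<open>The shift of the index is the halving: 2^n / 2^k for \<open>g\<close> at index n is
  2^(n+1) / 2^(k+1) for \<open>h\<close> at index n + 1.\<close>

lemma loop_winding_lift:
  assumes "\<And>t. t \<in> {0..1} \<Longrightarrow> F (h t) = g t"
  shows "loop_winding (Suc n) h = loop_winding n g"
  unfolding loop_winding_def by (rule winding_number_cong) (use assms in \<open>simp add: Z_Suc\<close>)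

text \<open>\<open>T\<close> will be a half plane from \<open>half_plane_root\<close>. Closure under
  nonnegative factors keeps the radial paths of \<open>path_to_core\<close> over it and puts 0,
  hence the circle over w = 0, into reach.\<close>

definition W_over :: "complex set \<Rightarrow> (complex \<times> complex \<times> complex) set" where
  "W_over T = {x \<in> W_lift. fst x \<in> T}"

context
  fixes T :: "complex set" and rt :: "complex \<Rightarrow> complex"
  assumes rt: "continuous_on T rt" "rt ` T \<subseteq> T" "\<And>w. w \<in> T \<Longrightarrow> (rt w)\<^sup>2 = w"
    and T: "\<And>w r. w \<in> T \<Longrightarrow> 0 \<le> r \<Longrightarrow> of_real r * w \<in> T"
begin

lemma W_T_W_lift: "W_over T \<subseteq> W_lift" by (auto simp: W_over_def)

lemma path_to_core_T:
  assumes "x \<in> W_over T"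
  shows "\<exists>g p q. path g \<and> path_image g \<subseteq> W_over T \<and> pathstart g = x \<and> pathfinish g = (0, p, q) \<and> p \<noteq> 0 \<and> cmod p = cmod q"
proof -
  have x: "x \<in> W_lift" "fst x \<in> T" using assms by (auto simp: W_over_def)
  from path_to_core[OF x(1)] obtain g \<rho> where gr: "continuous_on {0..1::real} g \<and> g 0 = x \<and> continuous_on {0..1} \<rho> \<and> \<rho> 0 = 1 \<and> \<rho> 1 = 0 \<and>
    (\<forall>t\<in>{0..1}. g t \<in> W_lift \<and> \<rho> t \<in> {0..1::real} \<and> fst (g t) = of_real (\<rho> t) * fst x)"
    by (elim exE)
  have "g t \<in> W_over T" if t: "t \<in> {0..1}" for t
  proof -
    have "g t \<in> W_lift" "0 \<le> \<rho> t" "fst (g t) = of_real (\<rho> t) * fst x" using gr t by auto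
    then show ?thesis using T[OF x(2)] by (simp add: W_over_def)
  qed
  then have "path_image g \<subseteq> W_over T" by (auto simp: path_image_def)
  moreover have "g 1 \<in> W_lift" "fst (g 1) = 0" using gr by auto
  then obtain p q where "g 1 = (0, p, q)" "p \<noteq> 0" "cmod p = cmod q" using W_lift_core by blast
  ultimately show ?thesis
    using gr by (intro exI[of _ g] exI[of _ p] exI[of _ q]) (auto simp: path_def pathstart_def pathfinish_def)
qed

lemma core_in_W_T: "x \<in> W_over T \<Longrightarrow> p \<noteq> 0 \<Longrightarrow> cmod p = cmod q \<Longrightarrow> (0, p, q) \<in> W_over T"
  using core_in_W_lift T[of "fst x" 0] by (auto simp: W_over_def)

lemma core_path:
  assumes x: "x \<in> W_over T" and 1: "p \<noteq> 0" "cmod p = cmod q" and 2: "p' \<noteq> 0" "cmod p' = cmod q'"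
  shows "\<exists>g. path g \<and> path_image g \<subseteq> W_over T \<and> pathstart g = (0, p, q) \<and> pathfinish g = (0, p', q')"
proof -
  have nz: "q \<noteq> 0" "q' \<noteq> 0" using 1 2 by auto
  \<comment> \<open>Interpolating logarithms preserves |p| = |q|, because \<open>Ln p\<close> and
    \<open>Ln q\<close> have equal real parts, and so have \<open>Ln p'\<close> and
    \<open>Ln q'\<close>.\<close>
  define g where "g = (\<lambda>t::real. (0::complex, exp (of_real (1 - t) * Ln p + of_real t * Ln p'),
      exp (of_real (1 - t) * Ln q + of_real t * Ln q')))"
  have "path g" unfolding path_def g_def by (intro continuous_intros)
  moreover have "g t \<in> W_over T" for t
    unfolding g_def by (rule core_in_W_T[OF x]) (use 1 2 nz in simp_all)
  then have "path_image g \<subseteq> W_over T" by (auto simp: path_image_def)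
  moreover have "pathstart g = (0, p, q)" "pathfinish g = (0, p', q')"
    using 1 2 nz by (simp_all add: pathstart_def pathfinish_def g_def)
  ultimately show ?thesis by blast
qed

lemma W_T_path_connected:
  assumes x: "x \<in> W_over T" and y: "y \<in> W_over T"
  shows "\<exists>g. path g \<and> path_image g \<subseteq> W_over T \<and> pathstart g = x \<and> pathfinish g = y"
proof -
  obtain g p q where g: "path g" "path_image g \<subseteq> W_over T" "pathstart g = x" "pathfinish g = (0, p, q)" "p \<noteq> 0" "cmod p = cmod q"
    using path_to_core_T[OF x] by (elim exE conjE)
  obtain h p' q' where h: "path h" "path_image h \<subseteq> W_over T" "pathstart h = y" "pathfinish h = (0, p', q')" "p' \<noteq> 0" "cmod p' = cmod q'"
    using path_to_core_T[OF y] by (elim exE conjE)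
  obtain k where k: "path k" "path_image k \<subseteq> W_over T" "pathstart k = (0, p, q)" "pathfinish k = (0, p', q')"
    using core_path[OF x g(5,6) h(5,6)] by (elim exE conjE)
  show ?thesis
    by (intro exI[of _ "g +++ (k +++ reversepath h)"])
       (use g h k in \<open>simp add: path_image_join\<close>)
qed

text \<open>The circle over w = 0, traversed once, conjugated by a path from \<open>x\<close>. On
  the circle the n-th iterate has coordinate z^(2^n), and the contributions of the path out and back
  cancel.\<close>

lemma base_loop:
  assumes x: "x \<in> W_over T"
  shows "\<exists>g. path g \<and> path_image g \<subseteq> W_over T \<and> pathstart g = x \<and> pathfinish g = x \<and>
    (\<forall>\<^sub>F n in sequentially. loop_winding n g = 2 ^ n)"
proof -
  obtain g p q where g: "path g" "path_image g \<subseteq> W_over T" "pathstart g = x" "pathfinish g = (0, p, q)" "p \<noteq> 0" "cmod p = cmod q"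
    using path_to_core_T[OF x] by (elim exE conjE)
  have q: "q \<noteq> 0" using g(5,6) by auto
  define k where "k = (\<lambda>t::real. (0::complex, p * exp (2 * of_real pi * \<i> * of_real t), q))"
  have k: "path k" "path_image k \<subseteq> W_over T" "pathstart k = (0, p, q)" "pathfinish k = (0, p, q)"
  proof -
    show "path k" unfolding path_def k_def by (intro continuous_intros)
    have "k t \<in> W_over T" for t
      unfolding k_def by (rule core_in_W_T[OF x]) (use g in \<open>simp_all add: norm_mult\<close>)
    then show "path_image k \<subseteq> W_over T" by (auto simp: path_image_def)
    have "exp (2 * of_real pi * \<i>) = (1::complex)" using exp_two_pi_i by simp
    then show "pathstart k = (0, p, q)" "pathfinish k = (0, p, q)"
      by (simp_all add: k_def pathstart_def pathfinish_def)
  qed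
  have lk: "loop_winding n k = 2 ^ n" for n
  proof -
    define l where "l = (\<lambda>t::real. Ln ((p / q) ^ 2 ^ n) + of_nat (2 ^ n) * (2 * of_real pi * \<i> * of_real t))"
    have "Z n (k t) = exp (l t)" for t
    proof -
      have "Z n (k t) = (p / q * exp (2 * of_real pi * \<i> * of_real t)) ^ 2 ^ n"
        by (simp add: k_def Z_core)
      also have "\<dots> = (p / q) ^ 2 ^ n * exp (of_nat (2 ^ n) * (2 * of_real pi * \<i> * of_real t))"
        by (simp only: power_mult_distrib exp_of_nat_mult)
      also have "\<dots> = exp (l t)" using g(5) q by (simp add: l_def exp_add)
      finally show ?thesis .
    qed
    then have "loop_winding n k = (l 1 - l 0) / (2 * pi * \<i>)"
      unfolding loop_winding_def by (intro winding_number_exp_path) (auto simp: l_def intro!: continuous_intros)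
    also have "\<dots> = 2 ^ n" by (simp add: l_def)
    finally show ?thesis .
  qed
  let ?L = "g +++ (k +++ reversepath g)"
  have gW: "path_image g \<subseteq> W_lift" and kW: "path_image k \<subseteq> W_lift" using g k W_T_W_lift by auto
  have kg: "path (k +++ reversepath g)" "path_image (k +++ reversepath g) \<subseteq> W_lift"
    using g k gW kW by (simp_all add: path_image_join)
  have "\<forall>\<^sub>F n in sequentially. loop_winding n ?L = loop_winding n g + loop_winding n (k +++ reversepath g)"
    by (rule loop_winding_join[OF g(1) gW kg]) (use g k in simp)
  moreover have "\<forall>\<^sub>F n in sequentially. loop_winding n (k +++ reversepath g) = loop_winding n k + loop_winding n (reversepath g)"
    by (rule loop_winding_join[OF k(1) kW]) (use g k gW in simp_all)
  ultimately have "\<forall>\<^sub>F n in sequentially. loop_winding n ?L = 2 ^ n"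
    using loop_winding_reversepath[OF g(1) gW] by eventually_elim (simp add: lk)
  then show ?thesis
    by (intro exI[of _ ?L]) (use g k in \<open>simp add: path_image_join\<close>)
qed

text \<open>The induction runs on paths closed up to a factor \<open>c\<close>, as the ends of a
  lift agree only projectively. Using \<open>rt\<close> for the base coordinate makes the lift end
  over the same base point where it started.\<close>

lemma halving_loops:
  assumes x: "(w0, p0, q0) \<in> W_over T" and crit: "p0 * q0 = 0"
  shows "\<exists>g c. path g \<and> path_image g \<subseteq> W_over T \<and> pathstart g = (w0, p0, q0) \<and> c \<noteq> 0 \<and>
    pathfinish g = scale c (w0, p0, q0) \<and> (\<forall>\<^sub>F n in sequentially. loop_winding n g = 2 ^ n / 2 ^ k)"
proof (induction k)
  case 0
  obtain g where "path g \<and> path_image g \<subseteq> W_over T \<and> pathstart g = (w0, p0, q0) \<and> pathfinish g = (w0, p0, q0) \<and>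
    (\<forall>\<^sub>F n in sequentially. loop_winding n g = 2 ^ n)"
    using base_loop[OF x] by (elim exE)
  then show ?case
    by (intro exI[of _ g] exI[of _ 1]) (simp add: scale_def)
next
  case (Suc k)
  then obtain g c where g: "path g" "path_image g \<subseteq> W_over T" "pathstart g = (w0, p0, q0)" "c \<noteq> 0"
    "pathfinish g = scale c (w0, p0, q0)" and lg: "\<forall>\<^sub>F n in sequentially. loop_winding n g = 2 ^ n / 2 ^ k"
    by (elim exE conjE)
  have w0: "w0 \<in> T" and xd: "(w0, p0, q0) \<in> hcoords" using x W_lift_hcoords by (auto simp: W_over_def)
  have gt: "g t \<in> W_over T" if "t \<in> {0..1}" for t using g(2) that by (auto simp: path_image_def)
  then have gd: "g t \<in> hcoords" and gT: "fst (g t) \<in> T" if "t \<in> {0..1}" for t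
    using W_lift_hcoords that by (auto simp: W_over_def)
  obtain x' where x': "x' \<in> hcoords" "F x' = (w0, p0, q0)" "fst x' = rt w0"
    using F_preimage[OF xd, of "rt w0"] rt(3)[OF w0] by auto
  define w where "w = (\<lambda>t. rt (fst (g t)))"
  have g': "continuous_on {0..1} g" "g 0 = (w0, p0, q0)" "g 1 = scale c (w0, p0, q0)"
    using g by (simp_all add: path_def pathstart_def pathfinish_def)
  have cw: "continuous_on {0..1} w"
    unfolding w_def by (rule continuous_on_compose2[OF rt(1)]) (use g'(1) gT in \<open>auto intro!: continuous_intros\<close>)
  have wsq: "(w t)\<^sup>2 = fst (g t)" if "t \<in> {0..1}" for t
    using rt(3)[OF gT[OF that]] by (simp add: w_def)
  have Fx0: "F x' = g 0" "fst x' = w 0" using x' g' by (simp_all add: w_def)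
  have "\<exists>h. continuous_on {0..1} h \<and> h 0 = x' \<and> (\<forall>t\<in>{0..1}. fst (h t) = w t \<and> F (h t) = g t \<and> h t \<in> hcoords)"
    by (rule F_path_lift[OF g'(1) gd cw wsq Fx0])
  then obtain h where h: "continuous_on {0..1} h" "h 0 = x'"
    and ht: "\<forall>t\<in>{0..1}. fst (h t) = w t \<and> F (h t) = g t \<and> h t \<in> hcoords"
    by (elim exE conjE)
  have hW: "h t \<in> W_over T" if t: "t \<in> {0..1}" for t
  proof -
    have "h t \<in> hcoords" "F (h t) = g t" "fst (h t) = rt (fst (g t))" using ht t by (auto simp: w_def)
    then show ?thesis using gt[OF t] F_W_lift_iff[of "h t"] rt(2) by (auto simp: W_over_def)
  qed
  have h_path: "path h" "path_image h \<subseteq> W_over T" "pathstart h = x'"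
    using h hW by (auto simp: path_def path_image_def pathstart_def)
  obtain c' where c': "c' \<noteq> 0" "h 1 = scale c' x'"
  proof -
    obtain p q where xp: "x' = (rt w0, p, q)" using x'(3) by (cases x') auto
    have h1: "fst (h 1) = rt w0" "F (h 1) = scale c (w0, p0, q0)" using ht g'(3) by (auto simp: w_def scale_def)
    then obtain p' q' where hp: "h 1 = (rt w0, p', q')" by (cases "h 1") auto
    define \<alpha> \<beta> where "\<alpha> = diag_coeff (rt w0)" and "\<beta> = off_coeff (rt w0)"
    have e: "(\<alpha> * p + \<beta> * q)\<^sup>2 = p0" "(\<beta> * p + \<alpha> * q)\<^sup>2 = q0"
      "(\<alpha> * p' + \<beta> * q')\<^sup>2 = c * p0" "(\<beta> * p' + \<alpha> * q')\<^sup>2 = c * q0"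
      using x'(2) h1(2) by (simp_all add: xp hp \<alpha>_def \<beta>_def scale_def)
    \<comment> \<open>If \<open>p0 = 0\<close> the first form vanishes at both \<open>x'\<close> and
      \<open>h 1\<close>, and if \<open>q0 = 0\<close> the second does. Either way both products are
      0, which makes the ends of the lift proportional.\<close>
    have "(\<alpha> * p + \<beta> * q) * (\<beta> * p' + \<alpha> * q') = (\<alpha> * p' + \<beta> * q') * (\<beta> * p + \<alpha> * q)"
      using crit e by auto
    then have "(\<alpha>\<^sup>2 - \<beta>\<^sup>2) * (p * q' - p' * q) = 0"
      by (simp add: algebra_simps power2_eq_square)
    moreover have "cmod (rt w0) < 1" using x'(1,3) by (auto simp: hcoords_def)
    then have "\<alpha>\<^sup>2 - \<beta>\<^sup>2 \<noteq> 0" using coeff_det_nonzero by (simp add: \<alpha>_def \<beta>_def)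
    ultimately have pq: "p * q' = p' * q" by simp
    have d: "x' \<in> hcoords" "h 1 \<in> hcoords" using x' ht by auto
    have "proj x' = proj (h 1)"
    proof (cases "p = 0")
      case True
      then have "q \<noteq> 0" "p' = 0" "q' \<noteq> 0" using d pq by (auto simp: hcoords_def xp hp)
      then have "h 1 = scale (q' / q) x'" "q' / q \<noteq> 0" using True by (simp_all add: hp xp scale_def)
      then show ?thesis using proj_scale' by metis
    next
      case False
      then have q': "q' = p' * q / p" using pq by (simp add: field_simps)
      then have "p' \<noteq> 0" using d by (auto simp: hcoords_def hp)
      then have "h 1 = scale (p' / p) x'" "p' / p \<noteq> 0" using False q' by (simp_all add: hp xp scale_def)
      then show ?thesis using proj_scale' by metis
    qed
    then show thesis using proj_eq_scale[OF _ d] that by blast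
  qed
  have x'W: "x' \<in> W_over T" using hW[of 0] h(2) by simp
  obtain s where s: "path s" "path_image s \<subseteq> W_over T" "pathstart s = (w0, p0, q0)" "pathfinish s = x'"
    using W_T_path_connected[OF x x'W] by (elim exE conjE)
  \<comment> \<open>The lift ends at \<open>scale c' x'\<close>, so the return path is rescaled by
    \<open>c'\<close>; by \<open>loop_winding_scale\<close> its winding number still cancels that of
    \<open>s\<close>.\<close>
  define s' where "s' = (\<lambda>t. scale c' (reversepath s t))"
  have "path s'"
    using s(1) path_reversepath[of s] unfolding path_def s'_def scale_def by (auto intro!: continuous_intros)
  moreover have "path_image s' \<subseteq> W_over T"
  proof -
    have "scale c' y \<in> W_over T" if "y \<in> W_over T" for y
      using that scale_W_lift[OF c'(1)] by (auto simp: W_over_def scale_def)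
    moreover have "path_image s' = scale c' ` path_image (reversepath s)"
      by (simp add: path_image_def s'_def image_image)
    ultimately show ?thesis using s(2) by auto
  qed
  moreover have "pathstart s' = scale c' x'" "pathfinish s' = scale c' (w0, p0, q0)"
    using s by (simp_all add: s'_def reversepath_def pathstart_def pathfinish_def)
  ultimately have s': "path s'" "path_image s' \<subseteq> W_over T" "pathstart s' = scale c' x'"
    "pathfinish s' = scale c' (w0, p0, q0)" by auto
  have hf: "pathfinish h = scale c' x'" using c' by (simp add: pathfinish_def)
  let ?L = "s +++ (h +++ s')"
  have up: "path_image s \<subseteq> W_lift" "path_image h \<subseteq> W_lift" "path_image s' \<subseteq> W_lift"
    using s s' h_path W_T_W_lift by auto
  have hs: "path (h +++ s')" "path_image (h +++ s') \<subseteq> W_lift"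
    using h_path s' hf up by (simp_all add: path_image_join)
  have "\<forall>\<^sub>F n in sequentially. loop_winding n ?L = loop_winding n s + loop_winding n (h +++ s')"
    by (rule loop_winding_join[OF s(1) up(1) hs]) (use h_path s in simp)
  moreover have "\<forall>\<^sub>F n in sequentially. loop_winding n (h +++ s') = loop_winding n h + loop_winding n s'"
    by (rule loop_winding_join[OF h_path(1) up(2) s'(1) up(3)]) (use hf s' in simp)
  moreover have "\<forall>\<^sub>F n in sequentially. loop_winding n s' = - loop_winding n s"
    using loop_winding_reversepath[OF s(1) up(1)] by eventually_elim (simp add: s'_def loop_winding_scale[OF c'(1)])
  moreover have "\<forall>\<^sub>F n in sequentially. loop_winding n h = 2 ^ n / 2 ^ Suc k"
  proof -
    have "\<forall>\<^sub>F n in sequentially. loop_winding (Suc n) h = 2 ^ Suc n / 2 ^ Suc k"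
      using lg by eventually_elim (use loop_winding_lift[of h g] ht in simp)
    then show ?thesis
      by (rule eventually_sequentially_Suc[of "\<lambda>n. loop_winding n h = 2 ^ n / 2 ^ Suc k", THEN iffD1])
  qed
  ultimately have "\<forall>\<^sub>F n in sequentially. loop_winding n ?L = 2 ^ n / 2 ^ Suc k"
    by eventually_elim simp
  then show ?case
    by (intro exI[of _ ?L] exI[of _ c']) (use s s' h_path hf c' in \<open>simp add: path_image_join\<close>)
qed

end

text \<open>Four times the left-hand side of the equation of the parabola is U^2 -
  (\<open>crit w\<close>)^2. For \<open>U = crit w * (q + p) / (q - p)\<close> its vanishing means
  (q + p)^2 = (q - p)^2, that is, p q = 0.\<close>

lemma critical_value_parabola_point:
  assumes y: "y \<in> W_1 B" "y \<in> critical_value_parabola B"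
  shows "\<exists>w p q. (w, p, q) \<in> W_lift \<and> proj (w, p, q) = y \<and> p * q = 0"
proof -
  have "y \<in> X_r" using y(1) by (simp add: W_1_def)
  then obtain x where x: "x \<in> hcoords" "proj x = y" by (rule proj_surj)
  obtain w p q where wpq: "x = (w, p, q)" by (cases x)
  have w: "cmod w < 1" using x(1) by (auto simp: wpq hcoords_def)
  have "snd (proj x) \<noteq> None" using y(2) x(2) by (auto simp: critical_value_parabola_def)
  then have pq: "q - p \<noteq> 0"
    using proj_None_iff[of w p q] x(1) by (auto simp: wpq simp del: proj.simps)
  define X where "X = 1 / (1 - w)"
  define v where "v = (crit w * (q + p) + (1 - B * X) * (q - p)) / (2 * (q - p))"
  have "y = (Some X, Some v)"
    using pq x(2) by (auto simp: wpq ratio_def X_def v_def)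
  then have C: "v\<^sup>2 + B * X * v + B\<^sup>2 / 4 * X\<^sup>2 - B\<^sup>2 / 4 * X - v = 0"
    using y(2) by (auto simp: critical_value_parabola_def)
  define U where "U = crit w * (q + p) / (q - p)"
  have "2 * (q - p) \<noteq> 0" using pq by simp
  from nonzero_eq_divide_eq[OF this, THEN iffD1, OF v_def]
  have "crit w * (q + p) = (2 * v + B * X - 1) * (q - p)" by (simp add: algebra_simps)
  then have Uv: "U = 2 * v + B * X - 1"
    unfolding U_def using nonzero_divide_eq_eq[OF pq] by blast
  have "U\<^sup>2 - (1 - (2 * B - B\<^sup>2) * X) = 4 * (v\<^sup>2 + B * X * v + B\<^sup>2 / 4 * X\<^sup>2 - B\<^sup>2 / 4 * X - v)"
    unfolding Uv by (simp add: power2_eq_square algebra_simps)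
  then have "U\<^sup>2 - (1 - (2 * B - B\<^sup>2) * X) = 0" by (simp only: C mult_zero_right)
  moreover have "(crit w)\<^sup>2 = 1 - (2 * B - B\<^sup>2) * X" using crit_sq[OF w] by (simp add: X_def)
  ultimately have "U\<^sup>2 = (crit w)\<^sup>2" by (simp only: right_minus_eq)
  then have "U\<^sup>2 * (q - p)\<^sup>2 = (crit w)\<^sup>2 * (q - p)\<^sup>2" by simp
  moreover have "U\<^sup>2 * (q - p)\<^sup>2 = (crit w)\<^sup>2 * (q + p)\<^sup>2"
    using pq by (simp add: U_def power_divide power_mult_distrib)
  ultimately have "(q + p)\<^sup>2 = (q - p)\<^sup>2" using crit_nonzero[OF w] by simp
  then have "4 * (p * q) = 0" by (simp add: power2_eq_square algebra_simps)
  then show ?thesis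
    using x y(1) by (intro exI[of _ w] exI[of _ p] exI[of _ q]) (simp add: W_lift_def wpq del: proj.simps)
qed

text \<open>Under \<open>proj\<close> a path closed up to scaling becomes a loop. The barycentric
  coordinate \<open>x 1\<close> is the parameter of \<open>edge\<close>, and the restriction makes
  the simplex extensional.\<close>

lemma loop_simplex:
  assumes g: "path g" "path_image g \<subseteq> W_lift" and c: "c \<noteq> 0" "pathfinish g = scale c (pathstart g)"
  defines "\<sigma> \<equiv> restrict (\<lambda>x. proj (g (x 1))) (standard_simplex 1)"
  shows "singular_simplex 1 (subtopology P1xP1 (W_1 B)) \<sigma>" "\<sigma> (edge 0) = \<sigma> (edge 1)"
    "edge_winding (Z_down n) \<sigma> = loop_winding n g"
proof -
  have gt: "g t \<in> W_lift" if "t \<in> {0..1}" for t using g(2) that by (auto simp: path_image_def)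
  have x1: "x 1 \<in> {0..1}" if "x \<in> standard_simplex 1" for x :: "nat \<Rightarrow> real"
    using that by (auto simp: standard_simplex_def)
  have c1: "continuous_map (top_of_set {0..1}) (top_of_set hcoords) g"
    using g(1) gt W_lift_hcoords by (auto simp: path_def)
  have c2: "continuous_map (subtopology (powertop_real UNIV) (standard_simplex 1)) (top_of_set {0..1}) (\<lambda>x. x 1)"
    unfolding continuous_map_in_subtopology using x1
    by (auto intro!: continuous_map_from_subtopology continuous_map_product_projection simp del: One_nat_def)
  have "continuous_map (subtopology (powertop_real UNIV) (standard_simplex 1)) P1xP1 (proj \<circ> (g \<circ> (\<lambda>x. x 1)))"
    by (rule continuous_map_compose[OF continuous_map_compose[OF c2 c1] continuous_map_proj])
  then have "continuous_map (subtopology (powertop_real UNIV) (standard_simplex 1)) P1xP1 \<sigma>"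
    by (rule continuous_map_eq) (simp add: \<sigma>_def del: proj.simps)
  moreover have "\<sigma> x \<in> W_1 B" if "x \<in> standard_simplex 1" for x
    using gt[OF x1[OF that]] that by (simp add: \<sigma>_def W_lift_def del: proj.simps One_nat_def)
  then have "\<sigma> ` standard_simplex 1 \<subseteq> W_1 B" by blast
  moreover have "\<sigma> \<in> extensional (standard_simplex 1)" unfolding \<sigma>_def by (rule restrict_extensional)
  ultimately show "singular_simplex 1 (subtopology P1xP1 (W_1 B)) \<sigma>"
    by (simp only: singular_simplex_subtopology) (simp only: singular_simplex_def simp_thms)
  have e: "\<sigma> (edge t) = proj (g t)" if "t \<in> {0..1}" for t
    using edge_in_standard_simplex[OF that] unfolding \<sigma>_def by (simp add: edge_def del: proj.simps)
  have "g 1 = scale c (g 0)" using c(2) by (simp add: pathfinish_def pathstart_def)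
  then show "\<sigma> (edge 0) = \<sigma> (edge 1)" using e[of 0] e[of 1] proj_scale'[OF c(1)] by simp
  show "edge_winding (Z_down n) \<sigma> = loop_winding n g"
    unfolding edge_winding_def loop_winding_def
    by (rule winding_number_cong) (simp add: e Z_down_proj[OF W_lift_hcoords[OF gt]] del: proj.simps)
qed

end

theorem proposition8p26:
  fixes B :: complex
  assumes "cmod (1 - B) > 1"
    and "W_1 B \<inter> critical_value_parabola B \<noteq> {}"
  shows "\<not> finitely_generated_group (homology_group 1 (subtopology P1xP1 (W_1 B)))"
proof -
  interpret newton_parabola B by unfold_locales (rule assms(1))
  obtain y where "y \<in> W_1 B" "y \<in> critical_value_parabola B" using assms(2) by blast
  from critical_value_parabola_point[OF this] obtain w p q where
    x: "(w, p, q) \<in> W_lift" and pq: "p * q = 0"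
    by (elim exE conjE)
  \<comment> \<open>One half plane, containing the base coordinate of the critical value, serves for
    all \<open>k\<close>.\<close>
  obtain T rt where T: "w \<in> T" "continuous_on T rt" "rt ` T \<subseteq> T" "\<And>w. w \<in> T \<Longrightarrow> (rt w)\<^sup>2 = w"
    "\<And>w r. w \<in> T \<Longrightarrow> 0 \<le> r \<Longrightarrow> of_real r * w \<in> T"
    by (rule half_plane_root[of w]) blast
  have xT: "(w, p, q) \<in> W_over T" using x T(1) by (simp add: W_over_def)
  show ?thesis
  proof (rule not_finitely_generated_homology_1[where Z=Z_down])
    fix k
    have "\<exists>g c. path g \<and> path_image g \<subseteq> W_over T \<and> pathstart g = (w, p, q) \<and> c \<noteq> 0 \<and>
      pathfinish g = scale c (w, p, q) \<and> (\<forall>\<^sub>F n in sequentially. loop_winding n g = 2 ^ n / 2 ^ k)"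
      by (rule halving_loops[OF T(2-5) xT pq])
    then obtain g c where g: "path g" "path_image g \<subseteq> W_over T" "pathstart g = (w, p, q)" "c \<noteq> 0"
      "pathfinish g = scale c (w, p, q)" and lg: "\<forall>\<^sub>F n in sequentially. loop_winding n g = 2 ^ n / 2 ^ k"
      by (elim exE conjE)
    have gW: "path_image g \<subseteq> W_lift" using g(2) by (auto simp: W_over_def)
    have "pathfinish g = scale c (pathstart g)" using g(3,5) by simp
    note s = loop_simplex[OF g(1) gW g(4) this]
    show "\<exists>\<sigma>. singular_simplex 1 (subtopology P1xP1 (W_1 B)) \<sigma> \<and> \<sigma> (edge 0) = \<sigma> (edge 1) \<and>
        (\<forall>\<^sub>F n in sequentially. edge_winding (Z_down n) \<sigma> = 2 ^ n / 2 ^ k)"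
      using s lg by (intro exI[of _ "restrict (\<lambda>x. proj (g (x 1))) (standard_simplex 1)"]) simp
  qed (use simplex_eventually_tame in \<open>blast intro: eventually_mono\<close>)+
qed

end
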